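(* Let $0<\beta<1$, $H\in(1/2,1)$ and let $h\in\mathcal{H}_H$. Then: 1. For every $T>0$ the measures $\mu_{\beta,2H,T}^h$ and $\mu_{\beta,2H,T}$ are equivalent (mutually absolutely continuous), and the Radon-Nikodym density, regarded as a random variable on $\mathbb{W}\times\mathbb{R}^+$ by composition with $X_{\beta,2H,T}$, is given $\mathbb{P}_H\otimes\mathbb{P}_{Y_\beta}$-a.s. by $$\frac{\mathrm{d}\mu_{\beta,2H,T}^h}{\mathrm{d}\mu_{\beta,2H,T}}(X_{\beta,2H,T})=\exp\left(\int_0^t h(s)\,\mathrm{d}W^H(s)-\frac12\|h\|^2_{\mathcal{H}_H(t)}\right)\bigg|_{t=T\mathcal{Y}_\beta^{1/(2H)}}=\mathcal{E}\left(\int_0^\cdot\dot h(s)\,\mathrm{d}\widetilde W(s)\right)\big(T\mathcal{Y}_\beta^{1/(2H)}\big).$$ 2. The measures $\mu_{\beta,2H}^h$ and $\mu_{\beta,2H}$ are equivalent, and the Radon-Nikodym density, regarded as a random variable on $\mathbb{W}\times\mathbb{R}^+$ by composition with $X_{\beta,2H}$, is given $\mathbb{P}_H\otimes\mathbb{P}_{Y_\beta}$-a.s. by $$\frac{\mathrm{d}\mu_{\beta,2H}^h}{\mathrm{d}\mu_{\beta,2H}}(X_{\beta,2H})=\exp\left(\int_0^\infty h(s)\,\mathrm{d}W^H(s)-\frac12\|h\|^2_{\mathcal{H}_H}\right)=\mathcal{E}\left(\int_0^\cdot\dot h(s)\,\mathrm{d}\widetilde W(s)\right)(\infty).$$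
   Context: $\mathbb{R}^+=[0,\infty)$. $\mathbb{W}$ is the space of continuous $w:\mathbb{R}^+\to\mathbb{R}$ with $w(0)=0$, with the topology of locally uniform convergence and Borel $\sigma$-algebra $\mathcal{B}(\mathbb{W})$; $\mathbb{W}_T$ is the space of restrictions to $[0,T]$ of elements of $\mathbb{W}$. $\mathbb{P}_H$ is the unique probability measure on $\mathbb{W}$ under which the canonical process $W^H(t)(w)=w(t)$ is a fractional Brownian motion with Hurst index $H$, i.e. centered Gaussian with covariance $R_H(t,s)=\frac12(t^{2H}+s^{2H}-|t-s|^{2H})$. $\mathbb{P}_{Y_\beta}$ is the probability measure on $\mathbb{R}^+$ with density $M_\beta$ determined by $\int_0^\infty e^{-s\tau}M_\beta(\tau)\,d\tau=E_\beta(-s)$, $s\ge0$, with $E_\beta(z)=\sum_{n\ge0}z^n/\Gamma(\beta n+1)$. $\mathcal{Y}_\beta(\tau)=\tau$ is the identity map on $\mathbb{R}^+$. Kernel: for $H\in(1/2,1)$, $$K_H(t,r)=c_H\,r^{1/2-H}\int_r^tu^{H-1/2}(u-r)^{H-3/2}\,\mathrm{d}u\;\mathbf{1}_{(0,t]}(r),\qquad c_H=\Big(\frac{H(2H-1)\,\Gamma(3/2-H)}{ \Gamma(2-2H)\,\Gamma(H-1/2)}\Big)^{1/2},$$ so that $R_H(t,s)=\int_0^{t\wedge s}K_H(t,r)K_H(s,r)\,\mathrm{d}r$. The operator $(\mathcal{K}_Hf)(t)=\int_0^tK_H(t,s)f(s)\,\mathrm{d}s$ is injective on $L^2(\lambda)=L^2(\mathbb{R}^+,\text{Lebesgue})$.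 The Cameron--Martin space is $\mathcal{H}_H=\mathcal{K}_H(L^2(\lambda))$; for $h\in\mathcal{H}_H$, $\dot h:=\mathcal{K}_H^{-1}h\in L^2(\lambda)$, and $(h,g)_{\mathcal{H}_H}=\int_0^\infty\dot h\dot g\,\mathrm{d}\lambda$. For $t>0$, $\|h\|^2_{\mathcal{H}_H(t)}=\int_0^t|\dot h(s)|^2\,\mathrm{d}s$. Wiener integral: $\delta_H:\mathcal{H}_H\to L^2(\mathbb{P}_H)$ is the linear isometry extending $R_H(t,\cdot)\mapsto W^H(t)$, $t\ge0$. $\widetilde W(t)=\delta_H(\mathcal{K}_H(\mathbf{1}_{[0,t]}))$ (continuous version) is a standard Brownian motion under $\mathbb{P}_H$, and $W^H(t)=\int_0^tK_H(t,s)\,\mathrm{d}\widetilde W(s)$. One sets $\int_0^\infty h\,\mathrm{d}W^H=\delta_H(h)=\int_0^\infty\dot h\,\mathrm{d}\widetilde W$ and $\int_0^th\,\mathrm{d}W^H:=\int_0^t\dot h\,\mathrm{d}\widetilde W$. Moreover $\mathcal{E}\big(\int_0^\cdot\dot h\,\mathrm{d}\widetilde W\big)(t)=\exp\big(\int_0^t\dot h\,\mathrm{d}\widetilde W-\frac12\int_0^t|\dot h|^2\,\mathrm{d}s\big)$ for $t\in[0,\infty]$ (continuous version in $t$); evaluation at $t=T\mathcal{Y}_\beta^{1/(2H)}$ means the random variable $(w,\tau)\mapsto$ value at $t=T\tau^{1/(2H)}$ for the path $w$. On $(\mathbb{W}\times\mathbb{R}^+,\mathcal{B}(\mathbb{W})\otimes\mathcal{B}(\mathbb{R}^+),\mathbb{P}_H\otimes\mathbb{P}_{Y_\beta})$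 the generalized grey Brownian motion is $X_{\beta,2H}(t)(w,\tau)=w(t\tau^{1/(2H)})$, and $X_{\beta,2H}^h(t)(w,\tau)=w(t\tau^{1/(2H)})+h(t\tau^{1/(2H)})$. Their laws on $\mathbb{W}$ are $\mu_{\beta,2H}$ and $\mu_{\beta,2H}^h$; the laws on $\mathbb{W}_T$ of their restrictions $X_{\beta,2H,T}$, $X^h_{\beta,2H,T}$ to $t\in[0,T]$ are $\mu_{\beta,2H,T}$ and $\mu_{\beta,2H,T}^h$. *)

theory Defs
  imports "HOL-Probability.Probability"
begin

section \<open>Path spaces\<close>

text \<open>
  Functions on an index set \<open>I\<close> of times are represented as \<^const>\<open>extensional\<close> functions on
  \<open>I\<close>. Thus \<open>path_space {0..}\<close> is the space W of all paths, and \<open>path_space {0..T}\<close> is the space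
  of restrictions of such paths (lemma \<open>path_space_eq_restrictions\<close>).
\<close>

definition path_space :: "real set \<Rightarrow> (real \<Rightarrow> real) set" where
  "path_space I = {w \<in> extensional I. continuous_on I w \<and> w 0 = 0}"

text \<open>
  Locally uniform convergence on a closed interval is uniform convergence on compact subsets; see
  lemma \<open>limitin_path_topology\<close>. For compact \<open>I\<close> it is uniform convergence on \<open>I\<close>.
\<close>

definition path_open :: "real set \<Rightarrow> (real \<Rightarrow> real) set \<Rightarrow> bool" where
  "path_open I U \<longleftrightarrow> U \<subseteq> path_space I \<and>
     (\<forall>w\<in>U. \<exists>K e. compact K \<and> K \<subseteq> I \<and> e > 0 \<and>
        (\<forall>v\<in>path_space I. (\<forall>t\<in>K. \<bar>v t - w t\<bar> < e) \<longrightarrow> v \<in> U))"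

definition path_topology :: "real set \<Rightarrow> (real \<Rightarrow> real) topology" where
  "path_topology I = topology (path_open I)"

definition path_borel :: "real set \<Rightarrow> (real \<Rightarrow> real) measure" where
  "path_borel I = sigma (path_space I) {U. openin (path_topology I) U}"

lemma istopology_path_open: "istopology (path_open I)"
  unfolding istopology_def
proof (intro conjI allI impI)
  fix S T assume S: "path_open I S" and T: "path_open I T"
  show "path_open I (S \<inter> T)"
    unfolding path_open_def
  proof (intro conjI ballI)
    show "S \<inter> T \<subseteq> path_space I" using S by (auto simp: path_open_def)
  next
    fix w assume w: "w \<in> S \<inter> T"
    obtain K e where 1: "compact K" "K \<subseteq> I" "e > 0"
      "\<forall>v\<in>path_space I. (\<forall>t\<in>K. \<bar>v t - w t\<bar> < e) \<longrightarrow> v \<in> S"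
      using S w unfolding path_open_def by blast
    obtain L d where 2: "compact L" "L \<subseteq> I" "d > 0"
      "\<forall>v\<in>path_space I. (\<forall>t\<in>L. \<bar>v t - w t\<bar> < d) \<longrightarrow> v \<in> T"
      using T w unfolding path_open_def by blast
    show "\<exists>K e. compact K \<and> K \<subseteq> I \<and> e > 0 \<and>
        (\<forall>v\<in>path_space I. (\<forall>t\<in>K. \<bar>v t - w t\<bar> < e) \<longrightarrow> v \<in> S \<inter> T)"
      using 1 2 by (intro exI[of _ "K \<union> L"] exI[of _ "min e d"]) (simp add: compact_Un)
  qed
next
  fix \<U> assume \<U>: "\<forall>U\<in>\<U>. path_open I U"
  show "path_open I (\<Union>\<U>)"
    unfolding path_open_def
  proof (intro conjI ballI)
    show "\<Union>\<U> \<subseteq> path_space I" using \<U> by (auto simp: path_open_def)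
  next
    fix w assume "w \<in> \<Union>\<U>"
    then obtain U where U: "U \<in> \<U>" "w \<in> U" by blast
    have "path_open I U" using \<U> U(1) by simp
    then obtain K e where 1: "compact K" "K \<subseteq> I" "e > 0"
      "\<forall>v\<in>path_space I. (\<forall>t\<in>K. \<bar>v t - w t\<bar> < e) \<longrightarrow> v \<in> U"
      using U(2) unfolding path_open_def by blast
    show "\<exists>K e. compact K \<and> K \<subseteq> I \<and> e > 0 \<and>
        (\<forall>v\<in>path_space I. (\<forall>t\<in>K. \<bar>v t - w t\<bar> < e) \<longrightarrow> v \<in> \<Union>\<U>)"
    proof (intro exI conjI ballI impI)
      fix v assume "v \<in> path_space I" "\<forall>t\<in>K. \<bar>v t - w t\<bar> < e"
      then have "v \<in> U" using 1(4) by simp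
      then show "v \<in> \<Union>\<U>" using U(1) by (rule UnionI[rotated])
    qed (use 1 in simp_all)
  qed
qed

lemma openin_path_topology: "openin (path_topology I) U \<longleftrightarrow> path_open I U"
  by (simp add: path_topology_def istopology_path_open)

lemma topspace_path_topology: "topspace (path_topology I) = path_space I"
proof -
  have "path_open I (path_space I)"
    unfolding path_open_def by (auto intro!: exI[of _ "{}"] exI[of _ "1::real"])
  then show ?thesis
    unfolding topspace_def openin_path_topology by (auto simp: path_open_def)
qed

lemma limitin_path_topology:
  "limitin (path_topology I) f w F \<longleftrightarrow>
     w \<in> path_space I \<and> (\<forall>\<^sub>F n in F. f n \<in> path_space I) \<and>
     (\<forall>K. compact K \<and> K \<subseteq> I \<longrightarrow> uniform_limit K f w F)"
  (is "?L \<longleftrightarrow> ?R")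
proof
  assume L: ?L
  have w: "w \<in> path_space I" using L by (simp add: limitin_def topspace_path_topology)
  have "\<forall>\<^sub>F n in F. f n \<in> path_space I"
    using L w unfolding limitin_def
    by (metis openin_topspace topspace_path_topology)
  moreover have "uniform_limit K f w F" if K: "compact K" "K \<subseteq> I" for K
  proof (rule uniform_limitI)
    fix e :: real assume e: "e > 0"
    define U where "U = {v \<in> path_space I. \<forall>t\<in>K. \<bar>v t - w t\<bar> < e}"
    have "path_open I U"
      unfolding path_open_def
    proof (intro conjI ballI)
      show "U \<subseteq> path_space I" by (auto simp: U_def)
      fix v assume v: "v \<in> U"
      show "\<exists>K e. compact K \<and> K \<subseteq> I \<and> e > 0 \<and>
        (\<forall>u\<in>path_space I. (\<forall>t\<in>K. \<bar>u t - v t\<bar> < e) \<longrightarrow> u \<in> U)"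
      proof (cases "K = {}")
        case True
        then show ?thesis by (auto simp: U_def intro!: exI[of _ "{}"] exI[of _ "1::real"])
      next
        case False
        have "continuous_on K (\<lambda>t. \<bar>v t - w t\<bar>)"
          using v w K by (auto simp: U_def path_space_def intro!: continuous_intros
              intro: continuous_on_subset)
        then obtain m where m: "m \<in> K" "\<forall>t\<in>K. \<bar>v t - w t\<bar> \<le> \<bar>v m - w m\<bar>"
          using continuous_attains_sup[OF K(1) False] by blast
        have "\<bar>v m - w m\<bar> < e" using v m by (auto simp: U_def)
        moreover have "u \<in> U"
          if "u \<in> path_space I" "\<forall>t\<in>K. \<bar>u t - v t\<bar> < e - \<bar>v m - w m\<bar>" for u
          using that m by (fastforce simp: U_def)
        ultimately show ?thesis
          using K by (intro exI[of _ K] exI[of _ "e - \<bar>v m - w m\<bar>"]) auto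
      qed
    qed
    moreover have "w \<in> U" using w e by (auto simp: U_def)
    ultimately have "\<forall>\<^sub>F n in F. f n \<in> U"
      using L by (auto simp: limitin_def openin_path_topology)
    then show "\<forall>\<^sub>F n in F. \<forall>t\<in>K. dist (f n t) (w t) < e"
      by eventually_elim (auto simp: U_def dist_real_def)
  qed
  ultimately show ?R using w by blast
next
  assume R: ?R
  show ?L
    unfolding limitin_def topspace_path_topology openin_path_topology
  proof (intro conjI allI impI)
    show "w \<in> path_space I" using R by blast
    fix U assume U: "path_open I U \<and> w \<in> U"
    then obtain K e where K: "compact K" "K \<subseteq> I" "e > 0"
      "\<forall>v\<in>path_space I. (\<forall>t\<in>K. \<bar>v t - w t\<bar> < e) \<longrightarrow> v \<in> U"
      unfolding path_open_def by blast
    have "\<forall>\<^sub>F n in F. \<forall>t\<in>K. dist (f n t) (w t) < e"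
      using R K by (auto simp: uniform_limit_iff)
    moreover have "\<forall>\<^sub>F n in F. f n \<in> path_space I" using R by blast
    ultimately show "\<forall>\<^sub>F n in F. f n \<in> U"
      by eventually_elim (use K(4) in \<open>auto simp: dist_real_def\<close>)
  qed
qed

lemma path_space_eq_restrictions:
  assumes "T \<ge> 0"
  shows "path_space {0..T} = (\<lambda>w. restrict w {0..T}) ` path_space {0..}"
proof (intro equalityI subsetI)
  fix w assume w: "w \<in> path_space {0..T}"
  define v where "v = restrict (\<lambda>t. w (min t T)) {0..}"
  have "continuous_on {0..T} w" using w by (simp add: path_space_def)
  moreover have "continuous_on {0..} (\<lambda>t. min t T)"
    by (intro continuous_on_min continuous_on_id continuous_on_const)
  moreover have "(\<lambda>t. min t T) ` {0..} \<subseteq> {0..T}"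
    using assms by (simp add: image_subset_iff)
  ultimately have "continuous_on {0..} (\<lambda>t. w (min t T))"
    by (rule continuous_on_compose2)
  then have "continuous_on {0..} v"
    by (rule continuous_on_eq) (simp add: v_def)
  then have "v \<in> path_space {0..}"
    using w assms by (simp add: v_def path_space_def)
  moreover have "w = restrict v {0..T}"
  proof
    fix t show "w t = restrict v {0..T} t"
      using w by (simp add: v_def path_space_def extensional_def restrict_def)
  qed
  ultimately show "w \<in> (\<lambda>w. restrict w {0..T}) ` path_space {0..}"
    by (intro image_eqI[of w _ v])
next
  fix w assume "w \<in> (\<lambda>w. restrict w {0..T}) ` path_space {0..}"
  then obtain v where v: "v \<in> path_space {0..}" and w: "w = restrict v {0..T}" by (rule imageE)
  have "continuous_on {0..} v" using v by (simp add: path_space_def)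
  then have "continuous_on {0..T} v" by (rule continuous_on_subset) simp
  then have "continuous_on {0..T} w"
    by (rule continuous_on_eq) (simp add: w)
  then show "w \<in> path_space {0..T}"
    using v w assms by (simp add: path_space_def)
qed

section \<open>Square-integrable functions\<close>

abbreviation lborel_pos :: "real measure" where
  "lborel_pos \<equiv> restrict_space lborel {0..}"

text \<open>Functions, not classes modulo null sets.\<close>

definition L2 :: "'a measure \<Rightarrow> ('a \<Rightarrow> real) set" where
  "L2 M = {f \<in> borel_measurable M. integrable M (\<lambda>x. (f x)\<^sup>2)}"

section \<open>Fractional Brownian motion\<close>

definition R_cov :: "real \<Rightarrow> real \<Rightarrow> real \<Rightarrow> real" where
  "R_cov H t s = (t powr (2 * H) + s powr (2 * H) - \<bar>t - s\<bar> powr (2 * H)) / 2"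

text \<open>The law of \<open>X\<close> is N(0,v), where N(0,0) is the Dirac measure at 0.\<close>

definition centered_normal :: "'a measure \<Rightarrow> ('a \<Rightarrow> real) \<Rightarrow> real \<Rightarrow> bool" where
  "centered_normal M X v \<longleftrightarrow> X \<in> borel_measurable M \<and>
     (if v = 0 then AE x in M. X x = 0
      else v > 0 \<and> distributed M lborel X (normal_density 0 (sqrt v)))"

text \<open>\<open>P\<close> is the law on the path space under which the canonical process is fBm.\<close>

definition fbm_law :: "real \<Rightarrow> (real \<Rightarrow> real) measure \<Rightarrow> bool" where
  "fbm_law H P \<longleftrightarrow> prob_space P \<and> sets P = sets (path_borel {0..}) \<and>
     (\<forall>J a. finite J \<and> J \<subseteq> {0..} \<longrightarrow> (\<exists>v. centered_normal P (\<lambda>w. \<Sum>t\<in>J. a t * w t) v)) \<and>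
     (\<forall>t\<ge>0. \<forall>s\<ge>0. (LINT w|P. w t * w s) = R_cov H t s)"

section \<open>The random time\<close>

definition mittag_leffler :: "real \<Rightarrow> real \<Rightarrow> real" where
  "mittag_leffler \<beta> z = (\<Sum>n. z ^ n / Gamma (\<beta> * real n + 1))"

definition is_M_density :: "real \<Rightarrow> (real \<Rightarrow> real) \<Rightarrow> bool" where
  "is_M_density \<beta> M \<longleftrightarrow> (\<forall>\<tau>\<ge>0. M \<tau> \<ge> 0) \<and>
     (\<forall>s\<ge>0. has_bochner_integral lborel_pos (\<lambda>\<tau>. exp (- s * \<tau>) * M \<tau>) (mittag_leffler \<beta> (- s)))"

definition Y_law :: "(real \<Rightarrow> real) \<Rightarrow> real measure" where
  "Y_law M = density lborel_pos (\<lambda>\<tau>. ennreal (M \<tau>))"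

section \<open>Kernel and Cameron--Martin space\<close>

definition c_const :: "real \<Rightarrow> real" where
  "c_const H = sqrt (H * (2 * H - 1) * Gamma (3/2 - H) / (Gamma (2 - 2 * H) * Gamma (H - 1/2)))"

definition K_kernel :: "real \<Rightarrow> real \<Rightarrow> real \<Rightarrow> real" where
  "K_kernel H t r = c_const H * r powr (1/2 - H) *
     (LINT u:{r..t}|lborel. u powr (H - 1/2) * (u - r) powr (H - 3/2)) * indicator {0<..t} r"

definition K_op :: "real \<Rightarrow> (real \<Rightarrow> real) \<Rightarrow> (real \<Rightarrow> real)" where
  "K_op H f = (\<lambda>t\<in>{0..}. LINT s:{0..t}|lborel. K_kernel H t s * f s)"

definition CM_space :: "real \<Rightarrow> (real \<Rightarrow> real) set" where
  "CM_space H = K_op H ` L2 lborel_pos"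

text \<open>
  \<^term>\<open>K_op H\<close> is injective on \<^term>\<open>L2 lborel_pos\<close> only up to equality almost everywhere;
  \<open>CM_dot H h\<close> is a representative of the class of preimages of \<open>h\<close>.
\<close>

definition CM_dot :: "real \<Rightarrow> (real \<Rightarrow> real) \<Rightarrow> (real \<Rightarrow> real)" where
  "CM_dot H h = inv_into (L2 lborel_pos) (K_op H) h"

definition CM_inner :: "real \<Rightarrow> (real \<Rightarrow> real) \<Rightarrow> (real \<Rightarrow> real) \<Rightarrow> real" where
  "CM_inner H h g = (LINT s|lborel_pos. CM_dot H h s * CM_dot H g s)"

definition CM_normsq :: "real \<Rightarrow> (real \<Rightarrow> real) \<Rightarrow> real" where
  "CM_normsq H h = CM_inner H h h"

definition CM_normsq_upto :: "real \<Rightarrow> (real \<Rightarrow> real) \<Rightarrow> real \<Rightarrow> real" where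
  "CM_normsq_upto H h t = (LINT s:{0..t}|lborel. \<bar>CM_dot H h s\<bar>\<^sup>2)"

section \<open>Wiener integrals\<close>

text \<open>
  \<open>\<delta>\<close> is (a choice of representatives of) the linear isometry from the Cameron--Martin space into
  \<open>L\<^sup>2(P)\<close> that maps \<open>R_cov H t\<close> to the value of the canonical process at time \<open>t\<close>.
\<close>

definition is_wiener_isometry ::
    "real \<Rightarrow> (real \<Rightarrow> real) measure \<Rightarrow> ((real \<Rightarrow> real) \<Rightarrow> (real \<Rightarrow> real) \<Rightarrow> real) \<Rightarrow> bool" where
  "is_wiener_isometry H P \<delta> \<longleftrightarrow>
     (\<forall>h\<in>CM_space H. \<delta> h \<in> L2 P) \<and>
     (\<forall>h\<in>CM_space H. \<forall>g\<in>CM_space H. \<forall>a b.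
        AE w in P. \<delta> (\<lambda>s\<in>{0..}. a * h s + b * g s) w = a * \<delta> h w + b * \<delta> g w) \<and>
     (\<forall>h\<in>CM_space H. (LINT w|P. (\<delta> h w)\<^sup>2) = CM_normsq H h) \<and>
     (\<forall>t\<ge>0. AE w in P. \<delta> (\<lambda>s\<in>{0..}. R_cov H t s) w = w t)"

text \<open>\<open>B\<close> is a continuous version of the process \<open>t \<mapsto> \<delta> (K_op H 1\<^bsub>[0,t]\<^esub>)\<close>.\<close>

definition is_underlying_bm ::
    "real \<Rightarrow> (real \<Rightarrow> real) measure \<Rightarrow> ((real \<Rightarrow> real) \<Rightarrow> (real \<Rightarrow> real) \<Rightarrow> real) \<Rightarrow>
     (real \<Rightarrow> (real \<Rightarrow> real) \<Rightarrow> real) \<Rightarrow> bool" where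
  "is_underlying_bm H P \<delta> B \<longleftrightarrow>
     (\<forall>t\<ge>0. B t \<in> borel_measurable P \<and> (AE w in P. B t w = \<delta> (K_op H (indicator {0..t})) w)) \<and>
     (AE w in P. continuous_on {0..} (\<lambda>t. B t w))"

definition step_fun :: "nat \<Rightarrow> (nat \<Rightarrow> real) \<Rightarrow> (nat \<Rightarrow> real) \<Rightarrow> real \<Rightarrow> real" where
  "step_fun n p a s = (\<Sum>i<n. a i * indicator {p i<..p (Suc i)} s)"

definition step_integral ::
    "(real \<Rightarrow> 'a \<Rightarrow> real) \<Rightarrow> nat \<Rightarrow> (nat \<Rightarrow> real) \<Rightarrow> (nat \<Rightarrow> real) \<Rightarrow> 'a \<Rightarrow> real" where
  "step_integral B n p a w = (\<Sum>i<n. a i * (B (p (Suc i)) w - B (p i) w))"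

text \<open>
  \<open>X\<close> is a version of the stochastic integral over \<open>[0,\<infinity>)\<close> of the deterministic integrand \<open>f\<close> with
  respect to \<open>B\<close>, as the \<open>L\<^sup>2\<close>-limit of integrals of step functions.
\<close>

definition has_wiener_integral ::
    "'a measure \<Rightarrow> (real \<Rightarrow> 'a \<Rightarrow> real) \<Rightarrow> (real \<Rightarrow> real) \<Rightarrow> ('a \<Rightarrow> real) \<Rightarrow> bool" where
  "has_wiener_integral P B f X \<longleftrightarrow> f \<in> L2 lborel_pos \<and> X \<in> L2 P \<and>
     (\<exists>n p a. (\<forall>k. 0 \<le> p k 0 \<and> mono (p k)) \<and>
        (\<lambda>k. \<integral>\<^sup>+ s. ennreal ((step_fun (n k) (p k) (a k) s - f s)\<^sup>2) \<partial>lborel_pos) \<longlonglongrightarrow> 0 \<and>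
        (\<lambda>k. \<integral>\<^sup>+ w. ennreal ((step_integral B (n k) (p k) (a k) w - X w)\<^sup>2) \<partial>P) \<longlonglongrightarrow> 0)"

text \<open>
  \<open>Z\<close> is a continuous version of \<open>t \<mapsto> \<integral>\<^sub>0\<^sup>t f dB\<close>, \<open>t \<in> [0,\<infinity>]\<close>. Times in \<open>[0,\<infinity>]\<close> have type
  \<^typ>\<open>ennreal\<close>, so continuity includes convergence as \<open>t\<close> tends to \<open>\<infinity>\<close>.
\<close>

definition is_integral_process ::
    "'a measure \<Rightarrow> (real \<Rightarrow> 'a \<Rightarrow> real) \<Rightarrow> (real \<Rightarrow> real) \<Rightarrow> (ennreal \<Rightarrow> 'a \<Rightarrow> real) \<Rightarrow> bool" where
  "is_integral_process P B f Z \<longleftrightarrow>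
     (\<forall>t. has_wiener_integral P B (\<lambda>s. f s * indicator {s. ennreal s \<le> t} s) (Z t)) \<and>
     (AE w in P. continuous_on UNIV (\<lambda>t. Z t w))"

text \<open>The stochastic exponential of \<open>Z t = \<integral>\<^sub>0\<^sup>t f dB\<close>, where \<open>B\<close> is a Brownian motion.\<close>

definition stoch_exp ::
    "(real \<Rightarrow> real) \<Rightarrow> (ennreal \<Rightarrow> 'a \<Rightarrow> real) \<Rightarrow> ennreal \<Rightarrow> 'a \<Rightarrow> real" where
  "stoch_exp f Z t w =
     exp (Z t w - 1/2 * (LINT s|lborel_pos. indicator {s. ennreal s \<le> t} s * \<bar>f s\<bar>\<^sup>2))"

section \<open>Generalized grey Brownian motion\<close>

definition ggbm :: "real \<Rightarrow> (real \<Rightarrow> real) \<times> real \<Rightarrow> (real \<Rightarrow> real)" where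
  "ggbm H = (\<lambda>(w, \<tau>). \<lambda>t\<in>{0..}. w (t * \<tau> powr (1 / (2 * H))))"

definition ggbm_shift :: "real \<Rightarrow> (real \<Rightarrow> real) \<Rightarrow> (real \<Rightarrow> real) \<times> real \<Rightarrow> (real \<Rightarrow> real)" where
  "ggbm_shift H h = (\<lambda>(w, \<tau>). \<lambda>t\<in>{0..}.
     w (t * \<tau> powr (1 / (2 * H))) + h (t * \<tau> powr (1 / (2 * H))))"

definition ggbm_upto :: "real \<Rightarrow> real \<Rightarrow> (real \<Rightarrow> real) \<times> real \<Rightarrow> (real \<Rightarrow> real)" where
  "ggbm_upto H T x = restrict (ggbm H x) {0..T}"

definition ggbm_shift_upto ::
    "real \<Rightarrow> (real \<Rightarrow> real) \<Rightarrow> real \<Rightarrow> (real \<Rightarrow> real) \<times> real \<Rightarrow> (real \<Rightarrow> real)" where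
  "ggbm_shift_upto H h T x = restrict (ggbm_shift H h x) {0..T}"

text \<open>In the laws below, \<open>Q\<close> is the product measure on paths and random times.\<close>

definition mu :: "((real \<Rightarrow> real) \<times> real) measure \<Rightarrow> real \<Rightarrow> (real \<Rightarrow> real) measure" where
  "mu Q H = distr Q (path_borel {0..}) (ggbm H)"

definition mu_shift ::
    "((real \<Rightarrow> real) \<times> real) measure \<Rightarrow> real \<Rightarrow> (real \<Rightarrow> real) \<Rightarrow> (real \<Rightarrow> real) measure" where
  "mu_shift Q H h = distr Q (path_borel {0..}) (ggbm_shift H h)"

definition mu_upto ::
    "((real \<Rightarrow> real) \<times> real) measure \<Rightarrow> real \<Rightarrow> real \<Rightarrow> (real \<Rightarrow> real) measure" where
  "mu_upto Q H T = distr Q (path_borel {0..T}) (ggbm_upto H T)"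

definition mu_shift_upto ::
    "((real \<Rightarrow> real) \<times> real) measure \<Rightarrow> real \<Rightarrow> (real \<Rightarrow> real) \<Rightarrow> real \<Rightarrow> (real \<Rightarrow> real) measure" where
  "mu_shift_upto Q H h T = distr Q (path_borel {0..T}) (ggbm_shift_upto H h T)"

definition equivalent_measures :: "'a measure \<Rightarrow> 'a measure \<Rightarrow> bool" where
  "equivalent_measures \<mu> \<nu> \<longleftrightarrow>
     sets \<mu> = sets \<nu> \<and> absolutely_continuous \<mu> \<nu> \<and> absolutely_continuous \<nu> \<mu>"

end

theory Submission
  imports Defs
begin

text \<open>
  Why the theorem holds. Freeze the value \<open>\<tau>\<close> of the random time. The observed path is then the
  fractional Brownian motion, run at a deterministic speed, and the shift by \<open>h = K_op H f\<close> is the shift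
  of the Cameron--Martin theorem (theorem \<open>Cameron_Martin\<close>): it has the density
  \<open>exp (\<delta> h - \<parallel>f\<parallel>\<^sup>2 / 2)\<close> with respect to the law of the fractional Brownian motion. If the path is
  observed up to time \<open>T\<close> only, it is used up to time \<open>T * \<tau> powr (1 / (2 * H))\<close>. Up to this time \<open>h\<close>
  agrees with the shift that belongs to the truncated integrand (lemma \<open>truncated_K_op\<close>), which
  explains the random upper limit of the integral in the density. Integration over \<open>\<tau>\<close> gives a density
  on the product space (lemma \<open>shifted_law\<close>).
  
  This density is a function of the pair \<open>(w, \<tau>)\<close>, whereas a density of the laws has to be a function of
  the observed path. So it must factor through the observation
  (lemma \<open>equivalent_of_factored_density\<close>). It does, because the observed path determines \<open>\<tau>\<close>: the
  mean of the cosines of its rescaled increments tends to \<open>exp (- \<tau> / 2)\<close>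
  (lemma \<open>random_time_recovered\<close>). For \<open>H > 1/2\<close> the increments are nonnegatively correlated, and
  then the variance of that mean is bounded by the variance of the sum of the increments,
  which telescopes (lemma \<open>mean_cos_increments_variance\<close>). Knowing \<open>\<tau>\<close>, one undoes the time change
  and recovers \<open>w\<close> up to the observed time, and the Wiener integral up to that time is a functional
  of this piece of \<open>w\<close> (lemmas \<open>wiener_adapted\<close> and \<open>integral_process_functional\<close>).
  
  Three facts about the kernel carry the theory of Wiener integrals. The covariance factors as
  \<open>R_cov H t s = \<integral> K_kernel H t r * K_kernel H s r dr\<close> (lemma \<open>kernel_covariance\<close>), so the evaluation
  at time \<open>t\<close> is the Wiener integral of \<open>K_kernel H t\<close>. The operator is injective on every interval
  \<open>[0,q]\<close>, which is Abel's integral equation (lemma \<open>K_op_injective\<close>). By orthogonal projection,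
  injectivity means that the kernels \<open>K_kernel H t\<close> with \<open>t \<le> q\<close> span a dense subspace of the square
  integrable functions on \<open>[0,q]\<close> (lemma \<open>kernel_span_dense\<close>). Density makes all Wiener integrals
  Gaussian, and adapted to the path. Gaussian laws are used through the integrals of
  \<open>cos (X + \<theta>)\<close> alone, and measures on path space are determined by such integrals for the linear
  combinations \<open>X\<close> of evaluations (lemma \<open>path_measure_eqI_cos\<close>).
\<close>

section \<open>Square-integrable functions\<close>

lemma L2_mult_integrable:
  assumes "f \<in> L2 M" "g \<in> L2 M"
  shows "integrable M (\<lambda>x. f x * g x)"
proof (rule Bochner_Integration.integrable_bound)
  show "integrable M (\<lambda>x. (f x)\<^sup>2 + (g x)\<^sup>2)" using assms by (auto simp: L2_def)
  show "(\<lambda>x. f x * g x) \<in> borel_measurable M" using assms by (auto simp: L2_def)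
  have "\<bar>a * b\<bar> \<le> a\<^sup>2 + b\<^sup>2" for a b :: real
  proof -
    have "0 \<le> (\<bar>a\<bar> - \<bar>b\<bar>)\<^sup>2" by auto
    then have "2 * \<bar>a * b\<bar> \<le> a\<^sup>2 + b\<^sup>2" by (simp add: power2_eq_square algebra_simps abs_mult)
    then show ?thesis by linarith
  qed
  then show "AE x in M. norm (f x * g x) \<le> norm ((f x)\<^sup>2 + (g x)\<^sup>2)" by simp
qed

lemma L2_lincomb:
  assumes "f \<in> L2 M" "g \<in> L2 M"
  shows "(\<lambda>x. a * f x + b * g x) \<in> L2 M"
proof -
  have "integrable M (\<lambda>x. a\<^sup>2 * (f x)\<^sup>2 + 2 * a * b * (f x * g x) + b\<^sup>2 * (g x)\<^sup>2)"
    using assms L2_mult_integrable[OF assms] by (auto simp: L2_def)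
  also have "(\<lambda>x. a\<^sup>2 * (f x)\<^sup>2 + 2 * a * b * (f x * g x) + b\<^sup>2 * (g x)\<^sup>2)
      = (\<lambda>x. (a * f x + b * g x)\<^sup>2)"
    by (auto simp: power2_eq_square algebra_simps)
  finally show ?thesis using assms by (auto simp: L2_def)
qed

lemma L2_zero: "(\<lambda>x. 0) \<in> L2 M"
  by (simp add: L2_def)

lemma L2_diff: "f \<in> L2 M \<Longrightarrow> g \<in> L2 M \<Longrightarrow> (\<lambda>x. f x - g x) \<in> L2 M"
  using L2_lincomb[of f M g 1 "-1"] by simp

lemma L2_add: "f \<in> L2 M \<Longrightarrow> g \<in> L2 M \<Longrightarrow> (\<lambda>x. f x + g x) \<in> L2 M"
  using L2_lincomb[of f M g 1 "1"] by simp

lemma L2_cmult: "f \<in> L2 M \<Longrightarrow> (\<lambda>x. a * f x) \<in> L2 M"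
  using L2_lincomb[of f M f a "0"] by simp

lemma L2_sum:
  assumes "\<And>i. i \<in> J \<Longrightarrow> f i \<in> L2 M"
  shows "(\<lambda>x. \<Sum>i\<in>J. a i * f i x) \<in> L2 M"
  using assms
proof (induction J rule: infinite_finite_induct)
  case (insert i J)
  then show ?case
    using L2_lincomb[of "f i" M "\<lambda>x. \<Sum>i\<in>J. a i * f i x" "a i" 1] by simp
qed (auto simp: L2_zero)

lemma L2_integral_lincomb_square:
  assumes "f \<in> L2 M" "g \<in> L2 M"
  shows "(LINT x|M. (a * f x + b * g x)\<^sup>2)
    = a\<^sup>2 * (LINT x|M. (f x)\<^sup>2) + 2 * a * b * (LINT x|M. f x * g x) + b\<^sup>2 * (LINT x|M. (g x)\<^sup>2)"
proof -
  have "(\<lambda>x. (a * f x + b * g x)\<^sup>2) = (\<lambda>x. a\<^sup>2 * (f x)\<^sup>2 + 2 * a * b * (f x * g x) + b\<^sup>2 * (g x)\<^sup>2)"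
    by (auto simp: power2_eq_square algebra_simps)
  then show ?thesis
    using assms L2_mult_integrable[OF assms] by (simp add: L2_def)
qed

lemma L2_Cauchy_Schwarz:
  assumes "f \<in> L2 M" "g \<in> L2 M"
  shows "(LINT x|M. f x * g x)\<^sup>2 \<le> (LINT x|M. (f x)\<^sup>2) * (LINT x|M. (g x)\<^sup>2)"
proof -
  define A B C where "A = (LINT x|M. (f x)\<^sup>2)" and "B = (LINT x|M. f x * g x)"
    and "C = (LINT x|M. (g x)\<^sup>2)"
  have pos: "0 \<le> a\<^sup>2 * A + 2 * a * b * B + b\<^sup>2 * C" for a b
  proof -
    have "0 \<le> (LINT x|M. (a * f x + b * g x)\<^sup>2)" by simp
    then show ?thesis
      unfolding L2_integral_lincomb_square[OF assms] A_def B_def C_def .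
  qed
  have "A \<ge> 0" "C \<ge> 0" by (simp_all add: A_def C_def)
  show ?thesis
  proof (cases "C = 0")
    case True
    have "B = 0"
    proof (rule ccontr)
      assume "B \<noteq> 0"
      have "0 \<le> A + 2 * (-(A+1)/(2*B)) * B" using pos[of 1 "-(A+1)/(2*B)"] True by simp
      also have "\<dots> = -1" using \<open>B \<noteq> 0\<close> by (simp add: field_simps)
      finally show False by simp
    qed
    then show ?thesis using \<open>A \<ge> 0\<close> \<open>C \<ge> 0\<close> by (simp add: A_def[symmetric] B_def[symmetric] C_def[symmetric])
  next
    case False
    then have "C > 0" using \<open>C \<ge> 0\<close> by simp
    have "0 \<le> C\<^sup>2 * A + 2 * C * (-B) * B + (-B)\<^sup>2 * C" by (rule pos)
    then have "0 \<le> C * (A * C - B\<^sup>2)" by (simp add: power2_eq_square algebra_simps)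
    then have "0 \<le> A * C - B\<^sup>2" using \<open>C > 0\<close> by (simp add: zero_le_mult_iff)
    then show ?thesis by (simp add: A_def[symmetric] B_def[symmetric] C_def[symmetric])
  qed
qed

lemma nn_integral_square_L2:
  "f \<in> L2 M \<Longrightarrow> (\<integral>\<^sup>+ x. ennreal ((f x)\<^sup>2) \<partial>M) = ennreal (LINT x|M. (f x)\<^sup>2)"
  by (rule nn_integral_eq_integral) (auto simp: L2_def)

text \<open>
  Weighting the squared increments by \<open>2 ^ n\<close> keeps their sum integrable, and
  \<open>\<bar>d\<bar> \<le> 2 ^ n * d\<^sup>2 + (1/2) ^ n\<close> then makes the increments themselves summable almost
  everywhere. This gives a pointwise limit; Fatou's lemma turns it into a limit in \<open>L\<^sup>2\<close>.
\<close>

lemma L2_fast_Cauchy_converges: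
  fixes g :: "nat \<Rightarrow> 'a \<Rightarrow> real"
  assumes g: "\<And>n. g n \<in> L2 M"
    and bd: "\<And>m n. m \<le> n \<Longrightarrow> (LINT x|M. (g n x - g m x)\<^sup>2) \<le> C * (1/4)^m"
  obtains r where "r \<in> L2 M" "(\<lambda>n. LINT x|M. (g n x - r x)\<^sup>2) \<longlonglongrightarrow> 0"
proof -
  have [measurable]: "g n \<in> borel_measurable M" for n using g by (auto simp: L2_def)
  have C: "C \<ge> 0" using bd[of 0 0] by simp
  define d where "d n x = g (Suc n) x - g n x" for n x
  have dL: "d n \<in> L2 M" for n unfolding d_def[abs_def] by (intro L2_diff g)
  have "(\<integral>\<^sup>+ x. (\<Sum>n. ennreal (2^n * (d n x)\<^sup>2)) \<partial>M) = (\<Sum>n. \<integral>\<^sup>+ x. ennreal (2^n * (d n x)\<^sup>2) \<partial>M)"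
    unfolding d_def by (rule nn_integral_suminf) simp
  also have "\<dots> \<le> (\<Sum>n. ennreal (C * (1/2)^n))"
  proof (intro suminf_le allI)
    fix n
    have "(\<integral>\<^sup>+ x. ennreal (2^n * (d n x)\<^sup>2) \<partial>M) = ennreal (2^n) * ennreal (LINT x|M. (d n x)\<^sup>2)"
      by (simp add: ennreal_mult nn_integral_cmult nn_integral_square_L2[OF dL] d_def)
         (simp add: nn_integral_square_L2[OF dL, unfolded d_def])
    also have "\<dots> = ennreal (2^n * (LINT x|M. (d n x)\<^sup>2))"
      by (simp add: ennreal_mult)
    also have "\<dots> \<le> ennreal (2^n * (C * (1/4)^n))"
      using bd[of n "Suc n"] by (intro ennreal_leI mult_left_mono) (auto simp: d_def)
    also have "2^n * (C * (1/4)^n) = C * (1/2::real)^n"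
    proof -
      have "(2::real)^n * (1/4)^n = (1/2)^n" by (simp add: power_mult_distrib[symmetric])
      then show ?thesis by (simp add: mult_ac)
    qed
    finally show "(\<integral>\<^sup>+ x. ennreal (2^n * (d n x)\<^sup>2) \<partial>M) \<le> ennreal (C * (1/2)^n)" .
  qed auto
  also have "\<dots> < \<infinity>"
    using C by (subst suminf_ennreal2) (auto intro!: summable_mult summable_geometric)
  finally have "AE x in M. (\<Sum>n. ennreal (2^n * (d n x)\<^sup>2)) \<noteq> \<infinity>"
    by (intro nn_integral_noteq_infinite) (auto simp: d_def[abs_def])
  then have conv: "AE x in M. convergent (\<lambda>n. g n x)"
  proof eventually_elim
    fix x assume "(\<Sum>n. ennreal (2^n * (d n x)\<^sup>2)) \<noteq> \<infinity>"
    then have "summable (\<lambda>n. 2^n * (d n x)\<^sup>2)"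
      by (intro summable_suminf_not_top) auto
    then have s: "summable (\<lambda>n. 2^n * (d n x)\<^sup>2 + (1/2)^n)"
      by (intro summable_add summable_geometric) auto
    have "summable (\<lambda>n. d n x)"
    proof (rule summable_comparison_test'[OF s, of 0])
      fix n :: nat
      have "\<bar>d n x\<bar> = sqrt ((d n x)\<^sup>2 * 2^n * (1/2)^n)"
        by (simp add: power_divide)
      also have "\<dots> \<le> (2^n * (d n x)\<^sup>2 + (1/2)^n) / 2"
        using arith_geo_mean_sqrt[of "(d n x)\<^sup>2 * 2^n" "(1/2)^n"] by (simp add: mult_ac)
      also have "\<dots> \<le> 2^n * (d n x)\<^sup>2 + (1/2)^n" by simp
      finally show "norm (d n x) \<le> 2^n * (d n x)\<^sup>2 + (1/2)^n" by simp
    qed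
    then have "convergent (\<lambda>n. \<Sum>i<n. d i x)" by (simp add: summable_iff_convergent)
    moreover have "(\<lambda>n. \<Sum>i<n. d i x) = (\<lambda>n. g n x - g 0 x)"
      by (simp add: d_def sum_lessThan_telescope[of "\<lambda>n. g n x"])
    ultimately have "convergent (\<lambda>n. (g n x - g 0 x) + g 0 x)"
      by (intro convergent_add convergent_const) simp
    then show "convergent (\<lambda>n. g n x)" by simp
  qed
  define r where "r x = lim (\<lambda>n. g n x)" for x
  have [measurable]: "r \<in> borel_measurable M" unfolding r_def[abs_def] by simp
  have lim: "AE x in M. (\<lambda>n. g n x) \<longlonglongrightarrow> r x"
    using conv by eventually_elim (simp add: r_def convergent_LIMSEQ_iff)
  have fatou: "(\<integral>\<^sup>+ x. ennreal ((g n x - r x)\<^sup>2) \<partial>M) \<le> ennreal (C * (1/4)^n)" for n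
  proof -
    have "(\<integral>\<^sup>+ x. ennreal ((g n x - r x)\<^sup>2) \<partial>M)
        = (\<integral>\<^sup>+ x. liminf (\<lambda>m. ennreal ((g n x - g m x)\<^sup>2)) \<partial>M)"
    proof (rule nn_integral_cong_AE, use lim in eventually_elim)
      fix x assume "(\<lambda>n. g n x) \<longlonglongrightarrow> r x"
      then have "(\<lambda>m. ennreal ((g n x - g m x)\<^sup>2)) \<longlonglongrightarrow> ennreal ((g n x - r x)\<^sup>2)"
        by (intro tendsto_intros)
      then show "ennreal ((g n x - r x)\<^sup>2) = liminf (\<lambda>m. ennreal ((g n x - g m x)\<^sup>2))"
        by (rule lim_imp_Liminf[OF sequentially_bot, symmetric])
    qed
    also have "\<dots> \<le> liminf (\<lambda>m. \<integral>\<^sup>+ x. ennreal ((g n x - g m x)\<^sup>2) \<partial>M)"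
      by (rule nn_integral_liminf) simp
    also have "\<dots> \<le> liminf (\<lambda>m. ennreal (C * (1/4)^n))"
    proof (rule Liminf_mono, rule eventually_sequentiallyI[of n])
      fix m assume "n \<le> m"
      have "(\<integral>\<^sup>+ x. ennreal ((g n x - g m x)\<^sup>2) \<partial>M) = ennreal (LINT x|M. (g n x - g m x)\<^sup>2)"
        by (rule nn_integral_square_L2) (intro L2_diff g)
      also have "(LINT x|M. (g n x - g m x)\<^sup>2) = (LINT x|M. (g m x - g n x)\<^sup>2)"
        by (simp add: power2_commute)
      also have "ennreal \<dots> \<le> ennreal (C * (1/4)^n)"
        using bd[OF \<open>n \<le> m\<close>] by (rule ennreal_leI)
      finally show "(\<integral>\<^sup>+ x. ennreal ((g n x - g m x)\<^sup>2) \<partial>M) \<le> ennreal (C * (1/4)^n)" .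
    qed
    also have "\<dots> = ennreal (C * (1/4)^n)" by (simp add: Liminf_const)
    finally show ?thesis .
  qed
  have diffL: "(\<lambda>x. g n x - r x) \<in> L2 M" for n
    unfolding L2_def using fatou[of n]
    by (auto intro!: integrableI_bounded simp: le_less_trans[OF _ ennreal_less_top])
  have "r \<in> L2 M" using L2_diff[OF g[of 0] diffL[of 0]] by simp
  moreover have "(\<lambda>n. LINT x|M. (g n x - r x)\<^sup>2) \<longlonglongrightarrow> 0"
  proof (rule tendsto_sandwich[of "\<lambda>_. 0" _ _ "\<lambda>n. C * (1/4)^n"])
    have "(LINT x|M. (g n x - r x)\<^sup>2) \<le> C * (1/4)^n" for n
      using fatou[of n] C by (simp add: nn_integral_square_L2[OF diffL])
    then show "\<forall>\<^sub>F n in sequentially. (LINT x|M. (g n x - r x)\<^sup>2) \<le> C * (1/4)^n" by simp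
    show "(\<lambda>n. C * (1/4)^n) \<longlonglongrightarrow> 0"
      by (intro tendsto_mult_right_zero LIMSEQ_realpow_zero) auto
  qed auto
  ultimately show thesis by (rule that)
qed

lemma L2_tendsto_integral:
  assumes g: "\<And>n. g n \<in> L2 M" and r: "r \<in> L2 M"
    and lim: "(\<lambda>n. LINT x|M. (g n x - r x)\<^sup>2) \<longlonglongrightarrow> 0" and u: "u \<in> L2 M"
  shows "(\<lambda>n. LINT x|M. g n x * u x) \<longlonglongrightarrow> (LINT x|M. r x * u x)"
    and "(\<lambda>n. LINT x|M. (g n x)\<^sup>2) \<longlonglongrightarrow> (LINT x|M. (r x)\<^sup>2)"
proof -
  have *: "(\<lambda>n. LINT x|M. (g n x - r x) * u x) \<longlonglongrightarrow> 0" if u: "u \<in> L2 M" for u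
  proof -
    have "(\<lambda>n. (LINT x|M. (g n x - r x) * u x)\<^sup>2) \<longlonglongrightarrow> 0"
    proof (rule tendsto_sandwich[of "\<lambda>_. 0"])
      show "\<forall>\<^sub>F n in sequentially. (LINT x|M. (g n x - r x) * u x)\<^sup>2
          \<le> (LINT x|M. (g n x - r x)\<^sup>2) * (LINT x|M. (u x)\<^sup>2)"
        using L2_Cauchy_Schwarz[OF L2_diff[OF g r] u] by simp
      show "(\<lambda>n. (LINT x|M. (g n x - r x)\<^sup>2) * (LINT x|M. (u x)\<^sup>2)) \<longlonglongrightarrow> 0"
        using tendsto_mult_left_zero[OF lim] by simp
    qed auto
    then have "(\<lambda>n. sqrt ((LINT x|M. (g n x - r x) * u x)\<^sup>2)) \<longlonglongrightarrow> sqrt 0"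
      by (rule tendsto_real_sqrt)
    then show ?thesis by (simp add: tendsto_rabs_zero_iff)
  qed
  have eq: "(LINT x|M. (g n x - r x) * u x) = (LINT x|M. g n x * u x) - (LINT x|M. r x * u x)"
    if "u \<in> L2 M" for n u
    using L2_mult_integrable[OF g[of n] that] L2_mult_integrable[OF r that]
    by (simp add: left_diff_distrib)
  show "(\<lambda>n. LINT x|M. g n x * u x) \<longlonglongrightarrow> (LINT x|M. r x * u x)"
    using *[OF u] by (simp add: eq[OF u] LIM_zero_iff)
  have "(LINT x|M. (g n x)\<^sup>2) = (LINT x|M. (g n x - r x)\<^sup>2) + 2 * (LINT x|M. (g n x - r x) * r x)
      + (LINT x|M. (r x)\<^sup>2)" for n
    using L2_integral_lincomb_square[OF L2_diff[OF g[of n] r] r, of 1 1] by simp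
  moreover have "(\<lambda>n. (LINT x|M. (g n x - r x)\<^sup>2) + 2 * (LINT x|M. (g n x - r x) * r x)
      + (LINT x|M. (r x)\<^sup>2)) \<longlonglongrightarrow> 0 + 2 * 0 + (LINT x|M. (r x)\<^sup>2)"
    by (intro tendsto_intros lim *[OF r])
  ultimately show "(\<lambda>n. LINT x|M. (g n x)\<^sup>2) \<longlonglongrightarrow> (LINT x|M. (r x)\<^sup>2)" by simp
qed

lemma L2_tendsto_AE_subseq:
  assumes "\<And>n. g n \<in> L2 M" "r \<in> L2 M" "(\<lambda>n. LINT x|M. (g n x - r x)\<^sup>2) \<longlonglongrightarrow> 0"
  obtains k :: "nat \<Rightarrow> nat" where "strict_mono k" "AE x in M. (\<lambda>n. g (k n) x) \<longlonglongrightarrow> r x"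
proof -
  have "\<exists>k::nat\<Rightarrow>nat. strict_mono k \<and> (AE x in M. (\<lambda>n. (g (k n) x - r x)\<^sup>2) \<longlonglongrightarrow> 0)"
  proof (rule tendsto_L1_AE_subseq[of M "\<lambda>n x. (g n x - r x)\<^sup>2"])
    show "integrable M (\<lambda>x. (g n x - r x)\<^sup>2)" for n
      using L2_diff[OF assms(1)[of n] assms(2)] by (simp add: L2_def)
    show "(\<lambda>n. LINT x|M. norm ((g n x - r x)\<^sup>2)) \<longlonglongrightarrow> 0" using assms(3) by simp
  qed
  then obtain k :: "nat \<Rightarrow> nat" where k: "strict_mono k"
    "AE x in M. (\<lambda>n. (g (k n) x - r x)\<^sup>2) \<longlonglongrightarrow> 0" by blast
  from k(2) have "AE x in M. (\<lambda>n. g (k n) x) \<longlonglongrightarrow> r x"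
  proof eventually_elim
    fix x assume "(\<lambda>n. (g (k n) x - r x)\<^sup>2) \<longlonglongrightarrow> 0"
    then have "(\<lambda>n. sqrt ((g (k n) x - r x)\<^sup>2)) \<longlonglongrightarrow> sqrt 0" by (rule tendsto_real_sqrt)
    then show "(\<lambda>n. g (k n) x) \<longlonglongrightarrow> r x" by (simp add: tendsto_rabs_zero_iff LIM_zero_iff)
  qed
  then show thesis using k(1) that by blast
qed

text \<open>
  The limit in \<open>L\<^sup>2\<close> is unique, since it is an almost sure limit along a common subsequence.
\<close>

lemma L2_limits_agree:
  assumes S: "\<And>k. S k \<in> L2 M" and X: "X \<in> L2 M" and X': "X' \<in> L2 M"
    and lim: "(\<lambda>k. LINT w|M. (S k w - X w)\<^sup>2) \<longlonglongrightarrow> 0" "(\<lambda>k. LINT w|M. (S k w - X' w)\<^sup>2) \<longlonglongrightarrow> 0"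
  shows "AE w in M. X w = X' w"
proof -
  obtain k :: "nat \<Rightarrow> nat" where k: "strict_mono k" "AE w in M. (\<lambda>n. S (k n) w) \<longlonglongrightarrow> X w"
    using L2_tendsto_AE_subseq[OF S X lim(1)] by blast
  have "(\<lambda>n. LINT w|M. (S (k n) w - X' w)\<^sup>2) \<longlonglongrightarrow> 0"
    using LIMSEQ_subseq_LIMSEQ[OF lim(2) k(1)] by (simp add: o_def)
  then obtain l :: "nat \<Rightarrow> nat" where l: "strict_mono l" "AE w in M. (\<lambda>n. S (k (l n)) w) \<longlonglongrightarrow> X' w"
    using L2_tendsto_AE_subseq[of "\<lambda>n. S (k n)", OF S X'] by blast
  from k(2) l(2) show ?thesis
  proof eventually_elim
    fix w assume "(\<lambda>n. S (k n) w) \<longlonglongrightarrow> X w" and l': "(\<lambda>n. S (k (l n)) w) \<longlonglongrightarrow> X' w"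
    then have "(\<lambda>n. S (k (l n)) w) \<longlonglongrightarrow> X w"
      using LIMSEQ_subseq_LIMSEQ[OF _ l(1), of "\<lambda>n. S (k n) w"] by (simp add: o_def)
    then show "X w = X' w" using l' by (rule LIMSEQ_unique)
  qed
qed

lemma L2_cong_AE:
  assumes "f \<in> L2 M" "g \<in> borel_measurable M" "AE x in M. f x = g x"
  shows "g \<in> L2 M"
proof -
  have m: "f \<in> borel_measurable M" using assms(1) by (simp add: L2_def)
  have "integrable M (\<lambda>x. (g x)\<^sup>2)"
    by (rule integrable_cong_AE_imp[of _ "\<lambda>x. (f x)\<^sup>2"])
      (use assms m in \<open>auto simp: L2_def elim!: eventually_mono\<close>)
  then show ?thesis using assms(2) by (simp add: L2_def)
qed

text \<open>
  The orthogonal projection of \<open>f\<close> onto the closure of the subspace \<open>V\<close>: the sequence \<open>s\<close> tends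
  to the projection, and \<open>r\<close> is the residual. If only the zero class is orthogonal to \<open>V\<close>, then
  \<open>V\<close> is dense; this is how density of the kernel functions will follow from injectivity of
  their integral operator.
\<close>

lemma L2_orthogonal_residual:
  assumes V: "V \<subseteq> L2 M" "(\<lambda>x. 0) \<in> V"
    and sub: "\<And>u v a b. u \<in> V \<Longrightarrow> v \<in> V \<Longrightarrow> (\<lambda>x. a * u x + b * v x) \<in> V"
    and f: "f \<in> L2 M"
  obtains s r where "\<And>n::nat. s n \<in> V" "r \<in> L2 M"
    "(\<lambda>n. LINT x|M. (f x - s n x - r x)\<^sup>2) \<longlonglongrightarrow> 0"
    "\<And>v. v \<in> V \<Longrightarrow> (LINT x|M. r x * v x) = 0"
proof -
  define D where "D v = (LINT x|M. (f x - v x)\<^sup>2)" for v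
  define d where "d = (INF v\<in>V. D v)"
  have bdd: "bdd_below (D ` V)" by (rule bdd_belowI[of _ 0]) (auto simp: D_def)
  have dle: "d \<le> D v" if "v \<in> V" for v unfolding d_def by (rule cINF_lower[OF bdd that])
  have "\<exists>v\<in>V. D v < d + (1/4)^n" for n :: nat
  proof -
    have "d < d + (1/4)^n" by simp
    moreover have "V \<noteq> {}" using V(2) by blast
    ultimately show ?thesis using cINF_less_iff[OF _ bdd] unfolding d_def by blast
  qed
  then obtain s where s: "\<And>n. s n \<in> V" "\<And>n. D (s n) < d + (1/4)^n" by metis
  have sL: "s n \<in> L2 M" for n using s(1) V(1) by auto
  define g where "g n x = f x - s n x" for n x
  have gL: "g n \<in> L2 M" for n unfolding g_def[abs_def] by (intro L2_diff f sL)
  \<comment> \<open>A minimising sequence is Cauchy by the parallelogram law.\<close>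
  have par: "(LINT x|M. (g n x - g m x)\<^sup>2) \<le> 4 * (1/4)^m" if mn: "m \<le> n" for m n
  proof -
    \<comment> \<open>The midpoint of two near-minimisers is again in the subspace.\<close>
    have mid: "(\<lambda>x. (1/2) * s n x + (1/2) * s m x) \<in> V" by (intro sub s)
    have "d \<le> (LINT x|M. ((1/2) * g n x + (1/2) * g m x)\<^sup>2)"
    proof -
      have "(\<lambda>x. f x - ((1/2) * s n x + (1/2) * s m x)) = (\<lambda>x. (1/2) * g n x + (1/2) * g m x)"
        by (auto simp: g_def field_simps)
      then show ?thesis using dle[OF mid] by (simp add: D_def fun_eq_iff)
    qed
    also have "\<dots> = (1/4) * D (s n) + (1/2) * (LINT x|M. g n x * g m x) + (1/4) * D (s m)"
      using L2_integral_lincomb_square[OF gL[of n] gL[of m], of "1/2" "1/2"]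
      by (simp add: D_def g_def power2_eq_square)
    finally have "- 2 * (LINT x|M. g n x * g m x) \<le> D (s n) + D (s m) - 4 * d" by simp
    moreover have "(LINT x|M. (g n x - g m x)\<^sup>2) = D (s n) - 2 * (LINT x|M. g n x * g m x) + D (s m)"
      using L2_integral_lincomb_square[OF gL[of n] gL[of m], of 1 "-1"] by (simp add: D_def g_def)
    moreover have "(1/4::real)^n \<le> (1/4)^m" using mn by (intro power_decreasing) auto
    ultimately show ?thesis using s(2)[of n] s(2)[of m] by linarith
  qed
  obtain r where r: "r \<in> L2 M" "(\<lambda>n. LINT x|M. (g n x - r x)\<^sup>2) \<longlonglongrightarrow> 0"
    using L2_fast_Cauchy_converges[OF gL par] by blast
  have norm_r: "(LINT x|M. (r x)\<^sup>2) = d"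
  proof (rule LIMSEQ_unique[OF L2_tendsto_integral(2)[OF gL r L2_zero]])
    show "(\<lambda>n. LINT x|M. (g n x)\<^sup>2) \<longlonglongrightarrow> d"
    proof (rule tendsto_sandwich[of "\<lambda>_. d" _ _ "\<lambda>n. d + (1/4)^n"])
      show "\<forall>\<^sub>F n in sequentially. (LINT x|M. (g n x)\<^sup>2) \<le> d + (1/4)^n"
        using less_imp_le[OF s(2)] by (intro always_eventually allI) (simp add: D_def g_def)
      show "\<forall>\<^sub>F n in sequentially. d \<le> (LINT x|M. (g n x)\<^sup>2)"
        using dle[OF s(1)] by (intro always_eventually allI) (simp add: D_def g_def)
      show "(\<lambda>n. d + (1/4)^n) \<longlonglongrightarrow> d"
        using tendsto_add[OF tendsto_const[of d] LIMSEQ_realpow_zero[of "1/4::real"]] by simp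
    qed auto
  qed
  have orth: "(LINT x|M. r x * v x) = 0" if v: "v \<in> V" for v
  proof (rule ccontr)
    assume ne: "(LINT x|M. r x * v x) \<noteq> 0"
    define b where "b = (LINT x|M. r x * v x)"
    define c where "c = (LINT x|M. (v x)\<^sup>2)"
    have vL: "v \<in> L2 M" using v V(1) by auto
    have c: "c \<ge> 0" by (simp add: c_def)
    have le: "0 \<le> -2 * e * b + e\<^sup>2 * c" for e
    proof -
      have "d \<le> (LINT x|M. (1 * g n x + (- e) * v x)\<^sup>2)" for n
      proof -
        have "(\<lambda>x. 1 * s n x + e * v x) \<in> V" by (intro sub s v)
        from dle[OF this] show ?thesis by (simp add: D_def g_def algebra_simps)
      qed
      then have "d \<le> (LINT x|M. (g n x)\<^sup>2) + 2 * (- e) * (LINT x|M. g n x * v x) + (- e)\<^sup>2 * c" for n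
        unfolding c_def L2_integral_lincomb_square[OF gL vL] by simp
      moreover have "(\<lambda>n. (LINT x|M. (g n x)\<^sup>2) + 2 * (- e) * (LINT x|M. g n x * v x) + (- e)\<^sup>2 * c)
          \<longlonglongrightarrow> d + 2 * (- e) * b + (- e)\<^sup>2 * c"
        unfolding b_def norm_r[symmetric]
        by (intro tendsto_intros L2_tendsto_integral(1)[OF gL r vL]
          L2_tendsto_integral(2)[OF gL r vL])
      ultimately have "d \<le> d + 2 * (- e) * b + (- e)\<^sup>2 * c"
        by (intro LIMSEQ_le_const) auto
      then show ?thesis by simp
    qed
    define e where "e = b / (c + 1)"
    have be: "b = e * (c + 1)" using c by (simp add: e_def)
    \<comment> \<open>The quadratic is minimal at \<open>b / c\<close>; taking \<open>c + 1\<close> for \<open>c\<close> also covers \<open>c = 0\<close>.\<close>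
    have "0 \<le> -2 * e * b + e\<^sup>2 * c" by (rule le)
    also have "\<dots> = e\<^sup>2 * (- 2 * (c + 1) + c)"
      unfolding be by (simp add: power2_eq_square algebra_simps)
    also have "\<dots> < 0"
      using c ne by (intro mult_pos_neg) (auto simp: b_def e_def)
    finally show False by simp
  qed
  have "(\<lambda>n. LINT x|M. (f x - s n x - r x)\<^sup>2) \<longlonglongrightarrow> 0" using r(2) by (simp add: g_def)
  then show thesis by (rule that[OF s(1) r(1) _ orth])
qed

section \<open>Borel sets of path space\<close>

text \<open>
  The time horizons \<open>[0,T]\<close> and \<open>[0,\<infinity>)\<close> at once (lemma \<open>time_set_cases\<close>). A horizon contains,
  with each time, the grid points below it, so that paths can be sampled along grids.
\<close>

definition time_set :: "real set \<Rightarrow> bool" where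
  "time_set I \<longleftrightarrow> closed I \<and> 0 \<in> I \<and> I \<subseteq> {0..} \<and> (\<forall>t\<in>I. {0..t} \<subseteq> I)"

lemma time_set_halfline: "time_set {0..}"
  by (auto simp: time_set_def)

lemma time_set_interval: "T \<ge> 0 \<Longrightarrow> time_set {0..T}"
  by (auto simp: time_set_def)

lemma space_path_borel [simp]: "space (path_borel I) = path_space I"
  by (simp add: path_borel_def space_measure_of_conv)

lemma sets_path_borel:
  "sets (path_borel I) = sigma_sets (path_space I) {U. path_open I U}"
  unfolding path_borel_def openin_path_topology
  by (rule sets_measure_of) (auto simp: path_open_def)

lemma evaluation_measurable:
  assumes "t \<in> I"
  shows "(\<lambda>w. w t) \<in> borel_measurable (path_borel I)"
proof (rule borel_measurableI_less)
  fix a :: real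
  have "path_open I {w \<in> path_space I. w t < a}"
    unfolding path_open_def
  proof (intro conjI ballI)
    fix w assume w: "w \<in> {w \<in> path_space I. w t < a}"
    then show "\<exists>K e. compact K \<and> K \<subseteq> I \<and> e > 0 \<and> (\<forall>v\<in>path_space I.
        (\<forall>t\<in>K. \<bar>v t - w t\<bar> < e) \<longrightarrow> v \<in> {w \<in> path_space I. w t < a})"
      using assms by (intro exI[of _ "{t}"] exI[of _ "a - w t"]) auto
  qed auto
  then show "{w \<in> space (path_borel I). w t < a} \<in> sets (path_borel I)"
    by (auto simp: sets_path_borel)
qed

lemma time_set_nonneg: "time_set I \<Longrightarrow> t \<in> I \<Longrightarrow> 0 \<le> t"
  by (auto simp: time_set_def)

lemma time_set_downward: "time_set I \<Longrightarrow> t \<in> I \<Longrightarrow> 0 \<le> s \<Longrightarrow> s \<le> t \<Longrightarrow> s \<in> I"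
  unfolding time_set_def by fastforce

lemma time_set_cases:
  assumes I: "time_set I"
  obtains "I = {0..}" | q where "0 \<le> q" "I = {0..q}"
proof (cases "bdd_above I")
  case True
  have "I \<noteq> {}" "closed I" using I by (auto simp: time_set_def)
  then have S: "Sup I \<in> I" using True by (intro closed_contains_Sup) auto
  have "I = {0..Sup I}"
  proof (intro equalityI subsetI)
    fix t assume "t \<in> I"
    then show "t \<in> {0..Sup I}" using time_set_nonneg[OF I] True by (auto intro: cSup_upper)
  next
    fix t assume "t \<in> {0..Sup I}"
    then show "t \<in> I" using time_set_downward[OF I S] by simp
  qed
  moreover have "0 \<le> Sup I" using time_set_nonneg[OF I S] .
  ultimately show thesis using that(2) by blast
next
  case False
  have "I = {0..}"
  proof (intro equalityI subsetI)
    fix t assume "t \<in> I" then show "t \<in> {0..}" using time_set_nonneg[OF I] by simp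
  next
    fix t :: real assume "t \<in> {0..}"
    obtain s where "s \<in> I" "t < s" using False by (auto simp: bdd_above_def not_le)
    then show "t \<in> I" using time_set_downward[OF I] \<open>t \<in> {0..}\<close> by auto
  qed
  then show thesis by (rule that(1))
qed

definition grid_below :: "nat \<Rightarrow> real \<Rightarrow> real" where
  "grid_below m t = of_int \<lfloor>real m * t\<rfloor> / real m"

lemma grid_below_le: "m > 0 \<Longrightarrow> grid_below m t \<le> t"
proof -
  assume "m > 0"
  have "of_int \<lfloor>real m * t\<rfloor> \<le> real m * t" by simp
  then show ?thesis using \<open>m > 0\<close> by (simp add: grid_below_def field_simps)
qed

lemma grid_below_nonneg: "t \<ge> 0 \<Longrightarrow> grid_below m t \<ge> 0"
  by (simp add: grid_below_def)

lemma grid_below_gt: "m > 0 \<Longrightarrow> t - 1 / real m < grid_below m t"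
proof -
  assume "m > 0"
  have "real m * t - 1 < of_int \<lfloor>real m * t\<rfloor>" by linarith
  then have "(real m * t - 1) / real m < grid_below m t"
    unfolding grid_below_def using \<open>m > 0\<close> by (intro divide_strict_right_mono) auto
  then show ?thesis using \<open>m > 0\<close> by (simp add: diff_divide_distrib)
qed

lemma grid_below_tendsto: "(\<lambda>m. grid_below (Suc m) t) \<longlonglongrightarrow> t"
proof (rule tendsto_sandwich[of "\<lambda>m. t - 1 / real (Suc m)" _ _ "\<lambda>_. t"])
  have "(\<lambda>m. t - 1 / real (Suc m)) \<longlonglongrightarrow> t - 0"
    by (intro tendsto_intros LIMSEQ_Suc[OF lim_1_over_n])
  then show "(\<lambda>m. t - 1 / real (Suc m)) \<longlonglongrightarrow> t" by simp
  show "\<forall>\<^sub>F m in sequentially. t - 1 / real (Suc m) \<le> grid_below (Suc m) t"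
    by (intro always_eventually allI less_imp_le grid_below_gt) simp
  show "\<forall>\<^sub>F m in sequentially. grid_below (Suc m) t \<le> t"
    by (intro always_eventually allI grid_below_le) simp
qed auto

lemma grid_below_in_time_set:
  assumes "time_set I" "t \<in> I" "m > 0" shows "grid_below m t \<in> I"
  using assms
  by (intro time_set_downward[OF assms(1,2)] grid_below_nonneg grid_below_le time_set_nonneg)

lemma path_continuous_limit:
  assumes I: "time_set I" and w: "w \<in> path_space I" and t: "t \<in> I"
  shows "(\<lambda>m. w (grid_below (Suc m) t)) \<longlonglongrightarrow> w t"
proof (rule continuous_on_tendsto_compose[of I w])
  show "continuous_on I w" using w by (simp add: path_space_def)
  show "\<forall>\<^sub>F m in sequentially. grid_below (Suc m) t \<in> I"
    by (intro always_eventually allI grid_below_in_time_set[OF I t]) simp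
qed (use t grid_below_tendsto in auto)

text \<open>
  Step functions of mesh \<open>1 / (m + 1)\<close> with rational values. There are countably many of them, and
  they approximate every path uniformly on bounded sets of times. They are discontinuous, but a
  bound \<open>\<bar>v t - rat_step m qs t\<bar> \<le> e\<close> for continuous \<open>v\<close> is still determined by grid points,
  because refined grids approach \<open>t\<close> from within the step that contains \<open>t\<close>.
\<close>

definition rat_step :: "nat \<Rightarrow> rat list \<Rightarrow> real \<Rightarrow> real" where
  "rat_step m qs t = of_rat (qs ! nat \<lfloor>real (Suc m) * t\<rfloor>)"

lemma rat_step_approx:
  assumes I: "time_set I" and w: "w \<in> path_space I" and e: "e > 0" 
  obtains m qs where "\<And>t. t \<in> I \<Longrightarrow> t \<le> real n \<Longrightarrow> \<bar>w t - rat_step m qs t\<bar> < e"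
proof -
  let ?K = "I \<inter> {0..real n}"
  have "compact ?K" using I by (simp add: time_set_def closed_Int_compact)
  moreover have "continuous_on ?K w" using w by (auto simp: path_space_def intro: continuous_on_subset)
  ultimately have "uniformly_continuous_on ?K w" by (rule compact_uniformly_continuous[rotated])
  then obtain d where d: "d > 0" "\<And>s t. s \<in> ?K \<Longrightarrow> t \<in> ?K \<Longrightarrow> dist s t < d \<Longrightarrow> dist (w s) (w t) < e/2"
    unfolding uniformly_continuous_on_def using e by (metis half_gt_zero)
  obtain m' where m': "1 / real (Suc m') < d" using d(1) nat_approx_posE by blast
  define m where "m = Suc m'"
  have m: "m > 0" "1 / real m < d" using m' by (auto simp: m_def)
  have "\<exists>q::rat. \<bar>w (real j / real m) - of_rat q\<bar> < e/2" for j
  proof -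
    obtain q :: rat where "w (real j / real m) - e/2 < of_rat q" "of_rat q < w (real j / real m) + e/2"
      using of_rat_dense[of "w (real j / real m) - e/2" "w (real j / real m) + e/2"] e by auto
    then have "\<bar>w (real j / real m) - of_rat q\<bar> < e/2" by linarith
    then show ?thesis by blast
  qed
  then obtain q :: "nat \<Rightarrow> rat" where q: "\<And>j. \<bar>w (real j / real m) - of_rat (q j)\<bar> < e/2" by metis
  define qs where "qs = map q [0..<Suc (m * n)]"
  have "\<bar>w t - rat_step m' qs t\<bar> < e" if t: "t \<in> I" "t \<le> real n" for t
  proof -
    have t0: "t \<ge> 0" using t I by (auto simp: time_set_def)
    let ?j = "nat \<lfloor>real m * t\<rfloor>"
    have jt: "real ?j / real m = grid_below m t" using t0 by (simp add: grid_below_def)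
    have "real m * t \<le> real (m * n)" using t by (simp add: mult_left_mono)
    then have "?j < Suc (m * n)" by linarith
    then have "rat_step m' qs t = of_rat (q ?j)" unfolding rat_step_def qs_def m_def[symmetric]
      by (subst nth_map) (simp_all del: upt_Suc)
    moreover have "\<bar>w (grid_below m t) - of_rat (q ?j)\<bar> < e/2" using q[of ?j] by (simp add: jt)
    moreover have "dist (w (grid_below m t)) (w t) < e/2"
    proof (rule d(2))
      show "grid_below m t \<in> ?K"
        using t grid_below_in_time_set[OF I t(1) m(1)] grid_below_le[OF m(1), of t] grid_below_nonneg[OF t0, of m]
        by simp
      show "t \<in> ?K" using t t0 by simp
      show "dist (grid_below m t) t < d"
        using grid_below_le[OF m(1), of t] grid_below_gt[OF m(1), of t] m(2) by (simp add: dist_real_def)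
    qed
    ultimately show ?thesis unfolding dist_real_def by linarith
  qed
  then show thesis by (rule that)
qed

text \<open>
  The evaluations generate the Borel sets of the path space: an open set is the union of those
  uniform neighbourhoods of rational step functions that it contains, which is a countable union,
  and each such neighbourhood is described by the values of the path on countably many times.
\<close>

lemma measurable_path_borelI:
  assumes I: "time_set I"
    and f: "\<And>x. x \<in> space M \<Longrightarrow> f x \<in> path_space I"
    and ev: "\<And>t. t \<in> I \<Longrightarrow> (\<lambda>x. f x t) \<in> borel_measurable M"
  shows "f \<in> M \<rightarrow>\<^sub>M path_borel I"
  unfolding path_borel_def openin_path_topology
proof (rule measurable_measure_of)
  show "f \<in> space M \<rightarrow> path_space I" using f by auto
  show "{U. path_open I U} \<subseteq> Pow (path_space I)" by (auto simp: path_open_def)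
  fix U assume "U \<in> {U. path_open I U}"
  then have U: "path_open I U" by simp
  define N where "N = (\<lambda>(n::nat, k::nat, m, qs). {v \<in> path_space I.
    \<forall>t\<in>I. t \<le> real n \<longrightarrow> \<bar>v t - rat_step m qs t\<bar> \<le> 1 / real (Suc k)})"
  have U_eq: "U = (\<Union>p\<in>{p. N p \<subseteq> U}. N p)"
  proof (intro equalityI subsetI)
    fix w assume w: "w \<in> U"
    have wp: "w \<in> path_space I" using U w by (auto simp: path_open_def)
    obtain K e where K: "compact K" "K \<subseteq> I" "e > 0"
      "\<forall>v\<in>path_space I. (\<forall>t\<in>K. \<bar>v t - w t\<bar> < e) \<longrightarrow> v \<in> U"
      using U w unfolding path_open_def by blast
    obtain B where B: "\<forall>t\<in>K. \<bar>t\<bar> \<le> B"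
      using compact_imp_bounded[OF K(1)] unfolding bounded_iff by (metis real_norm_def)
    obtain n where n: "B \<le> real n" using real_arch_simple by blast
    obtain k where k: "1 / real (Suc k) < e/2" using K(3) nat_approx_posE[of "e/2"] by auto
    obtain m qs where mq: "\<And>t. t \<in> I \<Longrightarrow> t \<le> real n \<Longrightarrow> \<bar>w t - rat_step m qs t\<bar> < 1 / real (Suc k)"
      using rat_step_approx[OF I wp, of "1 / real (Suc k)" n] by auto
    have "w \<in> N (n, k, m, qs)" using wp mq by (auto simp: N_def intro: less_imp_le)
    moreover have "N (n, k, m, qs) \<subseteq> U"
    proof
      fix v assume v: "v \<in> N (n, k, m, qs)"
      have "\<bar>v t - w t\<bar> < e" if "t \<in> K" for t
      proof -
        have "t \<in> I" "t \<le> real n" using that K(2) B n by fastforce+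
        then have "\<bar>v t - rat_step m qs t\<bar> \<le> 1 / real (Suc k)" "\<bar>w t - rat_step m qs t\<bar> < 1 / real (Suc k)"
          using v mq by (auto simp: N_def)
        then show ?thesis using k by linarith
      qed
      then show "v \<in> U" using K(4) v by (auto simp: N_def)
    qed
    ultimately show "w \<in> (\<Union>p\<in>{p. N p \<subseteq> U}. N p)" by blast
  qed auto
  have meas: "f -` N p \<inter> space M \<in> sets M" for p
  proof -
    obtain n k m qs where p: "p = (n, k, m, qs)" by (cases p) auto
    define g where "g p = real_of_int (snd p) / real (fst p)" for p :: "nat \<times> int"
    define D where "D = I \<inter> range g \<inter> {..real n}"
    have ext: "\<bar>v t - rat_step m qs t\<bar> \<le> 1 / real (Suc k)"
      if v: "v \<in> path_space I" and vD: "\<forall>s\<in>D. \<bar>v s - rat_step m qs s\<bar> \<le> 1 / real (Suc k)"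
        and t: "t \<in> I" "t \<le> real n" for v t
    proof -
      \<comment> \<open>refinements of the mesh stay in the step that contains \<open>t\<close>\<close>
      define s where "s i = grid_below (Suc m * Suc i) t" for i
      have t0: "t \<ge> 0" using t I by (auto simp: time_set_def)
      have s: "s i \<le> t" "0 \<le> s i" for i
        unfolding s_def by (auto intro!: grid_below_le grid_below_nonneg t0 simp del: mult_Suc mult_Suc_right)
      have "s i \<in> range g" for i
        unfolding s_def grid_below_def g_def
        by (rule range_eqI[of _ _ "(Suc m * Suc i, \<lfloor>real (Suc m * Suc i) * t\<rfloor>)"]) simp
      then have sD: "s i \<in> D" for i
        using s[of i] t time_set_downward[OF I t(1)] by (simp add: D_def)
      have fl: "\<lfloor>real (Suc m) * s i\<rfloor> = \<lfloor>real (Suc m) * t\<rfloor>" for i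
      proof (rule antisym)
        show "\<lfloor>real (Suc m) * s i\<rfloor> \<le> \<lfloor>real (Suc m) * t\<rfloor>"
          using s(1)[of i] by (intro floor_mono mult_left_mono) auto
        have "\<lfloor>real (Suc m) * t\<rfloor> * int (Suc i) \<le> \<lfloor>real (Suc m * Suc i) * t\<rfloor>"
        proof (subst le_floor_iff)
          have "real_of_int \<lfloor>real (Suc m) * t\<rfloor> * real (Suc i) \<le> (real (Suc m) * t) * real (Suc i)"
            by (rule mult_right_mono) auto
          then show "real_of_int (\<lfloor>real (Suc m) * t\<rfloor> * int (Suc i)) \<le> real (Suc m * Suc i) * t"
            by (simp only: of_int_mult of_int_of_nat_eq of_nat_mult mult_ac)
        qed
        then have "real_of_int (\<lfloor>real (Suc m) * t\<rfloor> * int (Suc i)) \<le> real_of_int \<lfloor>real (Suc m * Suc i) * t\<rfloor>"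
          by (simp only: of_int_le_iff)
        then have "real_of_int \<lfloor>real (Suc m) * t\<rfloor> \<le> real_of_int \<lfloor>real (Suc m * Suc i) * t\<rfloor> / real (Suc i)"
          by (simp only: of_int_mult of_int_of_nat_eq pos_le_divide_eq of_nat_0_less_iff zero_less_Suc)
        also have "\<dots> = real (Suc m) * s i"
          unfolding s_def grid_below_def of_nat_mult by (simp del: of_nat_Suc)
        finally show "\<lfloor>real (Suc m) * t\<rfloor> \<le> \<lfloor>real (Suc m) * s i\<rfloor>"
          by (simp only: le_floor_iff)
      qed
      have "strict_mono (\<lambda>i. m + Suc m * i)" by (intro strict_monoI add_strict_left_mono mult_strict_left_mono) auto
      from LIMSEQ_subseq_LIMSEQ[OF path_continuous_limit[OF I v t(1)] this]
      have "(\<lambda>i. v (grid_below (Suc (m + Suc m * i)) t)) \<longlonglongrightarrow> v t" by (simp only: o_def)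
      moreover have "Suc (m + Suc m * i) = Suc m * Suc i" for i by simp
      ultimately have "(\<lambda>i. v (s i)) \<longlonglongrightarrow> v t" by (simp only: s_def)
      then have "(\<lambda>i. \<bar>v (s i) - rat_step m qs t\<bar>) \<longlonglongrightarrow> \<bar>v t - rat_step m qs t\<bar>"
        by (intro tendsto_intros)
      moreover have "\<bar>v (s i) - rat_step m qs t\<bar> \<le> 1 / real (Suc k)" for i
      proof -
        have "rat_step m qs (s i) = rat_step m qs t" by (simp only: rat_step_def fl)
        then show ?thesis using bspec[OF vD sD[of i]] by simp
      qed
      ultimately show ?thesis by (intro LIMSEQ_le_const2) auto
    qed
    have "f -` N p \<inter> space M
        = {x \<in> space M. \<forall>p. g p \<in> D \<longrightarrow> \<bar>f x (g p) - rat_step m qs (g p)\<bar> \<le> 1 / real (Suc k)}"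
    proof (intro equalityI subsetI)
      fix x assume x: "x \<in> f -` N p \<inter> space M"
      then show "x \<in> {x \<in> space M. \<forall>p. g p \<in> D \<longrightarrow> \<bar>f x (g p) - rat_step m qs (g p)\<bar> \<le> 1 / real (Suc k)}"
        by (simp add: p N_def D_def)
    next
      fix x assume x: "x \<in> {x \<in> space M. \<forall>p. g p \<in> D \<longrightarrow> \<bar>f x (g p) - rat_step m qs (g p)\<bar> \<le> 1 / real (Suc k)}"
      then have "\<forall>s\<in>D. \<bar>f x s - rat_step m qs s\<bar> \<le> 1 / real (Suc k)" by (auto simp: D_def)
      then show "x \<in> f -` N p \<inter> space M" using ext[OF f] f x by (simp add: p N_def)
    qed
    also have "\<dots> \<in> sets M"
    proof (rule sets.sets_Collect_countable_All)
      fix p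
      show "{x \<in> space M. g p \<in> D \<longrightarrow> \<bar>f x (g p) - rat_step m qs (g p)\<bar> \<le> 1 / real (Suc k)} \<in> sets M"
      proof (cases "g p \<in> D")
        case True
        then have [measurable]: "(\<lambda>x. f x (g p)) \<in> borel_measurable M" using ev by (simp add: D_def)
        show ?thesis by measurable
      qed simp
    qed
    finally show ?thesis .
  qed
  have "f -` U \<inter> space M = (\<Union>p\<in>{p. N p \<subseteq> U}. f -` N p \<inter> space M)"
    by (subst U_eq) auto
  also have "\<dots> \<in> sets M" using meas by (intro sets.countable_UN') auto
  finally show "f -` U \<inter> space M \<in> sets M" .
qed

lemma path_space_add:
  assumes "w \<in> path_space I" "h \<in> path_space I" "0 \<in> I"
  shows "(\<lambda>t\<in>I. w t + h t) \<in> path_space I"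
proof -
  have "continuous_on I (\<lambda>t. w t + h t)"
    using assms by (intro continuous_on_add) (auto simp: path_space_def)
  then have "continuous_on I (\<lambda>t\<in>I. w t + h t)" by (rule continuous_on_eq) simp
  then show ?thesis using assms by (simp add: path_space_def)
qed

lemma path_shift_measurable:
  assumes \<phi>: "\<phi> \<in> M \<rightarrow>\<^sub>M path_borel {0..}" and h: "h \<in> path_space {0..}"
  shows "(\<lambda>x. \<lambda>t\<in>{0..}. \<phi> x t + h t) \<in> M \<rightarrow>\<^sub>M path_borel {0..}"
proof (rule measurable_path_borelI[OF time_set_halfline])
  show "(\<lambda>t\<in>{0..}. \<phi> x t + h t) \<in> path_space {0..}" if "x \<in> space M" for x
    using measurable_space[OF \<phi> that] h by (intro path_space_add) auto
  show "(\<lambda>x. (\<lambda>t\<in>{0..}. \<phi> x t + h t) t) \<in> borel_measurable M" if "t \<in> {0..}" for t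
    using measurable_compose[OF \<phi> evaluation_measurable[OF that]] that by simp
qed

lemma path_rescale:
  assumes I: "time_set I" and J: "time_set J" and w: "w \<in> path_space J"
    and g: "continuous_on I g" "g ` I \<subseteq> J" "g 0 = 0"
  shows "(\<lambda>t\<in>I. w (g t)) \<in> path_space I"
proof -
  have "continuous_on J w" using w by (simp add: path_space_def)
  then have "continuous_on I (\<lambda>t. w (g t))" by (rule continuous_on_compose2[OF _ g(1,2)])
  then have "continuous_on I (\<lambda>t\<in>I. w (g t))" by (rule continuous_on_eq) simp
  then show ?thesis using w g(3) I by (simp add: path_space_def time_set_def)
qed

text \<open>
  A path is the limit of its values at grid points, and the grid point is one of countably many.
\<close>

lemma jointly_measurable_evaluation:
  assumes J: "time_set J" and f: "f \<in> M \<rightarrow>\<^sub>M path_borel J" and [measurable]: "g \<in> borel_measurable M"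
    and gJ: "\<And>x. x \<in> space M \<Longrightarrow> g x \<in> J"
  shows "(\<lambda>x. f x (g x)) \<in> borel_measurable M"
proof -
  define k where "k m x = \<lfloor>real (Suc m) * g x\<rfloor>" for m x
  define v where "v m i x = (if real_of_int i / real (Suc m) \<in> J then f x (real_of_int i / real (Suc m)) else 0)" for m i x
  have grid: "grid_below (Suc m) (g x) = real_of_int (k m x) / real (Suc m)" for m x
    by (simp add: grid_below_def k_def)
  have fJ: "f x \<in> path_space J" if "x \<in> space M" for x using measurable_space[OF f that] by simp
  have "(\<lambda>x. v m (k m x) x) \<in> borel_measurable M" for m
  proof (rule measurable_compose_countable)
    show "k m \<in> M \<rightarrow>\<^sub>M count_space UNIV" unfolding k_def[abs_def] by measurable
    show "v m i \<in> borel_measurable M" for i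
    proof (cases "real_of_int i / real (Suc m) \<in> J")
      case True
      then show ?thesis
        unfolding v_def[abs_def] using measurable_compose[OF f evaluation_measurable[OF True]] by simp
    next
      case False
      then have "v m i = (\<lambda>_. 0)" by (simp only: v_def if_False fun_eq_iff simp_thms)
      then show ?thesis by simp
    qed
  qed
  then show ?thesis
  proof (rule borel_measurable_LIMSEQ_real[rotated])
    fix x assume x: "x \<in> space M"
    have "v m (k m x) x = f x (grid_below (Suc m) (g x))" for m
      using grid_below_in_time_set[OF J gJ[OF x], of "Suc m"] unfolding grid v_def by simp
    then show "(\<lambda>m. v m (k m x) x) \<longlonglongrightarrow> f x (g x)"
      using path_continuous_limit[OF J fJ[OF x] gJ[OF x]] by simp
  qed
qed

text \<open>
  The cylinders are stable under intersection (append the lists), which makes them suitable for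
  identifying measures.
\<close>

lemma sets_path_borel_cylinders:
  assumes I: "time_set I"
  shows "sets (path_borel I) = sigma_sets (path_space I)
    {{w \<in> path_space I. \<forall>(t, A)\<in>set L. w t \<in> A} |L. set L \<subseteq> I \<times> sets borel}"
    (is "_ = sigma_sets ?S ?G")
proof (rule antisym)
  have pow: "?G \<subseteq> Pow ?S" by auto
  have "(\<lambda>w. w) \<in> sigma ?S ?G \<rightarrow>\<^sub>M path_borel I"
  proof (rule measurable_path_borelI[OF I])
    fix t assume t: "t \<in> I"
    show "(\<lambda>w. w t) \<in> borel_measurable (sigma ?S ?G)"
    proof (rule measurableI)
      fix A :: "real set" assume A: "A \<in> sets borel"
      have "(\<lambda>w. w t) -` A \<inter> ?S = {w \<in> ?S. \<forall>(t, A)\<in>set [(t, A)]. w t \<in> A}" by auto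
      moreover have "set [(t, A)] \<subseteq> I \<times> sets borel" using t A by auto
      ultimately have "(\<lambda>w. w t) -` A \<inter> ?S \<in> ?G" by blast
      then show "(\<lambda>w. w t) -` A \<inter> space (sigma ?S ?G) \<in> sets (sigma ?S ?G)"
        using pow by (simp add: space_measure_of_conv sets_measure_of)
    qed simp
  qed (simp add: space_measure_of_conv)
  then have m: "(\<lambda>w. w) -` A \<inter> space (sigma ?S ?G) \<in> sets (sigma ?S ?G)"
    if "A \<in> sets (path_borel I)" for A
    using that by (rule measurable_sets)
  have "A \<in> sigma_sets ?S ?G" if A: "A \<in> sets (path_borel I)" for A
  proof -
    have "A \<subseteq> ?S" using sets.sets_into_space[OF A] by simp
    then have "(\<lambda>w. w) -` A \<inter> space (sigma ?S ?G) = A" by (auto simp: space_measure_of_conv)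
    then show ?thesis using m[OF A] pow by (simp add: sets_measure_of)
  qed
  then show "sets (path_borel I) \<subseteq> sigma_sets ?S ?G" by blast
  have "C \<in> sets (path_borel I)" if C: "C \<in> ?G" for C
  proof -
    obtain L where L: "set L \<subseteq> I \<times> sets borel" "C = {w \<in> ?S. \<forall>(t, A)\<in>set L. w t \<in> A}"
      using C by blast
    have "{w \<in> space (path_borel I). \<forall>p\<in>set L. w (fst p) \<in> snd p} \<in> sets (path_borel I)"
    proof (rule sets.sets_Collect_finite_All)
      fix p assume "p \<in> set L"
      then have p: "fst p \<in> I" "snd p \<in> sets borel" using L(1) by auto
      have "{w \<in> space (path_borel I). w (fst p) \<in> snd p}
          = (\<lambda>w. w (fst p)) -` snd p \<inter> space (path_borel I)" by auto
      then show "{w \<in> space (path_borel I). w (fst p) \<in> snd p} \<in> sets (path_borel I)"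
        using measurable_sets[OF evaluation_measurable[OF p(1)] p(2)] by simp
    qed simp
    then show ?thesis unfolding L(2) by (simp add: case_prod_beta)
  qed
  then have "?G \<subseteq> sets (path_borel I)" by blast
  then show "sigma_sets ?S ?G \<subseteq> sets (path_borel I)"
    using sets.sigma_sets_subset[of ?G "path_borel I"] by simp
qed

section \<open>Measures determined by cosine integrals\<close>

lemma (in finite_measure) integrable_cos:
  assumes "X \<in> borel_measurable M"
  shows "integrable M (\<lambda>x. cos (X x :: real))"
  using assms by (intro integrable_const_bound[of _ 1]) auto

text \<open>
  Levy's uniqueness theorem for the characteristic function, for finite measures and in real form:
  the sine transform is the cosine transform at phase \<open>- pi / 2\<close>.
\<close>

lemma finite_measure_eqI_cos:
  fixes \<mu> \<nu> :: "real measure"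
  assumes "finite_measure \<mu>" "finite_measure \<nu>" "sets \<mu> = sets borel" "sets \<nu> = sets borel"
    and eq: "\<And>b \<theta>. (LINT x|\<mu>. cos (b * x + \<theta>)) = (LINT x|\<nu>. cos (b * x + \<theta>))"
  shows "\<mu> = \<nu>"
proof -
  interpret m: finite_measure \<mu> by fact
  interpret n: finite_measure \<nu> by fact
  have [measurable_cong]: "sets \<mu> = sets borel" "sets \<nu> = sets borel" by fact+
  have sp: "space \<mu> = UNIV" "space \<nu> = UNIV"
    using assms(3,4) by (auto dest: sets_eq_imp_space_eq)
  define c where "c = measure \<mu> UNIV"
  have c: "measure \<nu> UNIV = c" using eq[of 0 0] by (simp add: c_def sp)
  show ?thesis
  proof (cases "c = 0")
    case True
    show ?thesis
    proof (rule measure_eqI)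
      fix A
      have "measure \<mu> A \<le> 0" "measure \<nu> A \<le> 0"
        using m.bounded_measure[of A] n.bounded_measure[of A] c True by (simp_all add: c_def sp)
      then have "measure \<mu> A = 0" "measure \<nu> A = 0" by (simp_all add: measure_le_0_iff)
      then show "emeasure \<mu> A = emeasure \<nu> A"
        by (simp add: m.emeasure_eq_measure n.emeasure_eq_measure)
    qed (simp add: assms)
  next
    case False
    then have "c > 0" using zero_less_measure_iff[of \<mu> UNIV] by (simp add: c_def)
    define D where "D \<rho> = density \<rho> (\<lambda>_. ennreal (1 / c))" for \<rho> :: "real measure"
    have em: "emeasure (D \<rho>) A = ennreal (1 / c) * emeasure \<rho> A"
      if "sets \<rho> = sets borel" "A \<in> sets borel" for \<rho> A
      unfolding D_def using that by (subst emeasure_density) (auto simp: nn_integral_cmult_indicator)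
    have rd: "real_distribution (D \<rho>)"
      if "sets \<rho> = sets borel" "finite_measure \<rho>" "measure \<rho> UNIV = c" for \<rho>
    proof -
      interpret r: finite_measure \<rho> by fact
      have "space \<rho> = UNIV" using that(1) by (auto dest: sets_eq_imp_space_eq)
      then have "prob_space (D \<rho>)"
        using em[OF that(1), of UNIV] \<open>c > 0\<close> that(3)
        by (intro prob_spaceI) (simp add: D_def r.emeasure_eq_measure ennreal_mult[symmetric] del: ennreal_1 flip: ennreal_1)
      then show ?thesis
        using that(1) by (simp add: real_distribution_def real_distribution_axioms_def D_def)
    qed
    have ch: "char (D \<rho>) t = complex_of_real ((LINT x|\<rho>. cos (t * x + 0)) / c)
        + \<i> * complex_of_real ((LINT x|\<rho>. cos (t * x + (- (pi/2)))) / c)"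
      if \<rho>: "sets \<rho> = sets borel" "finite_measure \<rho>" for \<rho> t
    proof -
      interpret r: finite_measure \<rho> by fact
      have [measurable_cong]: "sets \<rho> = sets borel" by fact
      have i1: "integrable \<rho> (\<lambda>x. complex_of_real (cos (t * x)) / complex_of_real c)"
        by (intro integrable_divide_zero integrable_of_real r.integrable_cos) measurable
      have i2: "integrable \<rho> (\<lambda>x. \<i> * (complex_of_real (cos (t * x - pi/2)) / complex_of_real c))"
        by (intro integrable_mult_right integrable_divide_zero integrable_of_real r.integrable_cos) measurable
      have "char (D \<rho>) t = (CLINT x|\<rho>. (1 / c) *\<^sub>R iexp (t * x))"
        unfolding char_def D_def using \<open>c > 0\<close> by (subst integral_density) auto
      also have "\<dots> = (CLINT x|\<rho>. complex_of_real (cos (t * x)) / complex_of_real c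
          + \<i> * (complex_of_real (cos (t * x - pi/2)) / complex_of_real c))"
        using \<open>c > 0\<close>
        by (intro Bochner_Integration.integral_cong refl complex_eqI) (simp_all add: Re_exp Im_exp cos_diff)
      also have "\<dots> = complex_of_real ((LINT x|\<rho>. cos (t * x + 0)) / c)
        + \<i> * complex_of_real ((LINT x|\<rho>. cos (t * x + (- (pi/2)))) / c)"
        by (subst Bochner_Integration.integral_add[OF i1 i2]) simp
      finally show ?thesis .
    qed
    have "D \<mu> = D \<nu>"
    proof (rule Levy_uniqueness)
      show "char (D \<mu>) = char (D \<nu>)"
        by (rule ext) (simp only: ch[OF assms(3,1)] ch[OF assms(4,2)] eq)
    qed (use rd assms c c_def in auto)
    show ?thesis
    proof (rule measure_eqI)
      fix A assume "A \<in> sets \<mu>"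
      then have A: "A \<in> sets borel" by (simp add: assms)
      have "emeasure \<rho> A = ennreal c * emeasure (D \<rho>) A" if "sets \<rho> = sets borel" for \<rho>
        using \<open>c > 0\<close> by (simp add: em[OF that A] mult.assoc[symmetric] ennreal_mult[symmetric])
      then show "emeasure \<mu> A = emeasure \<nu> A" using assms(3,4) \<open>D \<mu> = D \<nu>\<close> by metis
    qed (simp add: assms)
  qed
qed

text \<open>
  One-dimensional uniqueness in the presence of a weight. The weight may change sign, so uniqueness
  is applied to the positive density \<open>2 + g\<close> and the contribution of the constant \<open>2\<close> is subtracted.
\<close>

lemma integral_eq_of_weighted_cos:
  fixes X Y g k f :: "_ \<Rightarrow> real"
  assumes "finite_measure M" "finite_measure N"
    and [measurable]: "X \<in> borel_measurable M" "Y \<in> borel_measurable N"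
      "g \<in> borel_measurable M" "k \<in> borel_measurable N"
    and g: "\<And>x. \<bar>g x\<bar> \<le> 1" and k: "\<And>x. \<bar>k x\<bar> \<le> 1"
    and eq: "\<And>b \<theta>. (LINT x|M. cos (b * X x + \<theta>)) = (LINT x|N. cos (b * Y x + \<theta>))"
    and eqg: "\<And>b \<theta>. (LINT x|M. g x * cos (b * X x + \<theta>)) = (LINT x|N. k x * cos (b * Y x + \<theta>))"
    and [measurable]: "f \<in> borel_measurable borel"
    and f: "integrable M (\<lambda>x. f (X x))" "integrable N (\<lambda>x. f (Y x))"
  shows "(LINT x|M. g x * f (X x)) = (LINT x|N. k x * f (Y x))"
proof -
  interpret M: finite_measure M by fact
  interpret N: finite_measure N by fact
  have intg: "integrable M (\<lambda>x. g x * F x)" if "integrable M F" for F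
    by (rule Bochner_Integration.integrable_bound[OF that])
      (use that g in \<open>auto simp: abs_mult intro!: mult_left_le_one_le\<close>)
  have intk: "integrable N (\<lambda>x. k x * F x)" if "integrable N F" for F
    by (rule Bochner_Integration.integrable_bound[OF that])
      (use that k in \<open>auto simp: abs_mult intro!: mult_left_le_one_le\<close>)
  have g2: "0 \<le> 2 + g x" "0 \<le> 2 + k y" for x y using g[of x] k[of y] by linarith+
  have law: "distr M borel X = distr N borel Y"
    by (rule finite_measure_eqI_cos)
      (auto simp: integral_distr eq intro!: M.finite_measure_distr N.finite_measure_distr)
  have law2: "distr (density M (\<lambda>x. 2 + g x)) borel X = distr (density N (\<lambda>x. 2 + k x)) borel Y"
  proof (rule finite_measure_eqI_cos)
    show "finite_measure (distr (density M (\<lambda>x. 2 + g x)) borel X)"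
      using intg[of "\<lambda>_. 1"]
      by (intro finite_measure.finite_measure_distr finite_measureI)
         (auto simp: emeasure_density g2 nn_integral_eq_integral)
    show "finite_measure (distr (density N (\<lambda>x. 2 + k x)) borel Y)"
      using intk[of "\<lambda>_. 1"]
      by (intro finite_measure.finite_measure_distr finite_measureI)
         (auto simp: emeasure_density g2 nn_integral_eq_integral)
    fix b \<theta>
    have "(LINT x|M. (2 + g x) * cos (b * X x + \<theta>)) = (LINT x|N. (2 + k x) * cos (b * Y x + \<theta>))"
      using intg[OF M.integrable_cos[of "\<lambda>x. b * X x + \<theta>"]] intk[OF N.integrable_cos[of "\<lambda>x. b * Y x + \<theta>"]]
        M.integrable_cos[of "\<lambda>x. b * X x + \<theta>"] N.integrable_cos[of "\<lambda>x. b * Y x + \<theta>"]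
      by (simp add: distrib_right eq eqg)
    then show "(LINT x|distr (density M (\<lambda>x. 2 + g x)) borel X. cos (b * x + \<theta>)) =
        (LINT x|distr (density N (\<lambda>x. 2 + k x)) borel Y. cos (b * x + \<theta>))"
      by (simp add: integral_distr integral_density g2)
  qed auto
  have e1: "(LINT x|M. f (X x)) = (LINT x|N. f (Y x))"
    using arg_cong[OF law, of "\<lambda>\<mu>. integral\<^sup>L \<mu> f"] by (simp add: integral_distr)
  have "(LINT x|M. (2 + g x) * f (X x)) = (LINT x|N. (2 + k x) * f (Y x))"
    using arg_cong[OF law2, of "\<lambda>\<mu>. integral\<^sup>L \<mu> f"] by (simp add: integral_distr integral_density g2)
  then show ?thesis
    using intg[OF f(1)] intk[OF f(2)] f e1 by (simp add: distrib_right)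
qed

lemma lincomb_add_term:
  fixes a :: "real \<Rightarrow> real"
  assumes "finite J"
  obtains a' where "\<And>w :: real \<Rightarrow> real. (\<Sum>s\<in>insert t J. a' s * w s) = (\<Sum>s\<in>J. a s * w s) + b * w t"
proof (cases "t \<in> J")
  case True
  have "(\<Sum>s\<in>insert t J. (a(t := a t + b)) s * w s) = (\<Sum>s\<in>J. a s * w s) + b * w t" for w
  proof -
    have "(\<Sum>s\<in>J - {t}. (a(t := a t + b)) s * w s) = (\<Sum>s\<in>J - {t}. a s * w s)"
      by (rule sum.cong) auto
    then show ?thesis
      using True assms by (simp add: insert_absorb sum.remove[of J t] distrib_right)
  qed
  then show thesis by (rule that)
next
  case False
  have "(\<Sum>s\<in>insert t J. (a(t := b)) s * w s) = (\<Sum>s\<in>J. a s * w s) + b * w t" for w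
  proof -
    have "(\<Sum>s\<in>J. (a(t := b)) s * w s) = (\<Sum>s\<in>J. a s * w s)"
      using False by (intro sum.cong) auto
    then show ?thesis using False assms by simp
  qed
  then show thesis by (rule that)
qed

text \<open>
  This replaces uniqueness of multivariate characteristic functions. Indicators of evaluations are
  introduced one coordinate at a time: the product of the indicators introduced so far, times a
  cosine of the remaining linear combination, serves as the weight for one-dimensional uniqueness
  in the next coordinate.
\<close>

lemma path_measure_eqI_cos:
  assumes I: "time_set I" and fin: "finite_measure M" "finite_measure N"
    and sets: "sets M = sets (path_borel I)" "sets N = sets (path_borel I)"
    and eq: "\<And>J a \<theta>. finite J \<Longrightarrow> J \<subseteq> I \<Longrightarrow>
      (LINT w|M. cos ((\<Sum>t\<in>J. a t * w t) + \<theta>)) = (LINT w|N. cos ((\<Sum>t\<in>J. a t * w t) + \<theta>))"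
  shows "M = N"
proof -
  interpret M: finite_measure M by fact
  interpret N: finite_measure N by fact
  have [measurable_cong]: "sets M = sets (path_borel I)" "sets N = sets (path_borel I)" by fact+
  have sp: "space M = path_space I" "space N = path_space I"
    using sets[THEN sets_eq_imp_space_eq] by simp_all
  have [measurable]: "(\<lambda>w. w t) \<in> borel_measurable (path_borel I)" if "t \<in> I" for t
    using that by (rule evaluation_measurable)
  have lin[measurable]: "(\<lambda>w. \<Sum>t\<in>J. a t * w t) \<in> borel_measurable (path_borel I)" if "J \<subseteq> I" for J a
    using that by (intro borel_measurable_sum borel_measurable_times evaluation_measurable) auto
  define ind where "ind L w = (\<Prod>p\<leftarrow>L. indicator (snd p) (w (fst p)) :: real)" for L :: "(real \<times> real set) list" and w :: "real \<Rightarrow> real"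
  have ind_meas: "ind L \<in> borel_measurable (path_borel I)" if "set L \<subseteq> I \<times> sets borel" for L
    using that unfolding ind_def[abs_def]
  proof (induction L)
    case (Cons p L)
    then have [measurable]: "(\<lambda>w. w (fst p)) \<in> borel_measurable (path_borel I)" "snd p \<in> sets borel"
      by (auto intro: evaluation_measurable)
    from Cons have [measurable]: "(\<lambda>w. \<Prod>p\<leftarrow>L. indicator (snd p) (w (fst p)) :: real) \<in> borel_measurable (path_borel I)"
      by simp
    show ?case by simp
  qed simp
  have ind01: "0 \<le> ind L w" "ind L w \<le> 1" for L w
    unfolding ind_def by (induction L) (auto simp: indicator_def)
  have main: "(LINT w|M. ind L w * cos ((\<Sum>t\<in>J. a t * w t) + \<theta>))
      = (LINT w|N. ind L w * cos ((\<Sum>t\<in>J. a t * w t) + \<theta>))"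
    if "set L \<subseteq> I \<times> sets borel" "finite J" "J \<subseteq> I" for L J a \<theta>
    using that
  proof (induction L arbitrary: J a \<theta>)
    case Nil
    then show ?case using eq by (simp add: ind_def)
  next
    case (Cons p L)
    obtain t A where p: "p = (t, A)" by (cases p)
    have t: "t \<in> I" and A[measurable]: "A \<in> sets borel" and L: "set L \<subseteq> I \<times> sets borel"
      using Cons.prems(1) by (auto simp: p)
    have [measurable]: "(\<lambda>w. w t) \<in> borel_measurable (path_borel I)" using t by (rule evaluation_measurable)
    note [measurable] = ind_meas[OF L] lin[OF Cons.prems(3)]
    define g where "g w = ind L w * cos ((\<Sum>t\<in>J. a t * w t) + \<theta>)" for w
    have [measurable]: "g \<in> borel_measurable (path_borel I)" unfolding g_def[abs_def] by measurable
    have g1: "\<bar>g w\<bar> \<le> 1" for w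
      unfolding g_def abs_mult using ind01[of L w] by (intro mult_le_one) auto
    have prod: "g w * cos (b * w t + \<phi>)
       = (1/2) * (ind L w * cos ((\<Sum>t\<in>J. a t * w t) + (- b) * w t + (\<theta> - \<phi>)))
       + (1/2) * (ind L w * cos ((\<Sum>t\<in>J. a t * w t) + b * w t + (\<theta> + \<phi>)))" for w b \<phi>
    proof -
      have "k * cos A * cos B = (1/2) * (k * cos (A - B)) + (1/2) * (k * cos (A + B))" for k A B :: real
        by (simp add: cos_diff cos_add algebra_simps)
      note this[of "ind L w" "(\<Sum>t\<in>J. a t * w t) + \<theta>" "b * w t + \<phi>"]
      moreover have "(\<Sum>t\<in>J. a t * w t) + \<theta> - (b * w t + \<phi>) = (\<Sum>t\<in>J. a t * w t) + (- b) * w t + (\<theta> - \<phi>)"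
        "(\<Sum>t\<in>J. a t * w t) + \<theta> + (b * w t + \<phi>) = (\<Sum>t\<in>J. a t * w t) + b * w t + (\<theta> + \<phi>)"
        by (simp_all add: algebra_simps)
      ultimately show ?thesis unfolding g_def by (simp only:)
    qed
    have step: "(LINT w|M. ind L w * cos ((\<Sum>t\<in>J. a t * w t) + b * w t + \<psi>))
       = (LINT w|N. ind L w * cos ((\<Sum>t\<in>J. a t * w t) + b * w t + \<psi>))" for b \<psi>
    proof -
      obtain a' where a': "\<And>w :: real \<Rightarrow> real.
          (\<Sum>s\<in>insert t J. a' s * w s) = (\<Sum>s\<in>J. a s * w s) + b * w t"
        using lincomb_add_term[OF Cons.prems(2)] by metis
      show ?thesis
        using Cons.IH[OF L, of "insert t J" a' \<psi>] Cons.prems(2,3) t unfolding a' by simp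
    qed
    have intM: "integrable M (\<lambda>w. ind L w * cos ((\<Sum>t\<in>J. a t * w t) + b * w t + \<psi>))" for b \<psi>
      using ind01[of L] by (intro M.integrable_const_bound[of _ 1]) (auto simp: abs_mult intro!: mult_le_one)
    have intN: "integrable N (\<lambda>w. ind L w * cos ((\<Sum>t\<in>J. a t * w t) + b * w t + \<psi>))" for b \<psi>
      using ind01[of L] by (intro N.integrable_const_bound[of _ 1]) (auto simp: abs_mult intro!: mult_le_one)
    have "(LINT w|M. g w * indicator A (w t)) = (LINT w|N. g w * indicator A (w t))"
    proof (rule integral_eq_of_weighted_cos[where X = "\<lambda>w. w t" and Y = "\<lambda>w. w t", OF fin])
      show "(LINT w|M. cos (b * w t + \<phi>)) = (LINT w|N. cos (b * w t + \<phi>))" for b \<phi>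
        using eq[of "{t}" "\<lambda>_. b" \<phi>] t by simp
      show "(LINT w|M. g w * cos (b * w t + \<phi>)) = (LINT w|N. g w * cos (b * w t + \<phi>))" for b \<phi>
      proof -
        have "(LINT w|M. g w * cos (b * w t + \<phi>))
          = (1/2) * (LINT w|M. ind L w * cos ((\<Sum>t\<in>J. a t * w t) + (- b) * w t + (\<theta> - \<phi>)))
          + (1/2) * (LINT w|M. ind L w * cos ((\<Sum>t\<in>J. a t * w t) + b * w t + (\<theta> + \<phi>)))"
          unfolding prod
          by (subst Bochner_Integration.integral_add[OF integrable_mult_right[OF intM] integrable_mult_right[OF intM]])
            (simp only: integral_mult_right_zero)
        moreover have "(LINT w|N. g w * cos (b * w t + \<phi>))
          = (1/2) * (LINT w|N. ind L w * cos ((\<Sum>t\<in>J. a t * w t) + (- b) * w t + (\<theta> - \<phi>)))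
          + (1/2) * (LINT w|N. ind L w * cos ((\<Sum>t\<in>J. a t * w t) + b * w t + (\<theta> + \<phi>)))"
          unfolding prod
          by (subst Bochner_Integration.integral_add[OF integrable_mult_right[OF intN] integrable_mult_right[OF intN]])
            (simp only: integral_mult_right_zero)
        ultimately show ?thesis by (simp only: step)
      qed
      show "integrable M (\<lambda>w. indicator A (w t) :: real)"
        by (intro M.integrable_const_bound[of _ 1]) (auto simp: indicator_def)
      show "integrable N (\<lambda>w. indicator A (w t) :: real)"
        by (intro N.integrable_const_bound[of _ 1]) (auto simp: indicator_def)
    qed (use g1 in auto)
    moreover have "ind (p # L) w * cos ((\<Sum>t\<in>J. a t * w t) + \<theta>) = g w * indicator A (w t)" for w
      by (simp add: p ind_def g_def)
    ultimately show ?case by simp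
  qed
  let ?G = "{{w \<in> path_space I. \<forall>(t, A)\<in>set L. w t \<in> A} |L. set L \<subseteq> I \<times> sets borel}"
  show ?thesis
  proof (rule measure_eqI_generator_eq[of ?G "path_space I" M N "\<lambda>_. path_space I"])
    show "Int_stable ?G"
    proof (rule Int_stableI)
      fix a b assume "a \<in> ?G" "b \<in> ?G"
      then obtain L L' where "set L \<subseteq> I \<times> sets borel" "set L' \<subseteq> I \<times> sets borel"
        and ab: "a = {w \<in> path_space I. \<forall>(t, A)\<in>set L. w t \<in> A}"
          "b = {w \<in> path_space I. \<forall>(t, A)\<in>set L'. w t \<in> A}" by blast
      then have "set (L @ L') \<subseteq> I \<times> sets borel" by simp
      moreover have "a \<inter> b = {w \<in> path_space I. \<forall>(t, A)\<in>set (L @ L'). w t \<in> A}"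
        unfolding ab set_append by blast
      ultimately show "a \<inter> b \<in> ?G" by blast
    qed
    show "sets M = sigma_sets (path_space I) ?G" "sets N = sigma_sets (path_space I) ?G"
      using sets_path_borel_cylinders[OF I] sets by simp_all
    have "path_space I = {w \<in> path_space I. \<forall>(t, A)\<in>set []. w t \<in> A}" by simp
    moreover have "set [] \<subseteq> I \<times> sets borel" by simp
    ultimately have "path_space I \<in> ?G" by blast
    then show "range (\<lambda>_. path_space I) \<subseteq> ?G" by blast
    fix C assume "C \<in> ?G"
    then obtain L where L: "set L \<subseteq> I \<times> sets borel"
      and C: "C = {w \<in> path_space I. \<forall>(t, A)\<in>set L. w t \<in> A}" by blast
    have "C \<in> sets (path_borel I)" 
      unfolding sets_path_borel_cylinders[OF I] using \<open>C \<in> ?G\<close> by (rule sigma_sets.Basic)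
    moreover have ind_eq: "ind L' w = (if \<forall>p\<in>set L'. w (fst p) \<in> snd p then 1 else 0)" for L' w
      unfolding ind_def by (induction L') (auto simp: indicator_def)
    have "indicator C w = ind L w" if "w \<in> path_space I" for w
      using that unfolding C ind_eq by (auto simp: indicator_def case_prod_beta)
    then have "(LINT w|M. ind L w) = (LINT w|M. indicator C w)" "(LINT w|N. ind L w) = (LINT w|N. indicator C w)"
      using Bochner_Integration.integral_cong[of M M "ind L" "indicator C"]
        Bochner_Integration.integral_cong[of N N "ind L" "indicator C"] by (simp_all add: sp)
    moreover have "C \<inter> path_space I = C" unfolding C by auto
    ultimately have "measure M C = measure N C"
      using main[OF L, of "{}" undefined 0] sets by (simp add: sp)
    then show "emeasure M C = emeasure N C"
      by (simp add: M.emeasure_eq_measure N.emeasure_eq_measure)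
  qed (auto simp: M.emeasure_eq_measure)
qed

section \<open>The kernel and the covariance\<close>

lemma nn_integral_powr_shifted:
  assumes "p > -1" "r \<le> t"
  shows "(\<integral>\<^sup>+u. ennreal ((u - r) powr p) * indicator {r..t} u \<partial>lborel) = ennreal ((t - r) powr (p + 1) / (p + 1))"
proof -
  have "(\<integral>\<^sup>+u. ennreal ((u - r) powr p) * indicator {r..t} u \<partial>lborel)
    = (\<integral>\<^sup>+x. ennreal (x powr p) * indicator {0..t - r} x \<partial>lborel)"
    by (subst nn_integral_real_affine[where t = r and c = 1])
      (auto simp: indicator_def intro!: nn_integral_cong)
  also have "\<dots> = ennreal ((t - r) powr (p + 1) / (p + 1))"
    using assms by (intro nn_integral_has_integral_lebesgue' has_integral_powr_from_0) auto
  finally show ?thesis .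
qed

lemma nn_integral_Beta_interval:
  assumes "0 < a" "0 < b" "r < x"
  shows "(\<integral>\<^sup>+u. ennreal ((u - r) powr (a - 1) * (x - u) powr (b - 1)) * indicator {r..x} u \<partial>lborel)
    = ennreal (Beta a b * (x - r) powr (a + b - 1))"
proof -
  define d where "d = x - r"
  have d: "d > 0" and x: "x = r + d" using assms by (auto simp: d_def)
  have "(\<integral>\<^sup>+u. ennreal ((u - r) powr (a - 1) * (x - u) powr (b - 1)) * indicator {r..x} u \<partial>lborel)
    = ennreal \<bar>d\<bar> * (\<integral>\<^sup>+y. ennreal ((r + d * y - r) powr (a - 1) * (x - (r + d * y)) powr (b - 1))
        * indicator {r..x} (r + d * y) \<partial>lborel)"
    using d by (intro nn_integral_real_affine) auto
  also have "(\<integral>\<^sup>+y. ennreal ((r + d * y - r) powr (a - 1) * (x - (r + d * y)) powr (b - 1))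
        * indicator {r..x} (r + d * y) \<partial>lborel) = (\<integral>\<^sup>+y. ennreal (d powr (a + b - 2)) *
      (ennreal (y powr (a - 1) * (1 - y) powr (b - 1)) * indicator {0..1} y) \<partial>lborel)"
  proof (rule nn_integral_cong)
    fix y
    have ind: "indicator {r..x} (r + d * y) = (indicator {0..1} y :: ennreal)"
      using d by (auto simp: indicator_def zero_le_mult_iff x)
    show "ennreal ((r + d * y - r) powr (a - 1) * (x - (r + d * y)) powr (b - 1)) * indicator {r..x} (r + d * y)
      = ennreal (d powr (a + b - 2)) * (ennreal (y powr (a - 1) * (1 - y) powr (b - 1)) * indicator {0..1} y)"
    proof (cases "y \<in> {0..1}")
      case True
      have e: "x - (r + d * y) = d * (1 - y)" "r + d * y - r = d * y" by (auto simp: x algebra_simps)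
      have "d powr (a + b - 2) = d powr (a - 1) * d powr (b - 1)"
        by (simp add: powr_add[symmetric])
      then show ?thesis unfolding ind e using True d
        by (simp add: powr_mult ennreal_mult[symmetric] mult_ac)
    qed (simp add: ind)
  qed
  also have "ennreal \<bar>d\<bar> * \<dots> = ennreal d * (ennreal (d powr (a + b - 2)) * ennreal (Beta a b))"
    using d
    using nn_integral_has_integral_lebesgue'[OF _ has_integral_Beta_real[OF assms(1,2)]]
    by (subst nn_integral_cmult) auto
  also have "\<dots> = ennreal (Beta a b * d powr (a + b - 1))"
  proof -
    have "d powr (a + b - 1) = d * d powr (a + b - 2)"
      using d powr_add[of d 1 "a + b - 2"] by simp
    moreover have "Beta a b \<ge> 0" using assms by (simp add: Beta_def)
    ultimately show ?thesis using d by (simp add: ennreal_mult[symmetric] mult_ac)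
  qed
  finally show ?thesis by (simp add: d_def)
qed

lemma indicator_cmult: "ennreal (c * indicator A x) = ennreal c * indicator A x"
  by (simp split: split_indicator)

text \<open>
  The integral over \<open>r\<close> that arises from the product of two kernels. The substitution
  \<open>y = r * (v - u) / (u * (v - r))\<close> maps \<open>[0,u]\<close> onto \<open>[0,1]\<close> and the integrand to a multiple of
  the Beta density; the identity of the integrands is checked on logarithms.
\<close>

lemma nn_integral_two_point_kernel:
  assumes H: "1/2 < H" "H < 1" and uv: "0 < u" "u < v"
  shows "(\<integral>\<^sup>+r. ennreal (r powr (1 - 2*H) * (u - r) powr (H - 3/2) * (v - r) powr (H - 3/2))
      * indicator {0..u} r \<partial>lborel)
    = ennreal (Beta (2 - 2*H) (H - 1/2) * (u * v) powr (1/2 - H) * (v - u) powr (2*H - 2))"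
proof -
  define g where "g r = r * (v - u) / (u * (v - r))" for r
  define g' where "g' r = v * (v - u) / (u * (v - r)\<^sup>2)" for r
  define f where "f y = y powr (1 - 2*H) * (1 - y) powr (H - 3/2)" for y :: real
  define C where "C = (u * v) powr (1/2 - H) * (v - u) powr (2*H - 2)"
  have g01: "g 0 = 0" "g u = 1" using uv by (auto simp: g_def)
  have "(\<integral>\<^sup>+y. ennreal (f y) * indicator {0..1} y \<partial>lborel) = ennreal (Beta (2 - 2*H) (H - 1/2))"
    unfolding f_def using H has_integral_Beta_real[of "2 - 2*H" "H - 1/2"]
    by (intro nn_integral_has_integral_lebesgue') auto
  moreover have "(\<integral>\<^sup>+y. ennreal (f y * indicator {g 0..g u} y) \<partial>lborel)
      = (\<integral>\<^sup>+r. ennreal (f (g r) * g' r * indicator {0..u} r) \<partial>lborel)"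
  proof (rule nn_integral_substitution)
    show "set_borel_measurable borel {g 0..g u} f"
      unfolding set_borel_measurable_def f_def by measurable
    show "(g has_real_derivative g' r) (at r)" if "r \<in> {0..u}" for r
    proof -
      have z: "v - r \<noteq> 0" "u \<noteq> 0" using that uv by auto
      have "(g has_real_derivative ((v - u) * (u * (v - r)) - r * (v - u) * (- u)) / (u * (v - r) * (u * (v - r)))) (at r)"
        unfolding g_def[abs_def] using z by (auto intro!: derivative_eq_intros)
      also have "((v - u) * (u * (v - r)) - r * (v - u) * (- u)) = u * (v * (v - u))" by (simp add: algebra_simps)
      also have "u * (v * (v - u)) / (u * (v - r) * (u * (v - r))) = g' r"
        using z by (simp add: g'_def power2_eq_square)
      finally show ?thesis .
    qed
    show "continuous_on {0..u} g'"
      unfolding g'_def[abs_def] using uv by (intro continuous_intros) auto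
    show "0 \<le> g' r" if "r \<in> {0..u}" for r using uv by (simp add: g'_def)
  qed (use uv in simp)
  ultimately have beta: "(\<integral>\<^sup>+r. ennreal (f (g r) * g' r * indicator {0..u} r) \<partial>lborel)
      = ennreal (Beta (2 - 2*H) (H - 1/2))"
    unfolding g01
    using nn_integral_cong[of lborel "\<lambda>y. ennreal (f y * indicator {0..1} y)" "\<lambda>y. ennreal (f y) * indicator {0..1} y",
        OF indicator_cmult]
    by simp
  have pt: "C * (f (g r) * g' r) = r powr (1 - 2*H) * (u - r) powr (H - 3/2) * (v - r) powr (H - 3/2)"
    if r: "r \<in> {0..u}" for r
  proof (cases "r = 0 \<or> r = u")
    case True
    then show ?thesis using g01 by (auto simp: f_def)
  next
    case False
    then have pos: "0 < r" "0 < u - r" "0 < v - r" "0 < v - u" "0 < v" "0 < u" using r uv by auto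
    have one: "1 - g r = v * (u - r) / (u * (v - r))"
      using pos by (simp add: g_def field_simps)
    have lnp: "x powr p = exp (p * ln x)" if "x > 0" for x p :: real using that by (simp add: powr_def)
    have l1: "ln (g r) = ln r + ln (v - u) - ln u - ln (v - r)"
      using pos by (simp add: g_def ln_mult ln_div)
    have l2: "ln (1 - g r) = ln v + ln (u - r) - ln u - ln (v - r)"
      unfolding one using pos by (simp add: ln_mult ln_div)
    have l3: "ln (g' r) = ln v + ln (v - u) - ln u - 2 * ln (v - r)"
      using pos by (simp add: g'_def ln_mult ln_div ln_realpow)
    have l4: "ln (u * v) = ln u + ln v" using pos by (simp add: ln_mult)
    have p: "g r > 0" "1 - g r > 0" "g' r > 0" "u * v > 0"
      unfolding one using pos by (auto simp: g_def g'_def)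
    have e: "g' r = exp (ln (g' r))" using p by simp
    have "C * (f (g r) * g' r) = exp ((1/2 - H) * ln (u * v) + (2*H - 2) * ln (v - u)
        + (1 - 2*H) * ln (g r) + (H - 3/2) * ln (1 - g r) + ln (g' r))"
      unfolding C_def f_def using p pos
      by (subst e) (simp only: lnp exp_add mult_ac)
    also have "\<dots> = exp ((1 - 2*H) * ln r + (H - 3/2) * ln (u - r) + (H - 3/2) * ln (v - r))"
      unfolding l1 l2 l3 l4 by (rule arg_cong[where f = exp]) (simp add: field_simps)
    also have "\<dots> = r powr (1 - 2*H) * (u - r) powr (H - 3/2) * (v - r) powr (H - 3/2)"
      using pos by (simp only: lnp exp_add)
    finally show ?thesis .
  qed
  have C: "C \<ge> 0" by (simp add: C_def)
  have fg: "0 \<le> f (g r) * g' r" for r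
    unfolding f_def g'_def using uv by simp
  have "(\<integral>\<^sup>+r. ennreal (r powr (1 - 2*H) * (u - r) powr (H - 3/2) * (v - r) powr (H - 3/2))
      * indicator {0..u} r \<partial>lborel)
    = (\<integral>\<^sup>+r. ennreal C * ennreal (f (g r) * g' r * indicator {0..u} r) \<partial>lborel)"
  proof (rule nn_integral_cong)
    fix r
    show "ennreal (r powr (1 - 2*H) * (u - r) powr (H - 3/2) * (v - r) powr (H - 3/2)) * indicator {0..u} r
      = ennreal C * ennreal (f (g r) * g' r * indicator {0..u} r)"
    proof (cases "r \<in> {0..u}")
      case True
      then show ?thesis unfolding pt[OF True, symmetric] using C fg by (simp add: ennreal_mult)
    qed simp
  qed
  also have "\<dots> = ennreal C * ennreal (Beta (2 - 2*H) (H - 1/2))"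
    unfolding beta[symmetric] by (rule nn_integral_cmult) (simp add: f_def g_def g'_def)
  also have "\<dots> = ennreal (Beta (2 - 2*H) (H - 1/2) * (u * v) powr (1/2 - H) * (v - u) powr (2*H - 2))"
    using H by (simp add: ennreal_mult[symmetric] C_def Beta_def mult_ac)
  finally show ?thesis .
qed

text \<open>
  Up to the factor \<open>H * (2 * H - 1)\<close>, the function \<open>\<bar>u - v\<bar> powr (2 * H - 2)\<close> is the mixed second
  derivative of the covariance. Its singularity on the diagonal is integrable because \<open>H > 1/2\<close>.
\<close>

lemma nn_integral_abs_diff_powr:
  assumes H: "1/2 < H" "H < 1" and ts: "0 \<le> t" "0 \<le> s"
  shows "(\<integral>\<^sup>+u. (\<integral>\<^sup>+v. ennreal (\<bar>u - v\<bar> powr (2*H - 2)) * indicator {0..s} v \<partial>lborel) * indicator {0..t} u \<partial>lborel)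
    = ennreal (R_cov H t s / (H * (2*H - 1)))"
proof -
  define p where "p = 2*H - 1"
  have p: "0 < p" "p < 1" using H by (auto simp: p_def)
  \<comment> \<open>The odd power \<open>sgn x * \<bar>x\<bar> powr p\<close>, in a form whose continuity at 0 is immediate.\<close>
  define \<phi> where "\<phi> x = (max x 0) powr p - (max (- x) 0) powr p" for x :: real
  have cont: "continuous_on A (\<lambda>x. \<phi> (h x))" if "continuous_on A h" for A and h :: "real \<Rightarrow> real"
    unfolding \<phi>_def using p that
    by (intro continuous_on_diff continuous_on_powr' continuous_on_max continuous_on_minus continuous_on_const) auto
  have d\<phi>: "(\<phi> has_real_derivative p * \<bar>x\<bar> powr (p - 1)) (at x)" if "x \<noteq> 0" for x
  proof (cases "x > 0")
    case True
    have "((\<lambda>x. x powr p) has_real_derivative p * \<bar>x\<bar> powr (p - 1)) (at x)"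
      using True by (auto intro!: derivative_eq_intros)
    then show ?thesis
      by (rule has_field_derivative_transform_within[where d = x])
        (use True p in \<open>auto simp: \<phi>_def dist_real_def max_def abs_if split: if_splits\<close>)
  next
    case False
    then have "x < 0" using that by simp
    have "((\<lambda>x. - ((- x) powr p)) has_real_derivative p * \<bar>x\<bar> powr (p - 1)) (at x)"
      using \<open>x < 0\<close> by (auto intro!: derivative_eq_intros)
    then show ?thesis
      by (rule has_field_derivative_transform_within[where d = "- x"])
        (use \<open>x < 0\<close> p in \<open>auto simp: \<phi>_def dist_real_def max_def abs_if split: if_splits\<close>)
  qed
  have inner: "(\<integral>\<^sup>+v. ennreal (\<bar>u - v\<bar> powr (2*H - 2)) * indicator {0..s} v \<partial>lborel)
      = ennreal ((u powr p + \<phi> (s - u)) / p)" if "u \<ge> 0" for u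
  proof -
    have "((\<lambda>v. \<bar>u - v\<bar> powr (2*H - 2)) has_integral (\<phi> (s - u) / p - \<phi> (0 - u) / p)) {0..s}"
    proof (rule fundamental_theorem_of_calculus_interior_strong[of "{u}"])
      fix v assume "v \<in> {0<..<s} - {u}"
      then have "v - u \<noteq> 0" by simp
      have "((\<lambda>v. \<phi> (v - u) / p) has_real_derivative (p * \<bar>v - u\<bar> powr (p - 1)) * 1 / p) (at v)"
      proof -
        have "((\<lambda>v. v - u) has_real_derivative 1) (at v)" by (auto intro!: derivative_eq_intros)
        from DERIV_chain2[OF d\<phi>[OF \<open>v - u \<noteq> 0\<close>] this] show ?thesis by (rule DERIV_cdivide)
      qed
      then show "((\<lambda>v. \<phi> (v - u) / p) has_vector_derivative \<bar>u - v\<bar> powr (2*H - 2)) (at v)"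
        using p by (simp add: has_real_derivative_iff_has_vector_derivative p_def abs_minus_commute)
    qed (use ts p in \<open>auto intro!: continuous_intros cont\<close>)
    moreover have "\<phi> (0 - u) = - (u powr p)" using that p by (simp add: \<phi>_def)
    ultimately show ?thesis
      by (intro nn_integral_has_integral_lebesgue') (simp_all add: add_divide_distrib add.commute)
  qed
  have outer: "((\<lambda>u. (u powr p + \<phi> (s - u)) / p) has_integral
      ((t powr (p+1) - \<bar>s - t\<bar> powr (p+1)) / (p * (p+1)) - (0 powr (p+1) - \<bar>s - 0\<bar> powr (p+1)) / (p * (p+1)))) {0..t}"
  proof (rule fundamental_theorem_of_calculus_interior_strong[of "{s}"])
    fix u assume "u \<in> {0<..<t} - {s}"
    then have u: "u > 0" "u \<noteq> s" by auto
    have d1: "((\<lambda>u. u powr (p+1)) has_real_derivative (p+1) * u powr p) (at u)"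
      using u by (auto intro!: derivative_eq_intros)
    have d2: "((\<lambda>u. \<bar>s - u\<bar> powr (p+1)) has_real_derivative - ((p+1) * \<phi> (s - u))) (at u)"
    proof (cases "u < s")
      case True
      have "((\<lambda>u. (s - u) powr (p+1)) has_real_derivative - ((p+1) * (s - u) powr p)) (at u)"
        using True by (auto intro!: derivative_eq_intros)
      then have "((\<lambda>u. (s - u) powr (p+1)) has_real_derivative - ((p+1) * \<phi> (s - u))) (at u)"
        using True p by (simp add: \<phi>_def max_def)
      then show ?thesis
        by (rule has_field_derivative_transform_within[where d = "s - u"])
          (use True in \<open>auto simp: dist_real_def abs_if split: if_splits\<close>)
    next
      case False
      then have "s < u" using u by simp
      have "((\<lambda>u. (u - s) powr (p+1)) has_real_derivative ((p+1) * (u - s) powr p)) (at u)"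
        using \<open>s < u\<close> by (auto intro!: derivative_eq_intros)
      then have "((\<lambda>u. (u - s) powr (p+1)) has_real_derivative - ((p+1) * \<phi> (s - u))) (at u)"
        using \<open>s < u\<close> p by (simp add: \<phi>_def max_def algebra_simps)
      then show ?thesis
        by (rule has_field_derivative_transform_within[where d = "u - s"])
          (use \<open>s < u\<close> in \<open>auto simp: dist_real_def abs_if split: if_splits\<close>)
    qed
    have "((\<lambda>u. (u powr (p+1) - \<bar>s - u\<bar> powr (p+1)) / (p * (p+1))) has_real_derivative
        (((p+1) * u powr p - (- ((p+1) * \<phi> (s - u)))) / (p * (p+1)))) (at u)"
      by (intro DERIV_cdivide DERIV_diff d1 d2)
    moreover have "(((p+1) * u powr p - (- ((p+1) * \<phi> (s - u)))) / (p * (p+1))) = (u powr p + \<phi> (s - u)) / p"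
    proof -
      have "(p+1) * u powr p - (- ((p+1) * \<phi> (s - u))) = (p+1) * (u powr p + \<phi> (s - u))"
        by (simp add: algebra_simps)
      moreover have "(p+1) * A / (p * (p+1)) = A / p" for A using p by simp
      ultimately show ?thesis by simp
    qed
    ultimately show "((\<lambda>u. (u powr (p+1) - \<bar>s - u\<bar> powr (p+1)) / (p * (p+1))) has_vector_derivative
        (u powr p + \<phi> (s - u)) / p) (at u)"
      by (simp add: has_real_derivative_iff_has_vector_derivative)
  qed (use ts p in \<open>auto intro!: continuous_intros continuous_on_powr'\<close>)
  have nonneg: "0 \<le> (u powr p + \<phi> (s - u)) / p" if "u \<in> {0..t}" for u
  proof (rule divide_nonneg_pos[OF _ p(1)])
    have "(max (- (s - u)) 0) powr p \<le> u powr p"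
      using that p ts by (intro powr_mono2) auto
    moreover have "0 \<le> max (s - u) 0 powr p" by simp
    ultimately show "0 \<le> u powr p + \<phi> (s - u)" unfolding \<phi>_def by linarith
  qed
  have "(\<integral>\<^sup>+u. (\<integral>\<^sup>+v. ennreal (\<bar>u - v\<bar> powr (2*H - 2)) * indicator {0..s} v \<partial>lborel) * indicator {0..t} u \<partial>lborel)
     = (\<integral>\<^sup>+u. ennreal ((u powr p + \<phi> (s - u)) / p) * indicator {0..t} u \<partial>lborel)"
    by (intro nn_integral_cong) (auto simp: inner split: split_indicator)
  also have "\<dots> = ennreal ((t powr (p+1) - \<bar>s - t\<bar> powr (p+1)) / (p * (p+1)) - (0 powr (p+1) - \<bar>s - 0\<bar> powr (p+1)) / (p * (p+1)))"
    by (rule nn_integral_has_integral_lebesgue'[OF nonneg outer])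
  also have "\<dots> = ennreal (R_cov H t s / (H * (2*H - 1)))"
  proof -
    have "p + 1 = 2*H" by (simp add: p_def)
    moreover have "(A - B) / (p * (2*H)) - (0 - C) / (p * (2*H)) = (A + C - B) / 2 / (H * p)" for A B C :: real
      using p H by (simp add: field_simps)
    ultimately show ?thesis using ts p by (simp add: R_cov_def p_def abs_minus_commute)
  qed
  finally show ?thesis .
qed

text \<open>
  Up to the factor \<open>c_const H\<close>, the kernel is the integral of this function over \<open>u\<close>
  (lemma \<open>K_kernel_eq\<close>). It is nonnegative and lives on \<open>0 < r \<le> u \<le> t\<close>, so that Tonelli's
  theorem can exchange the variables \<open>r\<close> and \<open>u\<close>.
\<close>

definition kernel_density :: "real \<Rightarrow> real \<Rightarrow> real \<Rightarrow> real \<Rightarrow> real" where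
  "kernel_density H t r u = indicator {0<..} r * indicator {r..t} u *
     (r powr (1/2 - H) * u powr (H - 1/2) * (u - r) powr (H - 3/2))"

lemma kernel_density_nonneg [simp]: "0 \<le> kernel_density H t r u"
  by (simp add: kernel_density_def)

lemma kernel_density_measurable [measurable (raw)]:
  assumes [measurable]: "f \<in> borel_measurable M" "g \<in> borel_measurable M"
  shows "(\<lambda>x. kernel_density H t (f x) (g x)) \<in> borel_measurable M"
proof -
  have "(\<lambda>x. kernel_density H t (f x) (g x)) = (\<lambda>x. if 0 < f x \<and> f x \<le> g x \<and> g x \<le> t
      then f x powr (1/2 - H) * g x powr (H - 1/2) * (g x - f x) powr (H - 3/2) else 0)"
    by (auto simp: kernel_density_def indicator_def)
  then show ?thesis by simp
qed

lemma kernel_density_nn_integral_bound: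
  assumes H: "1/2 < H" and t: "0 \<le> t"
  shows "(\<integral>\<^sup>+u. ennreal (kernel_density H t r u) \<partial>lborel)
    \<le> ennreal (t powr (2*H - 1) / (H - 1/2) * (indicator {0<..t} r * r powr (1/2 - H)))"
proof (cases "0 < r \<and> r \<le> t")
  case True
  then have r: "0 < r" "r \<le> t" by auto
  have "(\<integral>\<^sup>+u. ennreal (kernel_density H t r u) \<partial>lborel)
    \<le> (\<integral>\<^sup>+u. ennreal (r powr (1/2 - H) * t powr (H - 1/2)) *
        (ennreal ((u - r) powr (H - 3/2)) * indicator {r..t} u) \<partial>lborel)"
  proof (rule nn_integral_mono)
    fix u
    show "ennreal (kernel_density H t r u) \<le> ennreal (r powr (1/2 - H) * t powr (H - 1/2)) *
        (ennreal ((u - r) powr (H - 3/2)) * indicator {r..t} u)"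
    proof (cases "u \<in> {r..t}")
      case True
      have "r powr (1/2 - H) * u powr (H - 1/2) * (u - r) powr (H - 3/2)
        \<le> r powr (1/2 - H) * t powr (H - 1/2) * (u - r) powr (H - 3/2)"
        using True r H by (intro mult_right_mono mult_left_mono powr_mono2) auto
      then show ?thesis using True r by (simp add: kernel_density_def ennreal_mult[symmetric])
    qed (simp add: kernel_density_def)
  qed
  also have "\<dots> = ennreal (r powr (1/2 - H) * t powr (H - 1/2)) * ennreal ((t - r) powr (H - 1/2) / (H - 1/2))"
    using nn_integral_powr_shifted[of "H - 3/2" r t] H r
    by (subst nn_integral_cmult) (auto simp: algebra_simps)
  also have "\<dots> \<le> ennreal (r powr (1/2 - H) * t powr (H - 1/2)) * ennreal (t powr (H - 1/2) / (H - 1/2))"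
    using r H by (intro mult_left_mono ennreal_leI divide_right_mono powr_mono2) auto
  also have "\<dots> = ennreal (t powr (2*H - 1) / (H - 1/2) * (indicator {0<..t} r * r powr (1/2 - H)))"
  proof -
    have "t powr (2*H - 1) = t powr (H - 1/2) * t powr (H - 1/2)" by (simp add: powr_add[symmetric])
    then show ?thesis using r H by (simp add: ennreal_mult[symmetric] mult_ac)
  qed
  finally show ?thesis .
next
  case False
  then have "kernel_density H t r u = 0" for u by (auto simp: kernel_density_def)
  then show ?thesis by simp
qed

lemma K_kernel_eq:
  "K_kernel H t r = c_const H * (LINT u|lborel. kernel_density H t r u)"
proof (cases "0 < r")
  case True
  have "(LINT u|lborel. kernel_density H t r u)
     = r powr (1/2 - H) * (LINT u:{r..t}|lborel. u powr (H - 1/2) * (u - r) powr (H - 3/2))"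
    using True unfolding set_lebesgue_integral_def integral_mult_right_zero[symmetric]
    by (intro Bochner_Integration.integral_cong) (auto simp: kernel_density_def)
  moreover have "(LINT u:{r..t}|lborel. u powr (H - 1/2) * (u - r) powr (H - 3/2)) = 0" if "r > t"
    using that by (simp add: set_lebesgue_integral_def)
  ultimately show ?thesis using True by (auto simp: K_kernel_def indicator_def)
qed (simp add: K_kernel_def kernel_density_def)

lemma c_const_nonneg: "1/2 < H \<Longrightarrow> H < 1 \<Longrightarrow> 0 \<le> c_const H"
  by (simp add: c_const_def)

lemma c_const_pos: "1/2 < H \<Longrightarrow> H < 1 \<Longrightarrow> 0 < c_const H"
  unfolding c_const_def by (intro real_sqrt_gt_zero divide_pos_pos mult_pos_pos Gamma_real_pos) auto

text \<open>
  The normalisation of the kernel is chosen so that the Beta factor of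
  \<open>nn_integral_two_point_kernel\<close> turns into \<open>H * (2 * H - 1)\<close>.
\<close>

lemma c_const_Beta:
  assumes "1/2 < H" "H < 1"
  shows "(c_const H)\<^sup>2 * Beta (2 - 2*H) (H - 1/2) = H * (2*H - 1)"
proof -
  have pos: "Gamma (3/2 - H) > 0" "Gamma (2 - 2*H) > 0" "Gamma (H - 1/2) > 0"
    using assms by (auto intro!: Gamma_real_pos)
  have e: "2 - 2*H + (H - 1/2) = 3/2 - H" by simp
  have "(c_const H)\<^sup>2 = H * (2*H - 1) * Gamma (3/2 - H) / (Gamma (2 - 2*H) * Gamma (H - 1/2))"
    unfolding c_const_def using pos assms by (intro real_sqrt_pow2) auto
  then show ?thesis unfolding Beta_def e using pos by simp
qed

lemma K_kernel_nonneg: "1/2 < H \<Longrightarrow> H < 1 \<Longrightarrow> 0 \<le> K_kernel H t r"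
  unfolding K_kernel_eq by (intro mult_nonneg_nonneg c_const_nonneg Bochner_Integration.integral_nonneg) auto

lemma K_kernel_measurable [measurable]: "K_kernel H t \<in> borel_measurable borel"
proof -
  have "(\<lambda>r. LINT u|lborel. kernel_density H t r u) \<in> borel_measurable lborel"
    by (rule lborel.borel_measurable_lebesgue_integral) simp
  then show ?thesis unfolding K_kernel_eq[abs_def] by simp
qed

lemma K_kernel_support: "r \<notin> {0<..t} \<Longrightarrow> K_kernel H t r = 0"
  by (simp add: K_kernel_def)

lemma ennreal_K_kernel:
  assumes "1/2 < H" "H < 1" "0 \<le> t"
  shows "ennreal (K_kernel H t r) = ennreal (c_const H) * (\<integral>\<^sup>+u. ennreal (kernel_density H t r u) \<partial>lborel)"
proof -
  have "(\<integral>\<^sup>+u. ennreal (kernel_density H t r u) \<partial>lborel) < \<infinity>"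
    using kernel_density_nn_integral_bound[of H t r] assms by (auto simp: le_less_trans[OF _ ennreal_less_top])
  then have "integrable lborel (kernel_density H t r)" by (intro integrableI_bounded) auto
  then show ?thesis
    unfolding K_kernel_eq using c_const_nonneg[OF assms(1,2)]
    by (simp add: ennreal_mult nn_integral_eq_integral)
qed

text \<open>
  The points \<open>u = 0\<close>, \<open>v = 0\<close> and \<open>u = v\<close> are excluded because the right-hand side is not the value
  of the integral there; they form a null set for the double integral over \<open>u\<close> and \<open>v\<close>.
\<close>

lemma kernel_density_product_integral:
  assumes H: "1/2 < H" "H < 1" and uv: "u \<noteq> v" "u \<noteq> 0" "v \<noteq> 0"
  shows "(\<integral>\<^sup>+r. ennreal (kernel_density H t r u) * ennreal (kernel_density H s r v) \<partial>lborel)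
    = ennreal (Beta (2 - 2*H) (H - 1/2)) * (ennreal (\<bar>u - v\<bar> powr (2*H - 2)) * indicator {0..s} v * indicator {0..t} u)"
proof -
  have *: "(\<integral>\<^sup>+r. ennreal (kernel_density H t r u) * ennreal (kernel_density H s r v) \<partial>lborel)
    = ennreal (Beta (2 - 2*H) (H - 1/2)) * (ennreal (\<bar>u - v\<bar> powr (2*H - 2)) * indicator {0..s} v * indicator {0..t} u)"
    if uv: "u < v" and u0: "u \<noteq> 0" for u v t s
  proof (cases "0 < u \<and> u \<le> t \<and> v \<le> s")
    case True
    then have u: "0 < u" "0 < v" using uv by auto
    have "(\<integral>\<^sup>+r. ennreal (kernel_density H t r u) * ennreal (kernel_density H s r v) \<partial>lborel)
      = (\<integral>\<^sup>+r. ennreal ((u * v) powr (H - 1/2)) *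
         (ennreal (r powr (1 - 2*H) * (u - r) powr (H - 3/2) * (v - r) powr (H - 3/2)) * indicator {0..u} r) \<partial>lborel)"
    proof (rule nn_integral_cong)
      fix r
      show "ennreal (kernel_density H t r u) * ennreal (kernel_density H s r v)
        = ennreal ((u * v) powr (H - 1/2)) *
         (ennreal (r powr (1 - 2*H) * (u - r) powr (H - 3/2) * (v - r) powr (H - 3/2)) * indicator {0..u} r)"
      proof (cases "0 < r \<and> r \<le> u")
        case r: True
        have "r powr (1 - 2*H) = r powr (1/2 - H) * r powr (1/2 - H)"
          by (simp add: powr_add[symmetric])
        moreover have "(u * v) powr (H - 1/2) = u powr (H - 1/2) * v powr (H - 1/2)"
          using u by (simp add: powr_mult)
        ultimately show ?thesis using r True uv
          by (simp add: kernel_density_def ennreal_mult[symmetric] mult_ac)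
      next
        case False
        then show ?thesis using H by (auto simp: kernel_density_def indicator_def)
      qed
    qed
    also have "\<dots> = ennreal ((u * v) powr (H - 1/2)) *
        ennreal (Beta (2 - 2*H) (H - 1/2) * (u * v) powr (1/2 - H) * (v - u) powr (2*H - 2))"
      using nn_integral_two_point_kernel[OF H u(1) uv] by (subst nn_integral_cmult) auto
    also have "\<dots> = ennreal (Beta (2 - 2*H) (H - 1/2) * (v - u) powr (2*H - 2))"
    proof -
      have "(u * v) powr (H - 1/2) * (u * v) powr (1/2 - H) = 1"
        using u by (simp add: powr_add[symmetric])
      then show ?thesis using H by (simp add: ennreal_mult[symmetric] Beta_def mult_ac)
    qed
    also have "\<dots> = ennreal (Beta (2 - 2*H) (H - 1/2)) * (ennreal (\<bar>u - v\<bar> powr (2*H - 2)) * indicator {0..s} v * indicator {0..t} u)"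
    proof -
      have "0 \<le> Beta (2 - 2*H) (H - 1/2)" using H by (simp add: Beta_def)
      then show ?thesis using True uv by (simp add: ennreal_mult)
    qed
    finally show ?thesis .
  next
    case False
    then have "kernel_density H t r u * kernel_density H s r v = 0" for r
      using uv by (auto simp: kernel_density_def indicator_def)
    then have "ennreal (kernel_density H t r u) * ennreal (kernel_density H s r v) = 0" for r
      by (simp add: ennreal_mult[symmetric])
    moreover have "indicator {0..s} v * indicator {0..t} u = (0::ennreal)"
      using False uv u0 by (auto simp: indicator_def)
    ultimately show ?thesis
      by (simp only: mult.assoc mult_zero_right mult_zero_left nn_integral_const)
  qed
  show ?thesis
  proof (cases "u < v")
    case True
    show ?thesis using *[OF True uv(2)] .
  next
    case False
    then have "v < u" using uv by simp
    from *[OF this uv(3), of s t] show ?thesis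
      unfolding abs_minus_commute[of u v] by (simp only: mult_ac)
  qed
qed

text \<open>
  The factorisation of the covariance. After exchanging the integrals, integration over \<open>r\<close> leaves
  \<open>\<bar>u - v\<bar> powr (2 * H - 2)\<close>, and the integral over the rectangle \<open>[0,t] \<times> [0,s]\<close> is the covariance.
\<close>

lemma kernel_covariance_nn:
  assumes H: "1/2 < H" "H < 1" and ts: "0 \<le> t" "0 \<le> s"
  shows "(\<integral>\<^sup>+r. ennreal (K_kernel H t r) * ennreal (K_kernel H s r) \<partial>lborel) = ennreal (R_cov H t s)"
proof -
  define c where "c = c_const H"
  define b where "b = Beta (2 - 2*H) (H - 1/2)"
  have c: "c \<ge> 0" using H by (simp add: c_def c_const_nonneg)
  let ?k = "\<lambda>t r u. ennreal (kernel_density H t r u)"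
  have prod: "ennreal (K_kernel H t r) * ennreal (K_kernel H s r)
      = ennreal (c\<^sup>2) * (\<integral>\<^sup>+u. \<integral>\<^sup>+v. ?k t r u * ?k s r v \<partial>lborel \<partial>lborel)" for r
  proof -
    have "(\<integral>\<^sup>+u. \<integral>\<^sup>+v. ?k t r u * ?k s r v \<partial>lborel \<partial>lborel) = (\<integral>\<^sup>+u. ?k t r u * (\<integral>\<^sup>+v. ?k s r v \<partial>lborel) \<partial>lborel)"
      by (intro nn_integral_cong nn_integral_cmult) simp
    also have "\<dots> = (\<integral>\<^sup>+u. ?k t r u \<partial>lborel) * (\<integral>\<^sup>+v. ?k s r v \<partial>lborel)"
      by (rule nn_integral_multc) simp
    finally show ?thesis
      unfolding ennreal_K_kernel[OF H ts(1)] ennreal_K_kernel[OF H ts(2)] c_def[symmetric]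
      using c by (simp add: power2_eq_square ennreal_mult mult_ac)
  qed
  have "(\<integral>\<^sup>+r. ennreal (K_kernel H t r) * ennreal (K_kernel H s r) \<partial>lborel)
      = ennreal (c\<^sup>2) * (\<integral>\<^sup>+r. \<integral>\<^sup>+u. \<integral>\<^sup>+v. ?k t r u * ?k s r v \<partial>lborel \<partial>lborel \<partial>lborel)"
    unfolding prod by (rule nn_integral_cmult) measurable
  also have "(\<integral>\<^sup>+r. \<integral>\<^sup>+u. \<integral>\<^sup>+v. ?k t r u * ?k s r v \<partial>lborel \<partial>lborel \<partial>lborel)
      = (\<integral>\<^sup>+u. \<integral>\<^sup>+r. \<integral>\<^sup>+v. ?k t r u * ?k s r v \<partial>lborel \<partial>lborel \<partial>lborel)"
    by (rule lborel_pair.Fubini') measurable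
  also have "\<dots> = (\<integral>\<^sup>+u. \<integral>\<^sup>+v. \<integral>\<^sup>+r. ?k t r u * ?k s r v \<partial>lborel \<partial>lborel \<partial>lborel)"
    by (intro nn_integral_cong lborel_pair.Fubini') measurable
  also have "\<dots> = (\<integral>\<^sup>+u. \<integral>\<^sup>+v. ennreal b * (ennreal (\<bar>u - v\<bar> powr (2*H - 2)) * indicator {0..s} v * indicator {0..t} u) \<partial>lborel \<partial>lborel)"
  proof (rule nn_integral_cong_AE)
    show "AE u in lborel. (\<integral>\<^sup>+v. \<integral>\<^sup>+r. ?k t r u * ?k s r v \<partial>lborel \<partial>lborel)
      = (\<integral>\<^sup>+v. ennreal b * (ennreal (\<bar>u - v\<bar> powr (2*H - 2)) * indicator {0..s} v * indicator {0..t} u) \<partial>lborel)"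
      using AE_lborel_singleton[of 0]
    proof eventually_elim
      fix u :: real assume u: "u \<noteq> 0"
      show "(\<integral>\<^sup>+v. \<integral>\<^sup>+r. ?k t r u * ?k s r v \<partial>lborel \<partial>lborel)
        = (\<integral>\<^sup>+v. ennreal b * (ennreal (\<bar>u - v\<bar> powr (2*H - 2)) * indicator {0..s} v * indicator {0..t} u) \<partial>lborel)"
      proof (rule nn_integral_cong_AE)
        show "AE v in lborel. (\<integral>\<^sup>+r. ?k t r u * ?k s r v \<partial>lborel)
          = ennreal b * (ennreal (\<bar>u - v\<bar> powr (2*H - 2)) * indicator {0..s} v * indicator {0..t} u)"
          using AE_lborel_singleton[of 0] AE_lborel_singleton[of u]
          by eventually_elim (use u H in \<open>simp add: kernel_density_product_integral b_def\<close>)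
      qed
    qed
  qed
  also have "\<dots> = (\<integral>\<^sup>+u. ennreal b * ((\<integral>\<^sup>+v. ennreal (\<bar>u - v\<bar> powr (2*H - 2)) * indicator {0..s} v \<partial>lborel) * indicator {0..t} u) \<partial>lborel)"
    by (intro nn_integral_cong) (simp add: nn_integral_cmult nn_integral_multc)
  also have "\<dots> = ennreal b * ennreal (R_cov H t s / (H * (2*H - 1)))"
    unfolding nn_integral_abs_diff_powr[OF H ts, symmetric] by (rule nn_integral_cmult) measurable
  also have "ennreal (c\<^sup>2) * \<dots> = ennreal (c\<^sup>2 * b * (R_cov H t s / (H * (2*H - 1))))"
  proof -
    have "b \<ge> 0" using H by (simp add: b_def Beta_def)
    then show ?thesis
      by (simp only: mult.assoc ennreal_mult' zero_le_power2)
  qed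
  also have "c\<^sup>2 * b * (R_cov H t s / (H * (2*H - 1))) = R_cov H t s"
    using c_const_Beta[OF H] H by (simp add: c_def b_def)
  finally show ?thesis .
qed

lemma integral_lborel_pos:
  assumes "\<And>r. r < 0 \<Longrightarrow> f r = (0::real)"
  shows "(LINT r|lborel_pos. f r) = (LINT r|lborel. f r)"
proof -
  have "(\<lambda>r. indicator {0..} r *\<^sub>R f r) = f" using assms by (auto simp: indicator_def fun_eq_iff)
  then show ?thesis by (simp add: integral_restrict_space)
qed

lemma measurable_lborel_pos_iff:
  "f \<in> borel_measurable lborel_pos \<longleftrightarrow> (\<lambda>r. indicator {0..} r * f r :: real) \<in> borel_measurable lborel"
  by (subst borel_measurable_restrict_space_iff) auto

lemma K_kernel_measurable_pos [measurable]: "K_kernel H t \<in> borel_measurable lborel_pos"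
  by (rule measurable_restrict_space1) simp

lemma R_cov_nonneg:
  assumes "1/2 < H" "H < 1" "0 \<le> t" "0 \<le> s" shows "0 \<le> R_cov H t s"
proof -
  have "\<bar>t - s\<bar> powr (2*H) \<le> (max t s) powr (2*H)" using assms by (intro powr_mono2) auto
  also have "\<dots> \<le> t powr (2*H) + s powr (2*H)" by (auto simp: max_def)
  finally show ?thesis by (simp add: R_cov_def)
qed

lemma K_kernel_L2:
  assumes H: "1/2 < H" "H < 1" and t: "0 \<le> t"
  shows "K_kernel H t \<in> L2 lborel_pos"
proof -
  have "integrable lborel (\<lambda>r. (K_kernel H t r)\<^sup>2)"
  proof (rule integrableI_bounded)
    have "ennreal (norm ((K_kernel H t r)\<^sup>2)) = ennreal (K_kernel H t r) * ennreal (K_kernel H t r)" for r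
      using K_kernel_nonneg[OF H] by (simp add: power2_eq_square ennreal_mult)
    then show "(\<integral>\<^sup>+r. ennreal (norm ((K_kernel H t r)\<^sup>2)) \<partial>lborel) < \<infinity>"
      using kernel_covariance_nn[OF H t t] by simp
  qed measurable
  then have "integrable lborel (\<lambda>r. indicator {0..} r *\<^sub>R (K_kernel H t r)\<^sup>2)"
    by (intro integrable_mult_indicator) auto
  then show ?thesis by (simp add: L2_def integrable_restrict_space)
qed

lemma R_cov_increment: "R_cov H s s - 2 * R_cov H s t + R_cov H t t = \<bar>s - t\<bar> powr (2*H)"
  by (simp add: R_cov_def field_simps)

lemma kernel_covariance:
  assumes H: "1/2 < H" "H < 1" and ts: "0 \<le> t" "0 \<le> s"
  shows "(LINT r|lborel_pos. K_kernel H t r * K_kernel H s r) = R_cov H t s"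
proof -
  have "(LINT r|lborel_pos. K_kernel H t r * K_kernel H s r) = (LINT r|lborel. K_kernel H t r * K_kernel H s r)"
    by (rule integral_lborel_pos) (simp add: K_kernel_support)
  also have "\<dots> = enn2real (\<integral>\<^sup>+r. ennreal (K_kernel H t r * K_kernel H s r) \<partial>lborel)"
    using K_kernel_nonneg[OF H] by (intro integral_eq_nn_integral) auto
  also have "\<dots> = R_cov H t s"
    using kernel_covariance_nn[OF H ts] K_kernel_nonneg[OF H] R_cov_nonneg[OF H ts]
    by (simp add: ennreal_mult)
  finally show ?thesis .
qed

lemma K_op_eq_inner:
  assumes "0 \<le> t"
  shows "K_op H f t = (LINT r|lborel_pos. K_kernel H t r * f r)"
proof -
  have "(\<lambda>r. indicator {0..t} r *\<^sub>R (K_kernel H t r * f r)) = (\<lambda>r. indicator {0..} r *\<^sub>R (K_kernel H t r * f r))"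
  proof
    fix r show "indicator {0..t} r *\<^sub>R (K_kernel H t r * f r) = indicator {0..} r *\<^sub>R (K_kernel H t r * f r)"
      by (cases "r \<in> {0<..t}") (auto simp: K_kernel_support)
  qed
  then show ?thesis
    using assms by (simp add: K_op_def set_lebesgue_integral_def integral_restrict_space)
qed

text \<open>
  The covariance functions lie in the Cameron--Martin space, and the kernel is the corresponding
  integrand. This connects the isometry, which is specified on covariance functions, with paths.
\<close>

lemma K_op_kernel:
  assumes H: "1/2 < H" "H < 1" and t: "0 \<le> t"
  shows "K_op H (K_kernel H t) = (\<lambda>s\<in>{0..}. R_cov H t s)"
proof
  fix s
  show "K_op H (K_kernel H t) s = (\<lambda>s\<in>{0..}. R_cov H t s) s"
  proof (cases "0 \<le> s")
    case True
    then show ?thesis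
      using kernel_covariance[OF H True t] by (simp add: K_op_eq_inner R_cov_def abs_minus_commute add.commute)
  qed (simp add: K_op_def)
qed

section \<open>Injectivity of the kernel operator\<close>

lemma kernel_Fubini:
  fixes k :: "real \<Rightarrow> real \<Rightarrow> real" and F :: "real \<Rightarrow> real"
  assumes [measurable]: "(\<lambda>(r, u). k r u) \<in> borel_measurable (lborel \<Otimes>\<^sub>M lborel)" "F \<in> borel_measurable borel"
    and k: "\<And>r u. 0 \<le> k r u"
    and fin: "(\<integral>\<^sup>+r. (\<integral>\<^sup>+u. ennreal (k r u) \<partial>lborel) * ennreal \<bar>F r\<bar> \<partial>lborel) < \<infinity>"
  shows "integrable lborel (\<lambda>u. LINT r|lborel. k r u * F r)"
    and "(LINT u|lborel. LINT r|lborel. k r u * F r) = (LINT r|lborel. (LINT u|lborel. k r u) * F r)"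
proof -
  have int: "integrable (lborel \<Otimes>\<^sub>M lborel) (\<lambda>(r, u). k r u * F r)"
  proof (rule integrableI_bounded)
    have "(\<integral>\<^sup>+ z. ennreal (norm (case z of (r, u) \<Rightarrow> k r u * F r)) \<partial>(lborel \<Otimes>\<^sub>M lborel))
      = (\<integral>\<^sup>+r. \<integral>\<^sup>+u. ennreal (norm (case (r, u) of (r, u) \<Rightarrow> k r u * F r)) \<partial>lborel \<partial>lborel)"
      by (rule lborel.nn_integral_fst[symmetric]) measurable
    also have "\<dots> = (\<integral>\<^sup>+r. (\<integral>\<^sup>+u. ennreal (k r u) * ennreal \<bar>F r\<bar> \<partial>lborel) \<partial>lborel)"
      using k by (simp add: abs_mult ennreal_mult)
    also have "\<dots> = (\<integral>\<^sup>+r. (\<integral>\<^sup>+u. ennreal (k r u) \<partial>lborel) * ennreal \<bar>F r\<bar> \<partial>lborel)"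
      by (intro nn_integral_cong nn_integral_multc) measurable
    finally show "(\<integral>\<^sup>+ z. ennreal (norm (case z of (r, u) \<Rightarrow> k r u * F r)) \<partial>(lborel \<Otimes>\<^sub>M lborel)) < \<infinity>"
      using fin by simp
  qed measurable
  show "integrable lborel (\<lambda>u. LINT r|lborel. k r u * F r)"
    using lborel_pair.integrable_snd[OF int] by simp
  have "(LINT u|lborel. LINT r|lborel. k r u * F r) = (LINT r|lborel. LINT u|lborel. k r u * F r)"
    by (rule lborel_pair.Fubini_integral[OF int])
  then show "(LINT u|lborel. LINT r|lborel. k r u * F r) = (LINT r|lborel. (LINT u|lborel. k r u) * F r)"
    by simp
qed

text \<open>
  The positive and the negative part are densities of measures that agree on all half-lines.
\<close>

lemma AE_zero_of_tail_integrals: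
  fixes \<phi> :: "real \<Rightarrow> real"
  assumes int: "integrable lborel \<phi>"
    and zero: "\<And>x. (LINT u|lborel. indicator {x<..} u * \<phi> u) = 0"
  shows "AE u in lborel. \<phi> u = 0"
proof -
  have [measurable]: "\<phi> \<in> borel_measurable borel" using int by auto
  define p n where "p u = max (\<phi> u) 0" and "n u = max (- \<phi> u) 0" for u
  have [measurable]: "p \<in> borel_measurable borel" "n \<in> borel_measurable borel"
    unfolding p_def n_def by measurable
  have ip: "integrable lborel p" "integrable lborel n" unfolding p_def n_def using int by auto
  have ii: "integrable lborel (\<lambda>u. indicator A u * g u)" if "integrable lborel g" "A \<in> sets borel" for A and g :: "real \<Rightarrow> real"
    using integrable_mult_indicator[of A lborel g] that by simp
  have em: "emeasure (density lborel (\<lambda>u. ennreal (g u))) {x<..} = ennreal (LINT u|lborel. indicator {x<..} u * g u)"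
    if "integrable lborel g" "\<And>u. 0 \<le> g u" for g :: "real \<Rightarrow> real" and x
  proof -
    have [measurable]: "g \<in> borel_measurable borel" using that(1) by auto
    have "emeasure (density lborel (\<lambda>u. ennreal (g u))) {x<..} = (\<integral>\<^sup>+u. ennreal (g u) * indicator {x<..} u \<partial>lborel)"
      by (rule emeasure_density) simp_all
    also have "\<dots> = (\<integral>\<^sup>+u. ennreal (indicator {x<..} u * g u) \<partial>lborel)"
      by (intro nn_integral_cong) (simp split: split_indicator)
    also have "\<dots> = ennreal (LINT u|lborel. indicator {x<..} u * g u)"
      using that by (intro nn_integral_eq_integral ii) (auto intro!: AE_I2)
    finally show ?thesis .
  qed
  have "density lborel (\<lambda>u. ennreal (p u)) = density lborel (\<lambda>u. ennreal (n u))"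
  proof (rule measure_eqI_lessThan)
    fix x
    show "emeasure (density lborel (\<lambda>u. ennreal (p u))) {x<..} < \<infinity>"
      using em[OF ip(1)] by (simp add: p_def)
    have "(LINT u|lborel. indicator {x<..} u * p u) - (LINT u|lborel. indicator {x<..} u * n u)
      = (LINT u|lborel. indicator {x<..} u * p u - indicator {x<..} u * n u)"
      by (intro Bochner_Integration.integral_diff[symmetric] ii ip) auto
    also have "(\<lambda>u. indicator {x<..} u * p u - indicator {x<..} u * n u) = (\<lambda>u. indicator {x<..} u * \<phi> u)"
      by (auto simp: p_def n_def indicator_def fun_eq_iff)
    finally show "emeasure (density lborel (\<lambda>u. ennreal (p u))) {x<..} = emeasure (density lborel (\<lambda>u. ennreal (n u))) {x<..}"
      using em[OF ip(1)] em[OF ip(2)] zero[of x] by (simp add: p_def n_def)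
  qed auto
  then have "AE u in lborel. ennreal (p u) = ennreal (n u)"
    by (subst (asm) sigma_finite_measure.density_unique_iff[OF sigma_finite_lborel]) auto
  then show ?thesis
    by eventually_elim (auto simp: p_def n_def max_def split: if_splits)
qed

lemma AE_zero_of_initial_integrals:
  fixes \<phi> :: "real \<Rightarrow> real"
  assumes int: "integrable lborel \<phi>" and q: "0 \<le> q"
    and supp: "\<And>u. u \<notin> {0<..q} \<Longrightarrow> \<phi> u = 0"
    and zero: "\<And>x. x \<in> {0..q} \<Longrightarrow> (LINT u|lborel. indicator {..x} u * \<phi> u) = 0"
  shows "AE u in lborel. \<phi> u = 0"
proof (rule AE_zero_of_tail_integrals[OF int])
  fix x
  have ii: "integrable lborel (\<lambda>u. indicator A u * \<phi> u)" if "A \<in> sets borel" for A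
    using integrable_mult_indicator[of A lborel \<phi>] that int by simp
  have z: "(LINT u|lborel. indicator {..y} u * \<phi> u) = 0" for y
  proof -
    have "(\<lambda>u. indicator {..y} u * \<phi> u) = (\<lambda>u. if y < 0 then 0 else indicator {..min y q} u * \<phi> u)"
      using supp by (fastforce simp: indicator_def)
    then show ?thesis using zero[of "min y q"] q by (cases "y < 0") simp_all
  qed
  have "(LINT u|lborel. indicator {..q} u * \<phi> u) - (LINT u|lborel. indicator {..x} u * \<phi> u)
      = (LINT u|lborel. indicator {..q} u * \<phi> u - indicator {..x} u * \<phi> u)"
    by (intro Bochner_Integration.integral_diff[symmetric] ii) auto
  also have "(\<lambda>u. indicator {..q} u * \<phi> u - indicator {..x} u * \<phi> u) = (\<lambda>u. indicator {x<..} u * \<phi> u)"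
    using supp by (fastforce simp: indicator_def)
  finally show "(LINT u|lborel. indicator {x<..} u * \<phi> u) = 0" by (simp add: z)
qed

text \<open>
  Abel's integral equation. Exchanging the order of integration shows that \<open>K_op H f t\<close> is
  a multiple of the integral of \<open>\<phi>\<close> over \<open>[0,t]\<close>, where \<open>\<phi> u\<close> is a power of \<open>u\<close> times the Abel
  transform of \<open>r powr (1/2 - H) * f r\<close> at \<open>u\<close>; so \<open>\<phi>\<close> vanishes. The transform is inverted by
  integrating it against \<open>(x - u) powr (1/2 - H)\<close>: the inner integral becomes a Beta integral whose
  parameters add up to one, hence it is constant in \<open>r\<close> and \<open>x\<close>.
\<close>

lemma K_op_injective:
  assumes H: "1/2 < H" "H < 1" and q: "0 \<le> q" and f: "f \<in> L2 lborel_pos"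
    and zero: "\<And>t. t \<in> {0..q} \<Longrightarrow> K_op H f t = 0"
  shows "AE r in lborel_pos. r \<le> q \<longrightarrow> f r = 0"
proof -
  define F where "F r = indicator {0<..q} r * f r" for r
  \<comment> \<open>The singular weight of the kernel. It is square integrable near 0 because \<open>H < 1\<close>, which gives all Fubini conditions.\<close>
  define w where "w r = indicator {0<..q} r * r powr (1/2 - H)" for r
  have F0: "F r = 0" if "r \<notin> {0<..q}" for r using that by (simp add: F_def)
  have fm: "(\<lambda>r. indicator {0..} r * f r) \<in> borel_measurable lborel"
    using f by (simp add: L2_def measurable_lborel_pos_iff)
  have F_eq: "F r = indicator {0<..q} r * (indicator {0..} r * f r)" for r
    by (auto simp: F_def indicator_def)
  have [measurable]: "F \<in> borel_measurable borel"
    using fm unfolding F_eq[abs_def] by simp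
  have [measurable]: "w \<in> borel_measurable borel" unfolding w_def[abs_def] by measurable
  have w0: "0 \<le> w r" for r by (simp add: w_def)
  have "integrable lborel (\<lambda>r. indicator {0..} r * (f r)\<^sup>2)"
    using f by (simp add: L2_def integrable_restrict_space)
  then have "integrable lborel (\<lambda>r. (F r)\<^sup>2)"
  proof (rule Bochner_Integration.integrable_bound)
    show "AE r in lborel. norm ((F r)\<^sup>2) \<le> norm (indicator {0..} r * (f r)\<^sup>2)"
      by (auto simp: F_def indicator_def)
  qed measurable
  then have F2: "(\<integral>\<^sup>+r. ennreal ((F r)\<^sup>2) \<partial>lborel) < \<infinity>"
    unfolding integrable_iff_bounded by simp
  have wF: "(\<integral>\<^sup>+r. ennreal (w r) * ennreal \<bar>F r\<bar> \<partial>lborel) < \<infinity>"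
  proof -
    have "ennreal (w r) * ennreal \<bar>F r\<bar>
        \<le> ennreal ((r - 0) powr (1 - 2*H)) * indicator {0..q} r + ennreal ((F r)\<^sup>2)" for r
    proof (cases "r \<in> {0<..q}")
      case True
      have "r powr (1 - 2*H) = (w r)\<^sup>2"
        using True by (simp add: w_def power2_eq_square powr_add[symmetric])
      moreover have "w r * \<bar>F r\<bar> \<le> (w r)\<^sup>2 + (F r)\<^sup>2"
      proof -
        have "0 \<le> (w r - \<bar>F r\<bar>)\<^sup>2" "0 \<le> w r * \<bar>F r\<bar>" using w0 by auto
        then show ?thesis by (simp add: power2_diff)
      qed
      ultimately show ?thesis using True w0[of r] by (simp add: ennreal_mult[symmetric] ennreal_plus[symmetric] del: ennreal_plus)
    qed (simp add: F0)
    then have "(\<integral>\<^sup>+r. ennreal (w r) * ennreal \<bar>F r\<bar> \<partial>lborel)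
      \<le> (\<integral>\<^sup>+r. ennreal ((r - 0) powr (1 - 2*H)) * indicator {0..q} r + ennreal ((F r)\<^sup>2) \<partial>lborel)"
      by (rule nn_integral_mono)
    also have "\<dots> = (\<integral>\<^sup>+r. ennreal ((r - 0) powr (1 - 2*H)) * indicator {0..q} r \<partial>lborel) + (\<integral>\<^sup>+r. ennreal ((F r)\<^sup>2) \<partial>lborel)"
      by (rule nn_integral_add) measurable
    also have "\<dots> < \<infinity>"
      using H q F2 by (subst nn_integral_powr_shifted) auto
    finally show ?thesis .
  qed
  have fin: "(\<integral>\<^sup>+r. (\<integral>\<^sup>+u. ennreal (k r u) \<partial>lborel) * ennreal \<bar>F r\<bar> \<partial>lborel) < \<infinity>"
    if "\<And>r. r \<in> {0<..q} \<Longrightarrow> (\<integral>\<^sup>+u. ennreal (k r u) \<partial>lborel) \<le> ennreal (C * w r)" "0 \<le> C" for k C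
  proof -
    have "(\<integral>\<^sup>+u. ennreal (k r u) \<partial>lborel) * ennreal \<bar>F r\<bar> \<le> ennreal C * (ennreal (w r) * ennreal \<bar>F r\<bar>)" for r
    proof (cases "r \<in> {0<..q}")
      case True
      then have "(\<integral>\<^sup>+u. ennreal (k r u) \<partial>lborel) * ennreal \<bar>F r\<bar> \<le> ennreal (C * w r) * ennreal \<bar>F r\<bar>"
        by (intro mult_right_mono that) auto
      then show ?thesis using that(2) w0 by (simp add: ennreal_mult mult.assoc)
    qed (simp add: F0)
    then have "(\<integral>\<^sup>+r. (\<integral>\<^sup>+u. ennreal (k r u) \<partial>lborel) * ennreal \<bar>F r\<bar> \<partial>lborel)
      \<le> (\<integral>\<^sup>+r. ennreal C * (ennreal (w r) * ennreal \<bar>F r\<bar>) \<partial>lborel)" by (rule nn_integral_mono)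
    also have "\<dots> = ennreal C * (\<integral>\<^sup>+r. ennreal (w r) * ennreal \<bar>F r\<bar> \<partial>lborel)"
      by (rule nn_integral_cmult) measurable
    also have "\<dots> < \<infinity>" using wF by (simp add: ennreal_mult_less_top)
    finally show ?thesis .
  qed
  define \<phi> where "\<phi> u = (LINT r|lborel. kernel_density H q r u * F r)" for u
  have fin1: "(\<integral>\<^sup>+r. (\<integral>\<^sup>+u. ennreal (kernel_density H t r u) \<partial>lborel) * ennreal \<bar>F r\<bar> \<partial>lborel) < \<infinity>"
    if "t \<in> {0..q}" for t
  proof (rule fin)
    fix r assume r: "r \<in> {0<..q}"
    have "t powr (2*H - 1) / (H - 1/2) * (indicator {0<..t} r * r powr (1/2 - H))
      \<le> t powr (2*H - 1) / (H - 1/2) * w r"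
      using that H by (intro mult_left_mono) (auto simp: w_def indicator_def)
    with kernel_density_nn_integral_bound[of H t r] that H
    show "(\<integral>\<^sup>+u. ennreal (kernel_density H t r u) \<partial>lborel) \<le> ennreal (t powr (2*H - 1) / (H - 1/2) * w r)"
      by (auto intro: order_trans ennreal_leI)
  qed (use H in simp)
  have \<phi>_int: "integrable lborel \<phi>"
    unfolding \<phi>_def[abs_def] by (rule kernel_Fubini(1)) (use fin1[of q] q in auto)
  have "AE u in lborel. \<phi> u = 0"
  proof (rule AE_zero_of_initial_integrals[OF \<phi>_int q])
    fix u assume "u \<notin> {0<..q}"
    then have "kernel_density H q r u = 0" for r by (auto simp: kernel_density_def indicator_def)
    then show "\<phi> u = 0" by (simp add: \<phi>_def)
  next
    fix t assume t: "t \<in> {0..q}"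
    have "indicator {..t} u * \<phi> u = (LINT r|lborel. kernel_density H t r u * F r)" for u
      unfolding \<phi>_def integral_mult_right_zero[symmetric]
      using t by (intro Bochner_Integration.integral_cong) (auto simp: kernel_density_def indicator_def)
    then have "(LINT u|lborel. indicator {..t} u * \<phi> u)
        = (LINT u|lborel. LINT r|lborel. kernel_density H t r u * F r)" by simp
    also have "\<dots> = (LINT r|lborel. (LINT u|lborel. kernel_density H t r u) * F r)"
      by (rule kernel_Fubini(2)) (use fin1[OF t] in auto)
    finally have "c_const H * (LINT u|lborel. indicator {..t} u * \<phi> u) = (LINT r|lborel. K_kernel H t r * F r)"
      unfolding K_kernel_eq integral_mult_right_zero[symmetric] by (simp add: mult.assoc)
    also have "\<dots> = (LINT r|lborel_pos. K_kernel H t r * F r)"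
      by (rule integral_lborel_pos[symmetric]) (simp add: F_def)
    also have "\<dots> = (LINT r|lborel_pos. K_kernel H t r * f r)"
    proof (rule Bochner_Integration.integral_cong[OF refl])
      fix r show "K_kernel H t r * F r = K_kernel H t r * f r"
        using t by (cases "r \<in> {0<..t}") (auto simp: F_def K_kernel_support)
    qed
    also have "\<dots> = 0" using zero[OF t] t by (simp add: K_op_eq_inner)
    finally show "(LINT u|lborel. indicator {..t} u * \<phi> u) = 0" using c_const_pos[OF H] by simp
  qed
  define \<psi> where "\<psi> r = r powr (1/2 - H) * F r" for r
  have [measurable]: "\<psi> \<in> borel_measurable borel" unfolding \<psi>_def[abs_def] by measurable
  have \<psi>_int: "integrable lborel \<psi>"
  proof (rule integrableI_bounded)
    have "ennreal (norm (\<psi> r)) = ennreal (w r) * ennreal \<bar>F r\<bar>" for r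
      using F0[of r] by (cases "r \<in> {0<..q}") (auto simp: \<psi>_def w_def abs_mult ennreal_mult)
    then show "(\<integral>\<^sup>+r. ennreal (norm (\<psi> r)) \<partial>lborel) < \<infinity>" using wF by simp
  qed simp
  have "AE r in lborel. \<psi> r = 0"
  proof (rule AE_zero_of_initial_integrals[OF \<psi>_int q])
    show "\<psi> r = 0" if "r \<notin> {0<..q}" for r using F0[OF that] by (simp add: \<psi>_def)
  next
    fix x assume x: "x \<in> {0..q}"
    define b where "b = Beta (H - 1/2) (3/2 - H)"
    have b: "b > 0" using H by (simp add: b_def Beta_def)
    \<comment> \<open>The Abel kernel times its inverse kernel.\<close>
    define k where "k r u = indicator {0<..} r * indicator {r..x} u
      * (r powr (1/2 - H) * (u - r) powr (H - 3/2) * (x - u) powr (1/2 - H))" for r u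
    have k0: "0 \<le> k r u" for r u by (simp add: k_def)
    have k_if: "k = (\<lambda>r u. if 0 < r \<and> r \<le> u \<and> u \<le> x
      then r powr (1/2 - H) * (u - r) powr (H - 3/2) * (x - u) powr (1/2 - H) else 0)"
      by (auto simp: k_def indicator_def fun_eq_iff)
    have [measurable]: "(\<lambda>(r, u). k r u) \<in> borel_measurable (lborel \<Otimes>\<^sub>M lborel)"
      "k r \<in> borel_measurable borel" for r
      unfolding k_if by measurable
    have kint: "(\<integral>\<^sup>+u. ennreal (k r u) \<partial>lborel) = ennreal (b * (indicator {0<..<x} r * r powr (1/2 - H)))" for r
    proof (cases "0 < r \<and> r < x")
      case True
      have "(\<integral>\<^sup>+u. ennreal (k r u) \<partial>lborel) = (\<integral>\<^sup>+u. ennreal (r powr (1/2 - H)) *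
          (ennreal ((u - r) powr ((H - 1/2) - 1) * (x - u) powr ((3/2 - H) - 1)) * indicator {r..x} u) \<partial>lborel)"
        using True by (intro nn_integral_cong) (auto simp: k_def ennreal_mult[symmetric] mult.assoc split: split_indicator)
      also have "\<dots> = ennreal (r powr (1/2 - H)) * ennreal (b * (x - r) powr ((H - 1/2) + (3/2 - H) - 1))"
        unfolding b_def using H True nn_integral_Beta_interval[of "H - 1/2" "3/2 - H" r x]
        by (subst nn_integral_cmult) simp_all
      also have "\<dots> = ennreal (b * (indicator {0<..<x} r * r powr (1/2 - H)))"
        using True b by (simp add: ennreal_mult[symmetric] mult_ac)
      finally show ?thesis .
    next
      case False
      have "AE u in lborel. ennreal (k r u) = 0"
        using AE_lborel_singleton[of x] by eventually_elim (use False in \<open>auto simp: k_if\<close>)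
      then have "(\<integral>\<^sup>+u. ennreal (k r u) \<partial>lborel) = 0" by (subst nn_integral_0_iff_AE) auto
      then show ?thesis using False by auto
    qed
    have kLINT: "(LINT u|lborel. k r u) = b * (indicator {0<..<x} r * r powr (1/2 - H))" for r
      using b k0 by (subst integral_eq_nn_integral) (auto simp: kint)
    have "(LINT u|lborel. LINT r|lborel. k r u * F r) = (LINT r|lborel. (LINT u|lborel. k r u) * F r)"
    proof (rule kernel_Fubini(2))
      show "(\<integral>\<^sup>+r. (\<integral>\<^sup>+u. ennreal (k r u) \<partial>lborel) * ennreal \<bar>F r\<bar> \<partial>lborel) < \<infinity>"
        by (rule fin[of _ b]) (use x b in \<open>auto simp: kint w_def indicator_def\<close>)
    qed (use k0 in auto)
    moreover have "(LINT u|lborel. LINT r|lborel. k r u * F r) = 0"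
    proof (rule integral_eq_zero_AE)
      show "AE u in lborel. (LINT r|lborel. k r u * F r) = 0"
        using \<open>AE u in lborel. \<phi> u = 0\<close>
      proof eventually_elim
        fix u assume \<phi>: "\<phi> u = 0"
        have "k r u * F r = (indicator {..x} u * u powr (1/2 - H) * (x - u) powr (1/2 - H)) * (kernel_density H q r u * F r)" for r
        proof (cases "0 < r \<and> r \<le> u \<and> u \<le> x")
          case True
          then have "u powr (H - 1/2) * u powr (1/2 - H) = 1" by (simp add: powr_add[symmetric])
          then show ?thesis using True x by (simp add: k_def kernel_density_def mult_ac) 
        next
          case False then show ?thesis by (auto simp: k_def kernel_density_def indicator_def)
        qed
        then have "(LINT r|lborel. k r u * F r) = (indicator {..x} u * u powr (1/2 - H) * (x - u) powr (1/2 - H)) * \<phi> u"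
          unfolding \<phi>_def by (simp only: integral_mult_right_zero)
        then show "(LINT r|lborel. k r u * F r) = 0" using \<phi> by simp
      qed
    qed
    ultimately have "b * (LINT r|lborel. indicator {0<..<x} r * \<psi> r) = 0"
      unfolding kLINT \<psi>_def integral_mult_right_zero[symmetric] by (simp add: mult.assoc)
    then have "(LINT r|lborel. indicator {0<..<x} r * \<psi> r) = 0" using b by simp
    moreover have "(LINT r|lborel. indicator {..x} r * \<psi> r) = (LINT r|lborel. indicator {0<..<x} r * \<psi> r)"
    proof (rule integral_cong_AE)
      show "AE r in lborel. indicator {..x} r * \<psi> r = indicator {0<..<x} r * \<psi> r"
        using AE_lborel_singleton[of x] by eventually_elim (auto simp: \<psi>_def F_def indicator_def)
    qed auto
    ultimately show "(LINT r|lborel. indicator {..x} r * \<psi> r) = 0" by simp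
  qed
  then have "AE r in lborel. r \<in> {0..} \<longrightarrow> r \<le> q \<longrightarrow> f r = 0"
    using AE_lborel_singleton[of 0]
    by eventually_elim (auto simp: \<psi>_def F_def indicator_def split: if_splits)
  then show ?thesis by (subst AE_restrict_space_iff) auto
qed

section \<open>Density of the kernel functions\<close>

lemma K_op_injective_on:
  assumes H: "1/2 < H" "H < 1" and I: "time_set I" and f: "f \<in> L2 lborel_pos"
    and zero: "\<And>t. t \<in> I \<Longrightarrow> K_op H f t = 0"
  shows "AE r in lborel_pos. r \<in> I \<longrightarrow> f r = 0"
proof (cases rule: time_set_cases[OF I])
  case 1
  have "AE r in lborel_pos. \<forall>n::nat. r \<le> real n \<longrightarrow> f r = 0"
    unfolding AE_all_countable using K_op_injective[OF H _ f] zero 1 by auto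
  then show ?thesis by eventually_elim (meson real_arch_simple)
next
  case (2 q)
  have "AE r in lborel_pos. r \<le> q \<longrightarrow> f r = 0" using K_op_injective[OF H 2(1) f] zero 2 by auto
  then show ?thesis by eventually_elim (simp add: 2)
qed

definition kernel_comb :: "real \<Rightarrow> real set \<Rightarrow> (real \<Rightarrow> real) \<Rightarrow> real \<Rightarrow> real" where
  "kernel_comb H J a r = (\<Sum>t\<in>J. a t * K_kernel H t r)"

lemma kernel_comb_L2:
  assumes "1/2 < H" "H < 1" "J \<subseteq> {0..}"
  shows "kernel_comb H J a \<in> L2 lborel_pos"
  unfolding kernel_comb_def[abs_def] using assms by (intro L2_sum K_kernel_L2) auto

text \<open>
  A function orthogonal to all \<open>K_kernel H t\<close>, \<open>t \<in> I\<close>, is annihilated by \<open>K_op H\<close> on \<open>I\<close> and hence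
  vanishes on \<open>I\<close>. The statement for bounded \<open>I\<close> is what makes Wiener integrals adapted: only
  kernels with \<open>t \<in> I\<close> are needed to approximate an integrand that is supported in \<open>I\<close>.
\<close>

lemma kernel_span_dense:
  assumes H: "1/2 < H" "H < 1" and I: "time_set I" and f: "f \<in> L2 lborel_pos"
    and supp: "\<And>r. r \<ge> 0 \<Longrightarrow> r \<notin> I \<Longrightarrow> f r = 0"
  obtains J a where "\<And>n::nat. finite (J n)" "\<And>n. J n \<subseteq> I"
    "(\<lambda>n. LINT r|lborel_pos. (kernel_comb H (J n) (a n) r - f r)\<^sup>2) \<longlonglongrightarrow> 0"
proof -
  let ?V = "{kernel_comb H J a |J a. finite J \<and> J \<subseteq> I}"
  have I0: "I \<subseteq> {0..}" using I by (simp add: time_set_def)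
  have V: "?V \<subseteq> L2 lborel_pos" using I0 by (auto intro!: kernel_comb_L2[OF H])
  have "kernel_comb H {} a = (\<lambda>r. 0)" for a by (simp add: kernel_comb_def fun_eq_iff)
  then have V0: "(\<lambda>r. 0) \<in> ?V" by (metis (mono_tags, lifting) empty_subsetI finite.emptyI mem_Collect_eq)
  have Vsub: "(\<lambda>r. a * u r + b * v r) \<in> ?V" if uV: "u \<in> ?V" and vV: "v \<in> ?V" for u v a b
  proof -
    obtain J c where u: "u = kernel_comb H J c" "finite J" "J \<subseteq> I" using uV by blast
    obtain J' c' where v: "v = kernel_comb H J' c'" "finite J'" "J' \<subseteq> I" using vV by blast
    define d where "d t = a * (if t \<in> J then c t else 0) + b * (if t \<in> J' then c' t else 0)" for t
    have "kernel_comb H (J \<union> J') d r = a * u r + b * v r" for r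
    proof -
      have e: "(\<Sum>t\<in>J \<union> J'. (if t \<in> J then c t else 0) * K_kernel H t r) = u r"
        "(\<Sum>t\<in>J \<union> J'. (if t \<in> J' then c' t else 0) * K_kernel H t r) = v r"
        unfolding u(1) v(1) kernel_comb_def using u(2) v(2)
        by (intro sum.mono_neutral_cong_right; auto)+
      have "kernel_comb H (J \<union> J') d r = (\<Sum>t\<in>J \<union> J'. a * ((if t \<in> J then c t else 0) * K_kernel H t r)
          + b * ((if t \<in> J' then c' t else 0) * K_kernel H t r))"
        unfolding kernel_comb_def d_def by (intro sum.cong) (auto simp: algebra_simps)
      also have "\<dots> = a * u r + b * v r"
        unfolding sum.distrib sum_distrib_left[symmetric] e ..
      finally show ?thesis .
    qed
    then have "(\<lambda>r. a * u r + b * v r) = kernel_comb H (J \<union> J') d" by (simp add: fun_eq_iff)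
    then show ?thesis using u v by blast
  qed
  obtain s r where s: "\<And>n::nat. s n \<in> ?V" and r: "r \<in> L2 lborel_pos"
    and lim: "(\<lambda>n. LINT x|lborel_pos. (f x - s n x - r x)\<^sup>2) \<longlonglongrightarrow> 0"
    and orth: "\<And>v. v \<in> ?V \<Longrightarrow> (LINT x|lborel_pos. r x * v x) = 0"
    using L2_orthogonal_residual[OF V V0 Vsub f] by blast
  have "\<forall>n. \<exists>J a. finite J \<and> J \<subseteq> I \<and> s n = kernel_comb H J a" using s by blast
  then obtain J a where Ja: "\<And>n. finite (J n)" "\<And>n. J n \<subseteq> I" "\<And>n. s n = kernel_comb H (J n) (a n)"
    by metis
  have "K_op H r t = 0" if "t \<in> I" for t
  proof -
    have "kernel_comb H {t} (\<lambda>_. 1) = K_kernel H t" by (simp add: kernel_comb_def fun_eq_iff)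
    then have "K_kernel H t \<in> ?V" using that by (metis (mono_tags, lifting) empty_subsetI finite.emptyI finite_insert insert_subset mem_Collect_eq)
    then show ?thesis using orth[of "K_kernel H t"] I0 that by (auto simp: K_op_eq_inner mult.commute)
  qed
  then have r0: "AE x in lborel_pos. x \<in> I \<longrightarrow> r x = 0" by (rule K_op_injective_on[OF H I r])
  have sL: "s n \<in> L2 lborel_pos" for n using s V by blast
  have s0: "s n x = 0" if "x \<ge> 0" "x \<notin> I" for n x
  proof -
    have "K_kernel H t x = 0" if "t \<in> J n" for t
      using Ja(2)[of n] \<open>t \<in> J n\<close> \<open>x \<notin> I\<close> time_set_downward[OF I, of t x]
      by (intro K_kernel_support) auto
    then show ?thesis unfolding Ja(3) kernel_comb_def by simp
  qed
  have "(\<lambda>n. LINT x|lborel_pos. (s n x - f x)\<^sup>2) \<longlonglongrightarrow> 0"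
  proof (rule tendsto_sandwich[OF _ _ tendsto_const[of 0] lim])
    show "\<forall>\<^sub>F n in sequentially. (LINT x|lborel_pos. (s n x - f x)\<^sup>2) \<le> (LINT x|lborel_pos. (f x - s n x - r x)\<^sup>2)"
    proof (rule always_eventually, rule allI, rule integral_mono_AE)
      fix n
      show "integrable lborel_pos (\<lambda>x. (s n x - f x)\<^sup>2)" using L2_diff[OF sL f] by (simp add: L2_def)
      show "integrable lborel_pos (\<lambda>x. (f x - s n x - r x)\<^sup>2)"
        using L2_diff[OF L2_diff[OF f sL] r] by (simp add: L2_def)
      show "AE x in lborel_pos. (s n x - f x)\<^sup>2 \<le> (f x - s n x - r x)\<^sup>2"
        using r0 AE_space
      proof eventually_elim
        fix x assume x: "x \<in> I \<longrightarrow> r x = 0" "x \<in> space lborel_pos"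
        show "(s n x - f x)\<^sup>2 \<le> (f x - s n x - r x)\<^sup>2"
          using x s0[of x n] supp[of x] by (cases "x \<in> I") (auto simp: space_restrict_space power2_commute)
      qed
    qed
  qed simp
  then show thesis using that[of J a] Ja by simp
qed

lemma K_op_lincomb:
  assumes H: "1/2 < H" "H < 1" and fg: "f \<in> L2 lborel_pos" "g \<in> L2 lborel_pos"
  shows "K_op H (\<lambda>r. a * f r + b * g r) = (\<lambda>s\<in>{0..}. a * K_op H f s + b * K_op H g s)"
proof
  fix s
  show "K_op H (\<lambda>r. a * f r + b * g r) s = (\<lambda>s\<in>{0..}. a * K_op H f s + b * K_op H g s) s"
  proof (cases "0 \<le> s")
    case True
    have i: "integrable lborel_pos (\<lambda>r. K_kernel H s r * f r)" "integrable lborel_pos (\<lambda>r. K_kernel H s r * g r)"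
      by (intro L2_mult_integrable K_kernel_L2[OF H True] fg)+
    have "(LINT r|lborel_pos. K_kernel H s r * (a * f r + b * g r))
      = (LINT r|lborel_pos. a * (K_kernel H s r * f r) + b * (K_kernel H s r * g r))"
      by (intro Bochner_Integration.integral_cong) (auto simp: algebra_simps)
    also have "\<dots> = a * (LINT r|lborel_pos. K_kernel H s r * f r) + b * (LINT r|lborel_pos. K_kernel H s r * g r)"
      using i by simp
    finally show ?thesis using True by (simp add: K_op_eq_inner)
  qed (simp add: K_op_def)
qed

text \<open>
  The representative picked by \<open>CM_dot\<close> is the given integrand, by injectivity.
\<close>

lemma CM_dot_K_op:
  assumes H: "1/2 < H" "H < 1" and f: "f \<in> L2 lborel_pos"
  shows "CM_dot H (K_op H f) \<in> L2 lborel_pos" "AE r in lborel_pos. CM_dot H (K_op H f) r = f r"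
proof -
  let ?g = "CM_dot H (K_op H f)"
  show g: "?g \<in> L2 lborel_pos" unfolding CM_dot_def using f by (intro inv_into_into) auto
  have eq: "K_op H ?g = K_op H f" unfolding CM_dot_def by (rule f_inv_into_f[of _ "K_op H"]) (use f in auto)
  have "K_op H (\<lambda>r. 1 * ?g r + (-1) * f r) t = 0" if "t \<in> {0..}" for t
    unfolding K_op_lincomb[OF H g f] using that by (simp add: eq)
  from K_op_injective_on[OF H time_set_halfline L2_lincomb[OF g f] this] 
  have "AE r in lborel_pos. r \<in> {0..} \<longrightarrow> 1 * ?g r + (-1) * f r = 0" by simp
  then show "AE r in lborel_pos. ?g r = f r"
    using AE_space by eventually_elim (auto simp: space_restrict_space)
qed

lemma CM_normsq_K_op:
  assumes H: "1/2 < H" "H < 1" and f: "f \<in> L2 lborel_pos"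
  shows "CM_normsq H (K_op H f) = (LINT r|lborel_pos. (f r)\<^sup>2)"
proof -
  have [measurable]: "f \<in> borel_measurable lborel_pos" "CM_dot H (K_op H f) \<in> borel_measurable lborel_pos"
    using f CM_dot_K_op(1)[OF H f] by (auto simp: L2_def)
  have "AE r in lborel_pos. CM_dot H (K_op H f) r * CM_dot H (K_op H f) r = (f r)\<^sup>2"
    using CM_dot_K_op(2)[OF H f] by eventually_elim (simp add: power2_eq_square)
  then show ?thesis unfolding CM_normsq_def CM_inner_def by (intro integral_cong_AE) auto
qed

text \<open>
  By the Cauchy--Schwarz inequality, \<open>K_op H f\<close> is Hoelder continuous of order \<open>H\<close>, since the squared
  distance of two kernels is \<open>\<bar>s - t\<bar> powr (2 * H)\<close>.
\<close>

lemma K_op_path: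
  assumes H: "1/2 < H" "H < 1" and f: "f \<in> L2 lborel_pos"
  shows "K_op H f \<in> path_space {0..}"
proof -
  define N where "N = (LINT r|lborel_pos. (f r)\<^sup>2)"
  have bound: "\<bar>K_op H f s - K_op H f t\<bar> \<le> sqrt (\<bar>s - t\<bar> powr (2*H) * N)" if st: "0 \<le> s" "0 \<le> t" for s t
  proof -
    have K: "K_kernel H s \<in> L2 lborel_pos" "K_kernel H t \<in> L2 lborel_pos" using st by (auto intro: K_kernel_L2[OF H])
    have "K_op H f s - K_op H f t = (LINT r|lborel_pos. (K_kernel H s r - K_kernel H t r) * f r)"
      using L2_mult_integrable[OF K(1) f] L2_mult_integrable[OF K(2) f] st
      by (simp add: K_op_eq_inner left_diff_distrib)
    also have "\<dots>\<^sup>2 \<le> (LINT r|lborel_pos. (K_kernel H s r - K_kernel H t r)\<^sup>2) * N"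
      unfolding N_def by (intro L2_Cauchy_Schwarz L2_diff K f)
    also have "(LINT r|lborel_pos. (K_kernel H s r - K_kernel H t r)\<^sup>2) = \<bar>s - t\<bar> powr (2*H)"
    proof -
      have "(LINT r|lborel_pos. (1 * K_kernel H s r + (-1) * K_kernel H t r)\<^sup>2)
        = R_cov H s s - 2 * R_cov H s t + R_cov H t t"
        unfolding L2_integral_lincomb_square[OF K] using kernel_covariance[OF H] st
        by (simp add: power2_eq_square)
      then show ?thesis by (simp add: R_cov_increment)
    qed
    finally show ?thesis by (intro real_le_rsqrt) simp
  qed
  have "continuous_on {0..} (K_op H f)"
    unfolding continuous_on_def
  proof
    fix t :: real assume t: "t \<in> {0..}"
    have "((\<lambda>s. sqrt (\<bar>s - t\<bar> powr (2*H) * N)) \<longlongrightarrow> sqrt (\<bar>t - t\<bar> powr (2*H) * N)) (at t within {0..})"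
      using H by (intro tendsto_real_sqrt tendsto_mult tendsto_powr' tendsto_rabs tendsto_diff tendsto_ident_at tendsto_const) auto
    then have lim: "((\<lambda>s. sqrt (\<bar>s - t\<bar> powr (2*H) * N)) \<longlongrightarrow> 0) (at t within {0..})" by simp
    have "((\<lambda>s. K_op H f s - K_op H f t) \<longlongrightarrow> 0) (at t within {0..})"
    proof (rule Lim_null_comparison[OF _ lim])
      show "\<forall>\<^sub>F s in at t within {0..}. norm (K_op H f s - K_op H f t) \<le> sqrt (\<bar>s - t\<bar> powr (2*H) * N)"
        using bound t by (auto simp: eventually_at_filter)
    qed
    then show "(K_op H f \<longlongrightarrow> K_op H f t) (at t within {0..})" by (rule LIM_zero_cancel)
  qed
  moreover have "K_op H f 0 = 0" by (simp add: K_op_eq_inner K_kernel_support)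
  ultimately show ?thesis by (auto simp: path_space_def K_op_def)
qed

section \<open>Wiener integrals\<close>

lemma (in prob_space) centered_normal_second_moment:
  assumes "centered_normal M X v"
  shows "X \<in> L2 M" "(LINT x|M. (X x)\<^sup>2) = v"
proof -
  have "X \<in> L2 M \<and> (LINT x|M. (X x)\<^sup>2) = v"
  proof (cases "v = 0")
    case True
    then have X: "X \<in> borel_measurable M" "AE x in M. X x = 0" using assms by (auto simp: centered_normal_def)
    then have ae: "AE x in M. (X x)\<^sup>2 = 0" by auto
    have "integrable M (\<lambda>x. (X x)\<^sup>2)"
      using ae X(1) by (subst integrable_cong_AE[of _ _ "\<lambda>_. 0"]) auto
    moreover have "(LINT x|M. (X x)\<^sup>2) = 0" using ae by (rule integral_eq_zero_AE)
    ultimately show ?thesis using X(1) True by (simp add: L2_def)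
  next
    case False
    then have v: "v > 0" and X: "X \<in> borel_measurable M" and d: "distributed M lborel X (normal_density 0 (sqrt v))"
      using assms by (auto simp: centered_normal_def)
    have s: "0 < sqrt v" using v by simp
    have i: "integrable M (\<lambda>x. (X x)\<^sup>2)"
      using distributed_integrable[OF d, of "\<lambda>x. x\<^sup>2"] integrable_normal_moment[OF s, of 0 2] by simp
    have "variance X = v" using normal_distributed_variance[OF s d] v by simp
    moreover have "expectation X = 0" using normal_distributed_expectation[OF s d] .
    ultimately show ?thesis using X i by (simp add: L2_def)
  qed
  then show "X \<in> L2 M" "(LINT x|M. (X x)\<^sup>2) = v" by auto
qed

lemma (in prob_space) centered_normal_cos:
  assumes "centered_normal M X v"
  shows "(LINT x|M. cos (X x + \<theta>)) = cos \<theta> * exp (- v / 2)"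
proof (cases "v = 0")
  case True
  then have "AE x in M. cos (X x + \<theta>) = cos \<theta>" and [measurable]: "X \<in> borel_measurable M"
    using assms by (auto simp: centered_normal_def)
  then have "(LINT x|M. cos (X x + \<theta>)) = (LINT x|M. cos \<theta>)" by (intro integral_cong_AE) auto
  then show ?thesis using True by (simp add: prob_space)
next
  case False
  then have v: "v > 0" and X[measurable]: "X \<in> borel_measurable M" and d: "distributed M lborel X (normal_density 0 (sqrt v))"
    using assms by (auto simp: centered_normal_def)
  have s: "0 < sqrt v" using v by simp
  have "distributed M lborel (\<lambda>x. (X x - 0) / sqrt v) std_normal_density"
    using normal_standard_normal_convert[OF s] d by blast
  then have law: "distr M borel (\<lambda>x. X x / sqrt v) = std_normal_distribution"
    by (simp add: distributed_def cong: distr_cong)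
  have "(CLINT x|M. iexp (X x)) = char std_normal_distribution (sqrt v)"
    unfolding law[symmetric] char_def using v by (simp add: integral_distr)
  also have "\<dots> = complex_of_real (exp (- v / 2))"
    using v by (simp add: char_std_normal_distribution)
  finally have e: "(CLINT x|M. iexp (X x)) = complex_of_real (exp (- v / 2))" .
  have ii: "integrable M (\<lambda>x. iexp (X x))"
    by (intro integrable_const_bound[of _ 1]) auto
  have "(LINT x|M. cos (X x)) = Re (CLINT x|M. iexp (X x))"
    by (subst integral_Re[OF ii, symmetric]) (simp add: Re_exp)
  then have c: "(LINT x|M. cos (X x)) = exp (- v / 2)" unfolding e by simp
  have "(LINT x|M. sin (X x)) = Im (CLINT x|M. iexp (X x))"
    by (subst integral_Im[OF ii, symmetric]) (simp add: Im_exp)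
  then have sn: "(LINT x|M. sin (X x)) = 0" unfolding e by simp
  have "integrable M (\<lambda>x. cos (X x))" "integrable M (\<lambda>x. sin (X x))"
    by (intro integrable_const_bound[of _ 1]; auto)+
  then have "(LINT x|M. cos (X x + \<theta>)) = cos \<theta> * (LINT x|M. cos (X x)) - sin \<theta> * (LINT x|M. sin (X x))"
    by (simp add: cos_add mult.commute)
  then show ?thesis by (simp add: c sn)
qed

text \<open>
  The isometry is transported to integrands: \<open>wiener f\<close> is the integral of \<open>f\<close> with respect to the
  underlying Brownian motion. It is linear up to null sets and isometric, it maps the kernel of
  time \<open>t\<close> to the evaluation at \<open>t\<close>, and by density of the kernels this determines everything else.
\<close>

locale wiener_isometry = prob_space P for P :: "(real \<Rightarrow> real) measure" +
  fixes H :: real and \<delta> :: "(real \<Rightarrow> real) \<Rightarrow> (real \<Rightarrow> real) \<Rightarrow> real"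
  assumes H: "1/2 < H" "H < 1"
    and fbm: "fbm_law H P"
    and iso: "is_wiener_isometry H P \<delta>"
begin

definition wiener :: "(real \<Rightarrow> real) \<Rightarrow> (real \<Rightarrow> real) \<Rightarrow> real" where
  "wiener f = \<delta> (K_op H f)"

lemma sets_P [measurable_cong]: "sets P = sets (path_borel {0..})"
  using fbm by (simp add: fbm_law_def)

lemma space_P [simp]: "space P = path_space {0..}"
  using sets_eq_imp_space_eq[OF sets_P] by simp

lemma evaluation_P: "t \<ge> 0 \<Longrightarrow> (\<lambda>w. w t) \<in> borel_measurable P"
  using evaluation_measurable[of t "{0..}"] by measurable

lemma identity_P: "(\<lambda>w. w) \<in> P \<rightarrow>\<^sub>M path_borel {0..}"
  by (simp add: measurable_cong_sets[OF sets_P refl])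

lemma wiener_L2: "f \<in> L2 lborel_pos \<Longrightarrow> wiener f \<in> L2 P"
  using iso by (auto simp: is_wiener_isometry_def CM_space_def wiener_def)

lemma wiener_measurable [measurable]: "f \<in> L2 lborel_pos \<Longrightarrow> wiener f \<in> borel_measurable P"
  using wiener_L2 by (auto simp: L2_def)

lemma wiener_lincomb:
  assumes "f \<in> L2 lborel_pos" "g \<in> L2 lborel_pos"
  shows "AE w in P. wiener (\<lambda>r. a * f r + b * g r) w = a * wiener f w + b * wiener g w"
  using iso assms unfolding is_wiener_isometry_def wiener_def K_op_lincomb[OF H assms] CM_space_def
  by blast

lemma wiener_norm:
  assumes "f \<in> L2 lborel_pos"
  shows "(LINT w|P. (wiener f w)\<^sup>2) = (LINT r|lborel_pos. (f r)\<^sup>2)"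
  using iso assms CM_normsq_K_op[OF H assms] by (auto simp: is_wiener_isometry_def CM_space_def wiener_def)

lemma wiener_kernel: "t \<ge> 0 \<Longrightarrow> AE w in P. wiener (K_kernel H t) w = w t"
  using iso by (simp add: is_wiener_isometry_def wiener_def K_op_kernel[OF H])

lemma wiener_dist:
  assumes "f \<in> L2 lborel_pos" "g \<in> L2 lborel_pos"
  shows "(LINT w|P. (wiener f w - wiener g w)\<^sup>2) = (LINT r|lborel_pos. (f r - g r)\<^sup>2)"
proof -
  have "(LINT w|P. (wiener f w - wiener g w)\<^sup>2) = (LINT w|P. (wiener (\<lambda>r. 1 * f r + (-1) * g r) w)\<^sup>2)"
  proof (rule integral_cong_AE)
    show "AE w in P. (wiener f w - wiener g w)\<^sup>2 = (wiener (\<lambda>r. 1 * f r + (-1) * g r) w)\<^sup>2"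
      using wiener_lincomb[OF assms, of 1 "-1"] by eventually_elim simp
    show "(\<lambda>w. (wiener (\<lambda>r. 1 * f r + (-1) * g r) w)\<^sup>2) \<in> borel_measurable P"
      using wiener_measurable[OF L2_lincomb[OF assms, of 1 "-1"]] by measurable
  qed (use wiener_measurable assms in measurable)
  also have "\<dots> = (LINT r|lborel_pos. (f r - g r)\<^sup>2)"
    using wiener_norm[OF L2_lincomb[OF assms, of 1 "-1"]] by simp
  finally show ?thesis .
qed

lemma wiener_sum:
  assumes "finite A" "\<And>i. i \<in> A \<Longrightarrow> f i \<in> L2 lborel_pos"
  shows "AE w in P. wiener (\<lambda>r. \<Sum>i\<in>A. a i * f i r) w = (\<Sum>i\<in>A. a i * wiener (f i) w)"
  using assms
proof (induction A rule: finite_induct)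
  case empty
  have "(\<lambda>r. \<Sum>i\<in>{}. a i * f i r) = (\<lambda>r. 0 * (0::real) + 0 * 0)" by simp
  then show ?case using wiener_lincomb[OF L2_zero L2_zero, of 0 0] by simp
next
  case (insert i A)
  have L: "f i \<in> L2 lborel_pos" "(\<lambda>r. \<Sum>i\<in>A. a i * f i r) \<in> L2 lborel_pos"
    using insert by (auto intro!: L2_sum)
  have eq: "(\<lambda>r. \<Sum>i\<in>insert i A. a i * f i r) = (\<lambda>r. a i * f i r + 1 * (\<Sum>i\<in>A. a i * f i r))"
    using insert by (simp add: fun_eq_iff)
  have "AE w in P. wiener (\<lambda>r. \<Sum>i\<in>A. a i * f i r) w = (\<Sum>i\<in>A. a i * wiener (f i) w)" using insert by simp
  moreover have "AE w in P. wiener (\<lambda>r. a i * f i r + 1 * (\<Sum>i\<in>A. a i * f i r)) w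
      = a i * wiener (f i) w + 1 * wiener (\<lambda>r. \<Sum>i\<in>A. a i * f i r) w"
    by (rule wiener_lincomb[OF L])
  ultimately show ?case
    unfolding eq by eventually_elim (use insert in simp)
qed

lemma wiener_kernel_comb:
  assumes "finite J" "J \<subseteq> {0..}"
  shows "AE w in P. wiener (kernel_comb H J a) w = (\<Sum>t\<in>J. a t * w t)"
proof -
  have "AE w in P. wiener (kernel_comb H J a) w = (\<Sum>t\<in>J. a t * wiener (K_kernel H t) w)"
    unfolding kernel_comb_def[abs_def] using assms by (intro wiener_sum K_kernel_L2[OF H]) auto
  moreover have "AE w in P. \<forall>t\<in>J. wiener (K_kernel H t) w = w t"
    using assms wiener_kernel by (intro AE_finite_allI) auto
  ultimately show ?thesis by eventually_elim simp
qed

lemma wiener_tendsto: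
  assumes g: "\<And>n. g n \<in> L2 lborel_pos" and f: "f \<in> L2 lborel_pos"
    and lim: "(\<lambda>n. LINT r|lborel_pos. (g n r - f r)\<^sup>2) \<longlonglongrightarrow> 0"
  shows "(\<lambda>n. LINT w|P. (wiener (g n) w - wiener f w)\<^sup>2) \<longlonglongrightarrow> 0"
  using lim by (simp add: wiener_dist[OF g f])

lemma wiener_cos_kernel_comb:
  assumes J: "finite J" "J \<subseteq> {0..}"
  shows "(LINT w|P. cos (wiener (kernel_comb H J a) w + \<theta>))
    = cos \<theta> * exp (- (LINT r|lborel_pos. (kernel_comb H J a r)\<^sup>2) / 2)"
proof -
  have L: "kernel_comb H J a \<in> L2 lborel_pos" using kernel_comb_L2[OF H J(2)] .
  obtain v where v: "centered_normal P (\<lambda>w. \<Sum>t\<in>J. a t * w t) v"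
    using fbm J unfolding fbm_law_def by blast
  have m: "(\<lambda>w. \<Sum>t\<in>J. a t * w t) \<in> borel_measurable P" using v by (simp add: centered_normal_def)
  have "v = (LINT w|P. (\<Sum>t\<in>J. a t * w t)\<^sup>2)" using centered_normal_second_moment(2)[OF v] ..
  also have "\<dots> = (LINT w|P. (wiener (kernel_comb H J a) w)\<^sup>2)"
  proof (rule integral_cong_AE)
    show "AE w in P. (\<Sum>t\<in>J. a t * w t)\<^sup>2 = (wiener (kernel_comb H J a) w)\<^sup>2"
      using wiener_kernel_comb[OF J, of a] by eventually_elim simp
  qed (use m wiener_measurable[OF L] in auto)
  finally have v_eq: "v = (LINT r|lborel_pos. (kernel_comb H J a r)\<^sup>2)" using wiener_norm[OF L] by simp
  have "(LINT w|P. cos (wiener (kernel_comb H J a) w + \<theta>)) = (LINT w|P. cos ((\<Sum>t\<in>J. a t * w t) + \<theta>))"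
  proof (rule integral_cong_AE)
    show "AE w in P. cos (wiener (kernel_comb H J a) w + \<theta>) = cos ((\<Sum>t\<in>J. a t * w t) + \<theta>)"
      using wiener_kernel_comb[OF J, of a] by eventually_elim simp
  qed (use m wiener_measurable[OF L] in auto)
  then show ?thesis using centered_normal_cos[OF v, of \<theta>] by (simp add: v_eq)
qed

text \<open>
  Wiener integrals are centred Gaussian. This holds by assumption for linear combinations of
  evaluations and passes to limits in \<open>L\<^sup>2\<close>. Joint normality of several integrals is included,
  because their linear combinations are again Wiener integrals.
\<close>

lemma wiener_cos:
  assumes f: "f \<in> L2 lborel_pos"
  shows "(LINT w|P. cos (wiener f w + \<theta>)) = cos \<theta> * exp (- (LINT r|lborel_pos. (f r)\<^sup>2) / 2)"
proof -
  obtain J a where J: "\<And>n::nat. finite (J n)" "\<And>n. J n \<subseteq> {0..}"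
    and lim: "(\<lambda>n. LINT r|lborel_pos. (kernel_comb H (J n) (a n) r - f r)\<^sup>2) \<longlonglongrightarrow> 0"
    by (rule kernel_span_dense[OF H time_set_halfline f]) auto
  have L: "kernel_comb H (J n) (a n) \<in> L2 lborel_pos" for n using kernel_comb_L2[OF H J(2)] .
  obtain k :: "nat \<Rightarrow> nat" where k: "strict_mono k"
    and ae: "AE w in P. (\<lambda>n. wiener (kernel_comb H (J (k n)) (a (k n))) w) \<longlonglongrightarrow> wiener f w"
    using L2_tendsto_AE_subseq[OF wiener_L2[OF L] wiener_L2[OF f] wiener_tendsto[OF L f lim]] by blast
  have "(\<lambda>n. LINT w|P. cos (wiener (kernel_comb H (J (k n)) (a (k n))) w + \<theta>)) \<longlonglongrightarrow> (LINT w|P. cos (wiener f w + \<theta>))"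
  proof (rule integral_dominated_convergence[where w = "\<lambda>_. 1"])
    show "AE w in P. (\<lambda>n. cos (wiener (kernel_comb H (J (k n)) (a (k n))) w + \<theta>)) \<longlonglongrightarrow> cos (wiener f w + \<theta>)"
      using ae by eventually_elim (intro tendsto_intros)
    show "(\<lambda>w. cos (wiener f w + \<theta>)) \<in> borel_measurable P" using wiener_measurable[OF f] by measurable
    show "(\<lambda>w. cos (wiener (kernel_comb H (J (k n)) (a (k n))) w + \<theta>)) \<in> borel_measurable P" for n
      using wiener_measurable[OF L[of "k n"]] by measurable
  qed auto
  moreover have "(\<lambda>n. LINT w|P. cos (wiener (kernel_comb H (J (k n)) (a (k n))) w + \<theta>))
      \<longlonglongrightarrow> cos \<theta> * exp (- (LINT r|lborel_pos. (f r)\<^sup>2) / 2)"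
    unfolding wiener_cos_kernel_comb[OF J]
    using LIMSEQ_subseq_LIMSEQ[OF L2_tendsto_integral(2)[OF L f lim L2_zero] k]
    by (intro tendsto_intros) (auto simp: o_def)
  ultimately show ?thesis by (rule LIMSEQ_unique)
qed

text \<open>
  The functional is defined on all paths as the limit of linear combinations of evaluations at times
  in \<open>I\<close>. Hence it depends only on the restriction of the path to \<open>I\<close> everywhere, not merely up to
  a null set.
\<close>

lemma wiener_adapted:
  assumes I: "time_set I" and f: "f \<in> L2 lborel_pos" and supp: "\<And>r. r \<ge> 0 \<Longrightarrow> r \<notin> I \<Longrightarrow> f r = 0"
  obtains G where "G \<in> borel_measurable (path_borel {0..})"
    "\<forall>w v. (\<forall>t\<in>I. w t = v t) \<longrightarrow> G w = G v" "AE w in P. wiener f w = G w"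
proof -
  obtain J a where J: "\<And>n::nat. finite (J n)" "\<And>n. J n \<subseteq> I"
    and lim: "(\<lambda>n. LINT r|lborel_pos. (kernel_comb H (J n) (a n) r - f r)\<^sup>2) \<longlonglongrightarrow> 0"
    by (rule kernel_span_dense[OF H I f supp]) auto
  have J0: "J n \<subseteq> {0..}" for n using J(2)[of n] I by (auto simp: time_set_def)
  have L: "kernel_comb H (J n) (a n) \<in> L2 lborel_pos" for n using kernel_comb_L2[OF H J0] .
  obtain k :: "nat \<Rightarrow> nat" where k: "strict_mono k"
    and ae: "AE w in P. (\<lambda>n. wiener (kernel_comb H (J (k n)) (a (k n))) w) \<longlonglongrightarrow> wiener f w"
    using L2_tendsto_AE_subseq[OF wiener_L2[OF L] wiener_L2[OF f] wiener_tendsto[OF L f lim]] by blast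
  define G where "G w = lim (\<lambda>n. \<Sum>t\<in>J (k n). a (k n) t * w t)" for w :: "real \<Rightarrow> real"
  have m: "(\<lambda>w. \<Sum>t\<in>J (k n). a (k n) t * w t) \<in> borel_measurable (path_borel {0..})" for n
    using J0 by (intro borel_measurable_sum borel_measurable_times evaluation_measurable) auto
  have "G \<in> borel_measurable (path_borel {0..})"
    unfolding G_def[abs_def] using m by (intro borel_measurable_lim_metric)
  moreover have "\<forall>w v. (\<forall>t\<in>I. w t = v t) \<longrightarrow> G w = G v"
  proof (intro allI impI)
    fix w v :: "real \<Rightarrow> real" assume wv: "\<forall>t\<in>I. w t = v t"
    have "(\<Sum>t\<in>J (k n). a (k n) t * w t) = (\<Sum>t\<in>J (k n). a (k n) t * v t)" for n
      using wv J(2) by (intro sum.cong) auto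
    then show "G w = G v" by (simp add: G_def)
  qed
  moreover have "AE w in P. wiener f w = G w"
  proof -
    have "AE w in P. \<forall>n. wiener (kernel_comb H (J (k n)) (a (k n))) w = (\<Sum>t\<in>J (k n). a (k n) t * w t)"
      unfolding AE_all_countable using wiener_kernel_comb[OF J(1) J0] by blast
    with ae show ?thesis by eventually_elim (simp add: G_def limI)
  qed
  ultimately show thesis by (rule that)
qed

end

section \<open>The Cameron--Martin theorem\<close>

context wiener_isometry begin

lemma wiener_cos_scaled:
  assumes f: "f \<in> L2 lborel_pos"
  shows "(LINT w|P. cos (b * wiener f w + \<theta>)) = cos \<theta> * exp (- (b\<^sup>2 * (LINT r|lborel_pos. (f r)\<^sup>2)) / 2)"
proof -
  have bf: "(\<lambda>r. b * f r) \<in> L2 lborel_pos" using L2_cmult[OF f] .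
  have "(LINT w|P. cos (b * wiener f w + \<theta>)) = (LINT w|P. cos (wiener (\<lambda>r. b * f r) w + \<theta>))"
  proof (rule integral_cong_AE)
    show "AE w in P. cos (b * wiener f w + \<theta>) = cos (wiener (\<lambda>r. b * f r) w + \<theta>)"
      using wiener_lincomb[OF f f, of b 0] by eventually_elim simp
  qed (use wiener_measurable[OF bf] wiener_measurable[OF f] in auto)
  also have "\<dots> = cos \<theta> * exp (- (b\<^sup>2 * (LINT r|lborel_pos. (f r)\<^sup>2)) / 2)"
    unfolding wiener_cos[OF bf] by (simp add: power_mult_distrib)
  finally show ?thesis .
qed

lemma wiener_law:
  assumes f: "f \<in> L2 lborel_pos" and s: "s = (LINT r|lborel_pos. (f r)\<^sup>2)" "s > 0"
  shows "distr P borel (wiener f) = density lborel (\<lambda>x. ennreal (normal_density 0 (sqrt s) x))"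
proof (rule finite_measure_eqI_cos)
  let ?N = "density lborel (\<lambda>x. ennreal (normal_density 0 (sqrt s) x))"
  have [measurable]: "wiener f \<in> borel_measurable P" using f by (rule wiener_measurable)
  interpret N: prob_space ?N using s by (intro prob_space_normal_density) simp
  show "finite_measure (distr P borel (wiener f))" by (rule finite_measure_distr) simp
  show "finite_measure ?N" by unfold_locales
  fix b \<theta>
  have "centered_normal ?N (\<lambda>x. b * x) (b\<^sup>2 * s)"
  proof (cases "b = 0")
    case False
    have "distributed ?N lborel (\<lambda>x. x) (\<lambda>x. ennreal (normal_density 0 (sqrt s) x))"
      by (auto simp: distributed_def intro!: distr_id2)
    from N.normal_density_affine[OF this _ False, of 0] s
    have "distributed ?N lborel (\<lambda>x. 0 + b * x) (\<lambda>x. ennreal (normal_density (0 + b * 0) (\<bar>b\<bar> * sqrt s) x))"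
      by simp
    moreover have "\<bar>b\<bar> * sqrt s = sqrt (b\<^sup>2 * s)" by (simp add: real_sqrt_mult)
    ultimately show ?thesis using s False by (simp add: centered_normal_def)
  qed (simp add: centered_normal_def)
  then have "(LINT x|?N. cos (b * x + \<theta>)) = cos \<theta> * exp (- (b\<^sup>2 * s) / 2)" by (rule N.centered_normal_cos)
  moreover have "(LINT x|distr P borel (wiener f). cos (b * x + \<theta>)) = cos \<theta> * exp (- (b\<^sup>2 * s) / 2)"
    using wiener_cos_scaled[OF f] by (simp add: integral_distr s)
  ultimately show "(LINT x|distr P borel (wiener f). cos (b * x + \<theta>)) = (LINT x|?N. cos (b * x + \<theta>))" by simp
qed auto

lemma normal_density_tilt:
  assumes "s > 0"
  shows "normal_density 0 (sqrt s) x * exp (x - s / 2) = normal_density s (sqrt s) x"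
proof -
  have "- (x\<^sup>2 / (2 * s)) + (x - s / 2) = - ((x - s)\<^sup>2 / (2 * s))"
    using assms by (simp add: field_simps power2_eq_square)
  then show ?thesis using assms by (simp add: normal_density_def exp_add[symmetric])
qed

text \<open>
  The exponential weight shifts a centred normal variable of variance \<open>s\<close> by \<open>s\<close>.
\<close>

lemma wiener_tilt:
  assumes f: "f \<in> L2 lborel_pos" and s: "s = (LINT r|lborel_pos. (f r)\<^sup>2)"
  shows "integrable P (\<lambda>w. exp (wiener f w - s / 2))"
    and "g \<in> borel_measurable borel \<Longrightarrow> (LINT w|P. g (wiener f w) * exp (wiener f w - s / 2)) = (LINT w|P. g (wiener f w + s :: real))"
proof -
  have [measurable]: "wiener f \<in> borel_measurable P" using f by (rule wiener_measurable)
  have "s \<ge> 0" by (simp add: s)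
  have "integrable P (\<lambda>w. exp (wiener f w - s / 2)) \<and> (g \<in> borel_measurable borel \<longrightarrow>
    (LINT w|P. g (wiener f w) * exp (wiener f w - s / 2)) = (LINT w|P. g (wiener f w + s)))"
  proof (cases "s = 0")
    case True
    have "(LINT w|P. (wiener f w)\<^sup>2) = 0" using wiener_norm[OF f] True s by simp
    then have "AE w in P. (wiener f w)\<^sup>2 = 0"
      using wiener_L2[OF f] by (subst (asm) integral_nonneg_eq_0_iff_AE) (auto simp: L2_def)
    then have z: "AE w in P. wiener f w = 0" by simp
    have "integrable P (\<lambda>w. exp (wiener f w - s / 2))"
    proof (rule integrable_cong_AE_imp[of _ "\<lambda>_. 1"])
      show "AE w in P. 1 = exp (wiener f w - s / 2)" using z by eventually_elim (simp add: True)
    qed auto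
    moreover have "(LINT w|P. g (wiener f w) * exp (wiener f w - s / 2)) = (LINT w|P. g (wiener f w + s))"
      if [measurable]: "g \<in> borel_measurable borel"
    proof (rule integral_cong_AE)
      show "AE w in P. g (wiener f w) * exp (wiener f w - s / 2) = g (wiener f w + s)"
        using z by eventually_elim (simp add: True)
    qed auto
    ultimately show ?thesis by blast
  next
    case False
    then have "s > 0" using \<open>s \<ge> 0\<close> by simp
    note law = wiener_law[OF f s \<open>s > 0\<close>]
    have sq: "0 < sqrt s" using \<open>s > 0\<close> by simp
    have "integrable lborel (normal_density s (sqrt s))" using integrable_normal_density[OF sq] .
    then have "integrable (density lborel (\<lambda>x. ennreal (normal_density 0 (sqrt s) x))) (\<lambda>x. exp (x - s / 2))"
      by (subst integrable_density) (auto simp: normal_density_tilt[OF \<open>s > 0\<close>])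
    then have "integrable P (\<lambda>w. exp (wiener f w - s / 2))"
      unfolding law[symmetric] by (subst (asm) integrable_distr_eq) auto
    moreover have "(LINT w|P. g (wiener f w) * exp (wiener f w - s / 2)) = (LINT w|P. g (wiener f w + s))"
      if [measurable]: "g \<in> borel_measurable borel"
    proof -
      have "(LINT w|P. g (wiener f w) * exp (wiener f w - s / 2))
          = (LINT x|distr P borel (wiener f). g x * exp (x - s / 2))" by (simp add: integral_distr)
      also have "\<dots> = (LINT x|lborel. normal_density 0 (sqrt s) x * (g x * exp (x - s / 2)))"
        unfolding law by (subst integral_density) auto
      also have "\<dots> = (LINT x|lborel. normal_density s (sqrt s) x * g x)"
        unfolding normal_density_tilt[OF \<open>s > 0\<close>, symmetric] by (simp add: mult_ac)
      also have "\<dots> = (LINT x|lborel. normal_density s (sqrt s) (s + 1 * x) * g (s + 1 * x))"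
        by (subst lborel_integral_real_affine[where c = 1 and t = s]) simp_all
      also have "\<dots> = (LINT x|lborel. normal_density 0 (sqrt s) x * g (x + s))"
        by (simp add: normal_density_def add.commute)
      also have "\<dots> = (LINT x|distr P borel (wiener f). g (x + s))"
        unfolding law by (subst integral_density) auto
      also have "\<dots> = (LINT w|P. g (wiener f w + s))" by (simp add: integral_distr)
      finally show ?thesis .
    qed
    ultimately show ?thesis by blast
  qed
  then show "integrable P (\<lambda>w. exp (wiener f w - s / 2))"
    "g \<in> borel_measurable borel \<Longrightarrow> (LINT w|P. g (wiener f w) * exp (wiener f w - s / 2)) = (LINT w|P. g (wiener f w + s))"
    by auto
qed

lemma wiener_cos_cos:
  assumes f: "f \<in> L2 lborel_pos" and g: "g \<in> L2 lborel_pos"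
  shows "(LINT w|P. cos (wiener g w + \<theta>) * cos (wiener f w + \<phi>))
    = (cos (\<theta> - \<phi>) * exp (- (LINT r|lborel_pos. (g r - f r)\<^sup>2) / 2)
     + cos (\<theta> + \<phi>) * exp (- (LINT r|lborel_pos. (g r + f r)\<^sup>2) / 2)) / 2"
proof -
  have L: "(\<lambda>r. g r - f r) \<in> L2 lborel_pos" "(\<lambda>r. g r + f r) \<in> L2 lborel_pos"
    using f g by (auto intro: L2_diff L2_add)
  note m[measurable] = wiener_measurable[OF f] wiener_measurable[OF g] wiener_measurable[OF L(1)] wiener_measurable[OF L(2)]
  have "(LINT w|P. cos (wiener g w + \<theta>) * cos (wiener f w + \<phi>))
    = (LINT w|P. (cos (wiener (\<lambda>r. g r - f r) w + (\<theta> - \<phi>)) + cos (wiener (\<lambda>r. g r + f r) w + (\<theta> + \<phi>))) / 2)"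
  proof (rule integral_cong_AE)
    have "AE w in P. wiener (\<lambda>r. g r - f r) w = wiener g w - wiener f w"
      using wiener_lincomb[OF g f, of 1 "-1"] by simp
    moreover have "AE w in P. wiener (\<lambda>r. g r + f r) w = wiener g w + wiener f w"
      using wiener_lincomb[OF g f, of 1 1] by simp
    ultimately show "AE w in P. cos (wiener g w + \<theta>) * cos (wiener f w + \<phi>)
      = (cos (wiener (\<lambda>r. g r - f r) w + (\<theta> - \<phi>)) + cos (wiener (\<lambda>r. g r + f r) w + (\<theta> + \<phi>))) / 2"
    proof eventually_elim
      fix w assume e: "wiener (\<lambda>r. g r - f r) w = wiener g w - wiener f w" "wiener (\<lambda>r. g r + f r) w = wiener g w + wiener f w"
      have "wiener g w - wiener f w + (\<theta> - \<phi>) = (wiener g w + \<theta>) - (wiener f w + \<phi>)"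
        "wiener g w + wiener f w + (\<theta> + \<phi>) = (wiener g w + \<theta>) + (wiener f w + \<phi>)" by simp_all
      then show "cos (wiener g w + \<theta>) * cos (wiener f w + \<phi>)
        = (cos (wiener (\<lambda>r. g r - f r) w + (\<theta> - \<phi>)) + cos (wiener (\<lambda>r. g r + f r) w + (\<theta> + \<phi>))) / 2"
        unfolding e by (simp only: cos_times_cos)
    qed
  qed auto
  also have "\<dots> = ((LINT w|P. cos (wiener (\<lambda>r. g r - f r) w + (\<theta> - \<phi>))) + (LINT w|P. cos (wiener (\<lambda>r. g r + f r) w + (\<theta> + \<phi>)))) / 2"
  proof -
    have "integrable P (\<lambda>w. cos (wiener (\<lambda>r. g r - f r) w + (\<theta> - \<phi>)))"
      "integrable P (\<lambda>w. cos (wiener (\<lambda>r. g r + f r) w + (\<theta> + \<phi>)))" by (rule integrable_cos; measurable)+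
    then show ?thesis by simp
  qed
  finally show ?thesis unfolding wiener_cos[OF L(1)] wiener_cos[OF L(2)] .
qed

text \<open>
  Orthogonal integrands have independent integrals. Under the weight \<open>cos (wiener g + \<theta>)\<close> the variable
  \<open>wiener f\<close> has the same cosine transform as under the constant weight with the same mean.
\<close>

lemma wiener_orthogonal_independent:
  assumes f: "f \<in> L2 lborel_pos" and g: "g \<in> L2 lborel_pos" and orth: "(LINT r|lborel_pos. g r * f r) = 0"
    and [measurable]: "F \<in> borel_measurable borel" and F: "integrable P (\<lambda>w. F (wiener f w) :: real)"
  shows "(LINT w|P. cos (wiener g w + \<theta>) * F (wiener f w)) = (LINT w|P. cos (wiener g w + \<theta>)) * (LINT w|P. F (wiener f w))"
proof -
  define c where "c = (LINT w|P. cos (wiener g w + \<theta>))"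
  note m[measurable] = wiener_measurable[OF f] wiener_measurable[OF g]
  have c_eq: "c = cos \<theta> * exp (- (LINT r|lborel_pos. (g r)\<^sup>2) / 2)" unfolding c_def by (rule wiener_cos[OF g])
  have "\<bar>c\<bar> \<le> 1" unfolding c_eq abs_mult
    by (intro mult_le_one) auto
  have "(LINT w|P. cos (wiener g w + \<theta>) * F (wiener f w)) = (LINT w|P. c * F (wiener f w))"
  proof (rule integral_eq_of_weighted_cos[where X = "wiener f" and Y = "wiener f"])
    fix b \<phi>
    have bf: "(\<lambda>r. b * f r) \<in> L2 lborel_pos" using L2_cmult[OF f] .
    have "AE w in P. wiener (\<lambda>r. b * f r) w = b * wiener f w"
      using wiener_lincomb[OF f f, of b 0] by simp
    then have e: "AE w in P. cos (b * wiener f w + \<phi>) = cos (wiener (\<lambda>r. b * f r) w + \<phi>)"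
      by eventually_elim simp
    note [measurable] = wiener_measurable[OF bf]
    have nm: "(LINT r|lborel_pos. (g r - b * f r)\<^sup>2) = (LINT r|lborel_pos. (g r)\<^sup>2) + (LINT r|lborel_pos. (b * f r)\<^sup>2)"
      "(LINT r|lborel_pos. (g r + b * f r)\<^sup>2) = (LINT r|lborel_pos. (g r)\<^sup>2) + (LINT r|lborel_pos. (b * f r)\<^sup>2)"
      using L2_integral_lincomb_square[OF g f, of 1 "-b"] L2_integral_lincomb_square[OF g f, of 1 b] orth
      by (simp_all add: power_mult_distrib)
    have "(LINT w|P. cos (wiener g w + \<theta>) * cos (b * wiener f w + \<phi>))
      = (LINT w|P. cos (wiener g w + \<theta>) * cos (wiener (\<lambda>r. b * f r) w + \<phi>))"
      using e by (intro integral_cong_AE) (auto elim!: eventually_mono)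
    also have "\<dots> = c * (LINT w|P. cos (wiener (\<lambda>r. b * f r) w + \<phi>))"
      unfolding wiener_cos_cos[OF bf g] wiener_cos[OF bf] c_eq nm
      by (simp add: cos_add cos_diff exp_add[symmetric] add_divide_distrib[symmetric] field_simps exp_diff exp_minus exp_add)
    also have "(LINT w|P. cos (wiener (\<lambda>r. b * f r) w + \<phi>)) = (LINT w|P. cos (b * wiener f w + \<phi>))"
      using e by (intro integral_cong_AE) (auto elim!: eventually_mono)
    finally show "(LINT w|P. cos (wiener g w + \<theta>) * cos (b * wiener f w + \<phi>)) = (LINT w|P. c * cos (b * wiener f w + \<phi>))"
      by simp
  qed (use F \<open>\<bar>c\<bar> \<le> 1\<close> finite_measure_axioms in auto)
  then show ?thesis by (simp add: c_def)
qed

text \<open>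
  Both sides are compared on cosines of linear combinations \<open>wiener G\<close> of evaluations. Split \<open>G\<close> into
  a multiple \<open>c * f\<close> and a part \<open>Z\<close> orthogonal to \<open>f\<close>. The exponential weight does not affect
  \<open>wiener Z\<close> and shifts \<open>c * wiener f\<close> by the inner product \<open>\<kappa>\<close> of \<open>G\<close> and \<open>f\<close>, which is the same
  linear combination of the values of the shift \<open>K_op H f\<close>.
\<close>

theorem Cameron_Martin:
  assumes f: "f \<in> L2 lborel_pos"
  shows "distr P (path_borel {0..}) (\<lambda>w. \<lambda>t\<in>{0..}. w t + K_op H f t)
    = density P (\<lambda>w. ennreal (exp (wiener f w - (LINT r|lborel_pos. (f r)\<^sup>2) / 2)))"
proof (rule path_measure_eqI_cos[OF time_set_halfline])
  define s where "s = (LINT r|lborel_pos. (f r)\<^sup>2)"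
  let ?h = "K_op H f"
  note [measurable] = wiener_measurable[OF f]
  have ev: "(\<lambda>w. w t) \<in> borel_measurable P" if "t \<ge> 0" for t using that by (rule evaluation_P)
  have hp: "?h \<in> path_space {0..}" by (rule K_op_path[OF H f])
  have shift[measurable]: "(\<lambda>w. \<lambda>t\<in>{0..}. w t + ?h t) \<in> P \<rightarrow>\<^sub>M path_borel {0..}"
    by (rule path_shift_measurable[OF identity_P hp])
  show "finite_measure (distr P (path_borel {0..}) (\<lambda>w. \<lambda>t\<in>{0..}. w t + ?h t))"
    by (rule finite_measure_distr[OF shift])
  have ie: "integrable P (\<lambda>w. exp (wiener f w - s / 2))" by (rule wiener_tilt(1)[OF f s_def])
  show "finite_measure (density P (\<lambda>w. ennreal (exp (wiener f w - (LINT r|lborel_pos. (f r)\<^sup>2) / 2))))"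
    unfolding s_def[symmetric]
  proof (rule finite_measureI)
    let ?g = "\<lambda>w. ennreal (exp (wiener f w - s / 2))"
    have "emeasure (density P ?g) (space P) = (\<integral>\<^sup>+w. ?g w * indicator (space P) w \<partial>P)"
      by (rule emeasure_density) (auto simp del: space_P)
    also have "\<dots> = (\<integral>\<^sup>+w. ?g w \<partial>P)" by (intro nn_integral_cong) simp
    also have "\<dots> = ennreal (LINT w|P. exp (wiener f w - s / 2))"
      using ie by (rule nn_integral_eq_integral) simp
    finally show "emeasure (density P ?g) (space (density P ?g)) \<noteq> \<infinity>" by simp
  qed
  fix J a \<theta> assume J: "finite J" "J \<subseteq> {0::real..}"
  define G where "G = kernel_comb H J a"
  define \<kappa> where "\<kappa> = (\<Sum>t\<in>J. a t * ?h t)"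
  have G: "G \<in> L2 lborel_pos" unfolding G_def by (rule kernel_comb_L2[OF H J(2)])
  have Gf: "(LINT r|lborel_pos. G r * f r) = \<kappa>"
  proof -
    have "(LINT r|lborel_pos. G r * f r) = (LINT r|lborel_pos. (\<Sum>t\<in>J. a t * (K_kernel H t r * f r)))"
      unfolding G_def kernel_comb_def by (simp add: sum_distrib_right mult.assoc)
    also have "\<dots> = (\<Sum>t\<in>J. (LINT r|lborel_pos. a t * (K_kernel H t r * f r)))"
      using J by (intro Bochner_Integration.integral_sum integrable_mult_right L2_mult_integrable K_kernel_L2[OF H] f) auto
    also have "\<dots> = \<kappa>" unfolding \<kappa>_def using J by (intro sum.cong) (auto simp: K_op_eq_inner)
    finally show ?thesis .
  qed
  \<comment> \<open>If \<open>s = 0\<close>, then \<open>f\<close> vanishes almost everywhere and so does \<open>\<kappa>\<close>; either way \<open>c * s = \<kappa>\<close>.\<close>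
  define c where "c = (if s = 0 then 0 else \<kappa> / s)"
  have s0: "\<kappa> = 0" if "s = 0"
  proof -
    have "\<kappa>\<^sup>2 \<le> (LINT r|lborel_pos. (G r)\<^sup>2) * s" unfolding Gf[symmetric] s_def by (rule L2_Cauchy_Schwarz[OF G f])
    then show ?thesis using that by simp
  qed
  have cs: "c * s = \<kappa>" using s0 by (simp add: c_def)
  define Z where "Z r = G r - c * f r" for r
  have Z: "Z \<in> L2 lborel_pos" unfolding Z_def[abs_def] by (intro L2_diff G L2_cmult f)
  have Zf: "(LINT r|lborel_pos. Z r * f r) = 0"
  proof -
    have "(LINT r|lborel_pos. Z r * f r) = (LINT r|lborel_pos. G r * f r - c * (f r)\<^sup>2)"
      by (simp add: Z_def power2_eq_square algebra_simps)
    also have "\<dots> = \<kappa> - c * s"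
      using L2_mult_integrable[OF G f] f by (simp add: Gf s_def L2_def)
    finally show ?thesis using cs by simp
  qed
  note [measurable] = wiener_measurable[OF G] wiener_measurable[OF Z]
  have split: "AE w in P. wiener G w = wiener Z w + c * wiener f w"
  proof -
    have "(\<lambda>r. 1 * Z r + c * f r) = G" by (simp add: Z_def fun_eq_iff)
    then show ?thesis using wiener_lincomb[OF Z f, of 1 c] by simp
  qed
  have lin: "AE w in P. wiener G w = (\<Sum>t\<in>J. a t * w t)" unfolding G_def by (rule wiener_kernel_comb[OF J])
  have linm: "(\<lambda>w. \<Sum>t\<in>J. a t * w t) \<in> borel_measurable P"
    using J ev by (intro borel_measurable_sum borel_measurable_times) auto
  have linm': "(\<lambda>w. \<Sum>t\<in>J. a t * w t) \<in> borel_measurable (path_borel {0..})"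
    using J by (intro borel_measurable_sum borel_measurable_times evaluation_measurable) auto
  define e where "e x = exp (x - s / 2)" for x :: real
  have [measurable]: "e \<in> borel_measurable borel" unfolding e_def[abs_def] by measurable
  have ice: "integrable P (\<lambda>w. cos (c * wiener f w) * e (wiener f w))"
    "integrable P (\<lambda>w. sin (c * wiener f w) * e (wiener f w))"
    by (rule Bochner_Integration.integrable_bound[OF ie]; auto simp: e_def abs_mult mult_left_le_one_le)+
  have bnd: "integrable P (\<lambda>w. cos (wiener Z w + \<psi>) * F w)" if "integrable P F" for F \<psi>
    by (rule Bochner_Integration.integrable_bound[OF that]) (use that in \<open>auto simp: abs_mult mult_left_le_one_le\<close>)
  have "(LINT w|P. cos (wiener G w + \<theta>) * e (wiener f w)) = (LINT w|P.
      cos (wiener Z w + \<theta>) * (cos (c * wiener f w) * e (wiener f w))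
      - cos (wiener Z w + (\<theta> - pi/2)) * (sin (c * wiener f w) * e (wiener f w)))"
  proof (rule integral_cong_AE)
    show "AE w in P. cos (wiener G w + \<theta>) * e (wiener f w) =
      cos (wiener Z w + \<theta>) * (cos (c * wiener f w) * e (wiener f w))
      - cos (wiener Z w + (\<theta> - pi/2)) * (sin (c * wiener f w) * e (wiener f w))"
      using split
    proof eventually_elim
      fix w assume w: "wiener G w = wiener Z w + c * wiener f w"
      have "cos (wiener Z w + c * wiener f w + \<theta>) = cos ((wiener Z w + \<theta>) + c * wiener f w)" by (simp add: add_ac)
      also have "\<dots> = cos (wiener Z w + \<theta>) * cos (c * wiener f w) - sin (wiener Z w + \<theta>) * sin (c * wiener f w)"
        by (rule cos_add)
      also have "sin (wiener Z w + \<theta>) = cos (wiener Z w + (\<theta> - pi/2))"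
        unfolding add_diff_eq by (simp only: cos_diff) simp
      finally have E: "cos (wiener Z w + c * wiener f w + \<theta>) = cos (wiener Z w + \<theta>) * cos (c * wiener f w)
          - cos (wiener Z w + (\<theta> - pi/2)) * sin (c * wiener f w)" .
      show "cos (wiener G w + \<theta>) * e (wiener f w) =
        cos (wiener Z w + \<theta>) * (cos (c * wiener f w) * e (wiener f w))
        - cos (wiener Z w + (\<theta> - pi/2)) * (sin (c * wiener f w) * e (wiener f w))"
        unfolding w E by (simp only: left_diff_distrib mult.assoc)
    qed
  qed auto
  also have "\<dots> = (LINT w|P. cos (wiener Z w + \<theta>) * (cos (c * wiener f w) * e (wiener f w)))
      - (LINT w|P. cos (wiener Z w + (\<theta> - pi/2)) * (sin (c * wiener f w) * e (wiener f w)))"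
    by (intro Bochner_Integration.integral_diff bnd ice)
  also have "(LINT w|P. cos (wiener Z w + \<theta>) * (cos (c * wiener f w) * e (wiener f w)))
      = (LINT w|P. cos (wiener Z w + \<theta>)) * (LINT w|P. cos (c * wiener f w) * e (wiener f w))"
    by (rule wiener_orthogonal_independent[OF f Z Zf]) (use ice in auto)
  also have "(LINT w|P. cos (wiener Z w + (\<theta> - pi/2)) * (sin (c * wiener f w) * e (wiener f w)))
      = (LINT w|P. cos (wiener Z w + (\<theta> - pi/2))) * (LINT w|P. sin (c * wiener f w) * e (wiener f w))"
    by (rule wiener_orthogonal_independent[OF f Z Zf]) (use ice in auto)
  also have "(LINT w|P. cos (c * wiener f w) * e (wiener f w)) = (LINT w|P. cos (c * (wiener f w + s)))"
    unfolding e_def by (rule wiener_tilt(2)[OF f s_def]) simp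
  also have "(LINT w|P. sin (c * wiener f w) * e (wiener f w)) = (LINT w|P. sin (c * (wiener f w + s)))"
    unfolding e_def by (rule wiener_tilt(2)[OF f s_def]) simp
  also have "(LINT w|P. cos (c * (wiener f w + s))) = cos \<kappa> * exp (- (c\<^sup>2 * s) / 2)"
    using wiener_cos_scaled[OF f, of c \<kappa>] by (simp add: distrib_left cs s_def[symmetric])
  also have "(LINT w|P. sin (c * (wiener f w + s))) = sin \<kappa> * exp (- (c\<^sup>2 * s) / 2)"
  proof -
    have "sin (c * (x + s)) = cos (c * x + (\<kappa> - pi/2))" for x
      unfolding add_diff_eq distrib_left cs by (simp only: cos_diff) simp
    then show ?thesis
      using wiener_cos_scaled[OF f, of c "\<kappa> - pi/2"] by (simp add: s_def[symmetric] cos_diff)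
  qed
  also have "(LINT w|P. cos (wiener Z w + \<theta>)) = cos \<theta> * exp (- (LINT r|lborel_pos. (Z r)\<^sup>2) / 2)"
    by (rule wiener_cos[OF Z])
  also have "(LINT w|P. cos (wiener Z w + (\<theta> - pi/2))) = sin \<theta> * exp (- (LINT r|lborel_pos. (Z r)\<^sup>2) / 2)"
    unfolding wiener_cos[OF Z] by (simp add: cos_diff)
  also have "cos \<theta> * exp (- (LINT r|lborel_pos. (Z r)\<^sup>2) / 2) * (cos \<kappa> * exp (- (c\<^sup>2 * s) / 2))
      - sin \<theta> * exp (- (LINT r|lborel_pos. (Z r)\<^sup>2) / 2) * (sin \<kappa> * exp (- (c\<^sup>2 * s) / 2))
      = cos (\<kappa> + \<theta>) * exp (- (LINT r|lborel_pos. (G r)\<^sup>2) / 2)"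
  proof -
    have "(LINT r|lborel_pos. (G r)\<^sup>2) = (LINT r|lborel_pos. (1 * Z r + c * f r)\<^sup>2)" by (simp add: Z_def)
    also have "\<dots> = (LINT r|lborel_pos. (Z r)\<^sup>2) + c\<^sup>2 * s"
      unfolding L2_integral_lincomb_square[OF Z f] by (simp add: Zf s_def)
    finally have "exp (- (LINT r|lborel_pos. (G r)\<^sup>2) / 2)
        = exp (- (LINT r|lborel_pos. (Z r)\<^sup>2) / 2) * exp (- (c\<^sup>2 * s) / 2)"
      by (simp add: exp_add[symmetric] add_divide_distrib)
    then show ?thesis by (simp add: cos_add algebra_simps)
  qed
  also have "\<dots> = (LINT w|P. cos (wiener G w + (\<kappa> + \<theta>)))" by (rule wiener_cos[OF G, symmetric])
  finally have key: "(LINT w|P. cos (wiener G w + \<theta>) * e (wiener f w)) = (LINT w|P. cos (wiener G w + (\<kappa> + \<theta>)))" .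
  have "(LINT w|distr P (path_borel {0..}) (\<lambda>w. \<lambda>t\<in>{0..}. w t + ?h t). cos ((\<Sum>t\<in>J. a t * w t) + \<theta>))
      = (LINT w|P. cos ((\<Sum>t\<in>J. a t * (\<lambda>t\<in>{0..}. w t + ?h t) t) + \<theta>))"
    using linm' by (subst integral_distr[OF shift]) auto
  also have "\<dots> = (LINT w|P. cos ((\<Sum>t\<in>J. a t * w t) + (\<kappa> + \<theta>)))"
  proof (rule Bochner_Integration.integral_cong[OF refl])
    fix w
    have "(\<Sum>t\<in>J. a t * (\<lambda>t\<in>{0..}. w t + ?h t) t) = (\<Sum>t\<in>J. a t * w t + a t * ?h t)"
      using J by (intro sum.cong) (auto simp: algebra_simps)
    also have "\<dots> = (\<Sum>t\<in>J. a t * w t) + \<kappa>" unfolding \<kappa>_def by (rule sum.distrib)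
    finally show "cos ((\<Sum>t\<in>J. a t * (\<lambda>t\<in>{0..}. w t + ?h t) t) + \<theta>) = cos ((\<Sum>t\<in>J. a t * w t) + (\<kappa> + \<theta>))"
      by (simp add: add.assoc)
  qed
  also have "\<dots> = (LINT w|P. cos (wiener G w + (\<kappa> + \<theta>)))"
    by (rule integral_cong_AE) (use lin linm in \<open>auto elim!: eventually_mono\<close>)
  also have "\<dots> = (LINT w|P. cos ((\<Sum>t\<in>J. a t * w t) + \<theta>) * e (wiener f w))"
    unfolding key[symmetric]
    by (rule integral_cong_AE) (use lin linm in \<open>auto elim!: eventually_mono\<close>)
  also have "\<dots> = (LINT w|density P (\<lambda>w. ennreal (exp (wiener f w - (LINT r|lborel_pos. (f r)\<^sup>2) / 2))). cos ((\<Sum>t\<in>J. a t * w t) + \<theta>))"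
    using linm by (subst integral_density) (auto simp: e_def s_def mult.commute)
  finally show "(LINT w|distr P (path_borel {0..}) (\<lambda>w. \<lambda>t\<in>{0..}. w t + ?h t). cos ((\<Sum>t\<in>J. a t * w t) + \<theta>))
      = (LINT w|density P (\<lambda>w. ennreal (exp (wiener f w - (LINT r|lborel_pos. (f r)\<^sup>2) / 2))). cos ((\<Sum>t\<in>J. a t * w t) + \<theta>))" .
qed (auto simp: sets_P)

end

section \<open>Mean cosine of increments\<close>

text \<open>
  For \<open>H > 1/2\<close> the kernel increases with time. Therefore increments of the process over disjoint
  intervals are nonnegatively correlated.
\<close>

lemma K_kernel_mono:
  assumes H: "1/2 < H" "H < 1" and st: "0 \<le> s" "s \<le> t"
  shows "K_kernel H s r \<le> K_kernel H t r"
proof -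
  have "ennreal (K_kernel H s r) \<le> ennreal (K_kernel H t r)"
    using st unfolding ennreal_K_kernel[OF H st(1)] ennreal_K_kernel[OF H order_trans[OF st]]
    by (intro mult_left_mono nn_integral_mono ennreal_leI) (auto simp: kernel_density_def indicator_def)
  then show ?thesis using K_kernel_nonneg[OF H] by simp
qed

text \<open>
  The left-hand side is \<open>exp (- v) * (cosh x - 1)\<close>, the covariance of \<open>cos \<xi>\<close> and \<open>cos \<eta>\<close> for jointly normal
  \<open>\<xi>\<close>, \<open>\<eta>\<close> of variance \<open>v\<close> and covariance \<open>x\<close>. The bound is convexity of \<open>exp\<close> on \<open>[- v, 0]\<close>.
\<close>

lemma cosh_defect_le:
  fixes x v :: real
  assumes "0 < v" "0 \<le> x" "x \<le> v"
  shows "(exp (- (v - x)) + exp (- (v + x))) / 2 - exp (- v) \<le> x / v"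
proof -
  define l where "l = x / v"
  have l: "0 \<le> l" "l \<le> 1" and x: "x = l * v" using assms by (auto simp: l_def)
  have "exp (- (v + x)) \<le> exp (- (v - x))" using assms by simp
  have "exp ((1 - l) * (- v) + l * 0) \<le> (1 - l) * exp (- v) + l * exp 0"
    using convex_onD[OF exp_convex, of l "- v" 0] l by simp
  moreover have "(1 - l) * (- v) + l * 0 = - (v - x)" by (simp add: x algebra_simps)
  ultimately have "exp (- (v - x)) \<le> (1 - l) * exp (- v) + l" by simp
  moreover have "(E + e) / 2 - V \<le> R - V" if "e \<le> E" "E \<le> R" for e E R V :: real using that by simp
  ultimately have "(exp (- (v - x)) + exp (- (v + x))) / 2 - exp (- v) \<le> (1 - l) * exp (- v) + l - exp (- v)"
    using \<open>exp (- (v + x)) \<le> exp (- (v - x))\<close> by blast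
  also have "\<dots> = l * (1 - exp (- v))" by (simp add: algebra_simps)
  also have "\<dots> \<le> l" using l by (intro mult_left_le) auto
  finally show ?thesis by (simp add: l_def)
qed

lemma integral_double_sum:
  fixes F :: "'i \<Rightarrow> 'j \<Rightarrow> 'a \<Rightarrow> real"
  assumes "\<And>i j. i \<in> A \<Longrightarrow> j \<in> B \<Longrightarrow> integrable M (F i j)"
  shows "(LINT x|M. (\<Sum>i\<in>A. \<Sum>j\<in>B. F i j x)) = (\<Sum>i\<in>A. \<Sum>j\<in>B. LINT x|M. F i j x)"
proof -
  have "(LINT x|M. (\<Sum>i\<in>A. \<Sum>j\<in>B. F i j x)) = (\<Sum>i\<in>A. LINT x|M. (\<Sum>j\<in>B. F i j x))"
    using assms by (intro Bochner_Integration.integral_sum Bochner_Integration.integrable_sum)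
  also have "\<dots> = (\<Sum>i\<in>A. \<Sum>j\<in>B. LINT x|M. F i j x)"
    using assms by (intro sum.cong refl Bochner_Integration.integral_sum)
  finally show ?thesis .
qed

context wiener_isometry begin

text \<open>
  A law of large numbers for nonnegatively correlated normal variables of variance \<open>v\<close>: the covariance
  of the cosines is at most the correlation of the variables, so the variance of the mean of the
  cosines is controlled by the second moment of the sum of the variables.
\<close>

lemma mean_cos_variance:
  assumes f: "\<And>i. i < n \<Longrightarrow> f i \<in> L2 lborel_pos" and n: "0 < n" and v: "0 < v"
    and norm: "\<And>i. i < n \<Longrightarrow> (LINT r|lborel_pos. (f i r)\<^sup>2) = v"
    and pos: "\<And>i j. i < n \<Longrightarrow> j < n \<Longrightarrow> 0 \<le> (LINT r|lborel_pos. f i r * f j r)"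
  shows "(LINT w|P. ((\<Sum>i<n. cos (wiener (f i) w)) / real n - exp (- v / 2))\<^sup>2)
    \<le> (LINT r|lborel_pos. (\<Sum>i<n. f i r)\<^sup>2) / (v * (real n)\<^sup>2)"
proof -
  define m where "m = exp (- v / 2)"
  have mm: "m * m = exp (- v)" by (simp add: m_def exp_add[symmetric])
  define X where "X i w = cos (wiener (f i) w) - m" for i w
  define x where "x i j = (LINT r|lborel_pos. f i r * f j r)" for i j
  note meas = wiener_measurable[OF f]
  have ic: "integrable P (\<lambda>w. cos (wiener (f i) w))" if "i < n" for i
    by (rule integrable_cos) (rule meas[OF that])
  have icc: "integrable P (\<lambda>w. cos (wiener (f i) w) * cos (wiener (f j) w))" if "i < n" "j < n" for i j
    using meas[OF that(1)] meas[OF that(2)]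
    by (intro integrable_const_bound[of _ 1]) (auto simp: abs_mult intro!: mult_le_one)
  have XX: "X i w * X j w = cos (wiener (f i) w) * cos (wiener (f j) w) - m * cos (wiener (f i) w) - m * cos (wiener (f j) w) + m * m" for i j w
    by (simp add: X_def algebra_simps)
  have iXX: "integrable P (\<lambda>w. X i w * X j w)" if "i < n" "j < n" for i j
    unfolding XX using ic[OF that(1)] ic[OF that(2)] icc[OF that] by simp
  have EXX: "(LINT w|P. X i w * X j w) \<le> x i j / v" if ij: "i < n" "j < n" for i j
  proof -
    have sq: "(LINT r|lborel_pos. (f i r - f j r)\<^sup>2) = 2 * (v - x i j)" "(LINT r|lborel_pos. (f i r + f j r)\<^sup>2) = 2 * (v + x i j)"
      using L2_integral_lincomb_square[OF f[OF ij(1)] f[OF ij(2)], of 1 "-1"]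
        L2_integral_lincomb_square[OF f[OF ij(1)] f[OF ij(2)], of 1 1] norm[OF ij(1)] norm[OF ij(2)]
      by (simp_all add: x_def algebra_simps)
    have "0 \<le> (LINT r|lborel_pos. (f i r - f j r)\<^sup>2)" by simp
    then have "x i j \<le> v" unfolding sq by simp
    have E: "(LINT w|P. cos (wiener (f k) w)) = m" if "k < n" for k
      using wiener_cos[OF f[OF that], of 0] norm[OF that] by (simp add: m_def)
    have "(LINT w|P. cos (wiener (f i) w) * cos (wiener (f j) w)) = (exp (- (v - x i j)) + exp (- (v + x i j))) / 2"
    proof -
      have "- (LINT r|lborel_pos. (f i r - f j r)\<^sup>2) / 2 = - (v - x i j)"
        "- (LINT r|lborel_pos. (f i r + f j r)\<^sup>2) / 2 = - (v + x i j)"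
        unfolding sq by simp_all
      with wiener_cos_cos[OF f[OF ij(2)] f[OF ij(1)], of 0 0] show ?thesis by (simp only: add_0_right cos_zero diff_zero mult_1_left)
    qed
    then have "(LINT w|P. X i w * X j w) = (exp (- (v - x i j)) + exp (- (v + x i j))) / 2 - exp (- v)"
      unfolding XX using ic[OF ij(1)] ic[OF ij(2)] icc[OF ij] E[OF ij(1)] E[OF ij(2)] mm prob_space by simp
    also have "\<dots> \<le> x i j / v" using pos[OF ij] v \<open>x i j \<le> v\<close> by (intro cosh_defect_le) (auto simp: x_def)
    finally show ?thesis .
  qed
  have "((\<Sum>i<n. cos (wiener (f i) w)) / real n - m)\<^sup>2 = (\<Sum>i<n. \<Sum>j<n. X i w * X j w) / (real n)\<^sup>2" for w
  proof -
    have "(\<Sum>i<n. cos (wiener (f i) w)) / real n - m = (\<Sum>i<n. X i w) / real n"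
      using n by (simp add: X_def sum_subtractf field_simps)
    then show ?thesis by (simp add: power_divide power2_eq_square sum_product)
  qed
  then have "(LINT w|P. ((\<Sum>i<n. cos (wiener (f i) w)) / real n - m)\<^sup>2) = (\<Sum>i<n. \<Sum>j<n. LINT w|P. X i w * X j w) / (real n)\<^sup>2"
    using iXX integral_double_sum[of "{..<n}" "{..<n}" P "\<lambda>i j w. X i w * X j w"] by simp
  also have "\<dots> \<le> (\<Sum>i<n. \<Sum>j<n. x i j / v) / (real n)\<^sup>2"
    by (intro divide_right_mono sum_mono EXX) auto
  also have "\<dots> = (\<Sum>i<n. \<Sum>j<n. x i j) / (v * (real n)\<^sup>2)"
    by (simp add: sum_divide_distrib[symmetric])
  also have "(\<Sum>i<n. \<Sum>j<n. x i j) = (LINT r|lborel_pos. (\<Sum>i<n. f i r)\<^sup>2)"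
  proof -
    have "(LINT r|lborel_pos. (\<Sum>i<n. f i r)\<^sup>2) = (LINT r|lborel_pos. (\<Sum>i<n. \<Sum>j<n. f i r * f j r))"
      by (simp add: power2_eq_square sum_product)
    also have "\<dots> = (\<Sum>i<n. \<Sum>j<n. x i j)"
      unfolding x_def by (rule integral_double_sum) (auto intro!: L2_mult_integrable f)
    finally show ?thesis ..
  qed
  finally show ?thesis by (simp add: m_def)
qed

end

text \<open>
  A statistic of a path on \<open>[0,T]\<close>. The increments are rescaled so that they are standard normal when
  the path is a fractional Brownian motion.
\<close>

definition mean_cos_increments :: "real \<Rightarrow> real \<Rightarrow> nat \<Rightarrow> (real \<Rightarrow> real) \<Rightarrow> real" where
  "mean_cos_increments H T n x =
    (\<Sum>i<n. cos ((real n / T) powr H * (x (T * real (Suc i) / real n) - x (T * real i / real n)))) / real n"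

context wiener_isometry begin

text \<open>
  The increments of the path \<open>t \<mapsto> w (t * c)\<close> over the grid add up to the single value \<open>w (T * c)\<close>. In the
  rescaled form their sum has variance \<open>n powr (2 * H)\<close> times the common variance \<open>c powr (2 * H)\<close>,
  which is \<open>o(n\<^sup>2)\<close> because \<open>H < 1\<close>. The bound is uniform in \<open>c\<close>.
\<close>

lemma mean_cos_increments_variance:
  assumes T: "0 < T" and n: "0 < n" and c: "0 < c"
  shows "(LINT w|P. (mean_cos_increments H T n (\<lambda>t. w (t * c)) - exp (- (c powr (2*H)) / 2))\<^sup>2) \<le> real n powr (2*H - 2)"
proof -
  define \<tau> where "\<tau> = c powr (2*H)"
  have \<tau>: "\<tau> > 0" using c by (simp add: \<tau>_def)
  define p where "p i = T * real i / real n * c" for i :: nat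
  define k where "k = (real n / T) powr H"
  have k: "k \<ge> 0" by (simp add: k_def)
  have p0: "0 \<le> p i" for i using T c by (simp add: p_def)
  have pmono: "p i \<le> p (Suc i)" for i using T c n by (simp add: p_def divide_right_mono)
  define f where "f i r = k * (K_kernel H (p (Suc i)) r - K_kernel H (p i) r)" for i r
  have KL: "K_kernel H (p i) \<in> L2 lborel_pos" for i by (rule K_kernel_L2[OF H p0])
  have fL: "f i \<in> L2 lborel_pos" for i unfolding f_def[abs_def] by (intro L2_cmult L2_diff KL)
  \<comment> \<open>Nonnegative integrands have nonnegative inner products.\<close>
  have f0: "0 \<le> f i r" for i r unfolding f_def using K_kernel_mono[OF H p0 pmono] k by simp
  have k2: "k\<^sup>2 * (c * T / real n) powr (2*H) = \<tau>"
  proof -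
    have "k\<^sup>2 = (real n / T) powr (2*H)" by (simp add: k_def power2_eq_square powr_add[symmetric])
    moreover have "(real n / T) powr (2*H) * (c * T / real n) powr (2*H) = (real n / T * (c * T / real n)) powr (2*H)"
      by (rule powr_mult[symmetric])
    ultimately show ?thesis using T n by (simp add: \<tau>_def)
  qed
  have pe: "p i = (c * T / real n) * real i" for i by (simp add: p_def)
  have cT: "0 \<le> c * T / real n" using c T by simp
  have norm: "(LINT r|lborel_pos. (f i r)\<^sup>2) = \<tau>" for i
  proof -
    have "(LINT r|lborel_pos. (f i r)\<^sup>2) = k\<^sup>2 * (LINT r|lborel_pos. (1 * K_kernel H (p (Suc i)) r + (-1) * K_kernel H (p i) r)\<^sup>2)"
      by (simp add: f_def power_mult_distrib)
    also have "\<dots> = k\<^sup>2 * (R_cov H (p (Suc i)) (p (Suc i)) - 2 * R_cov H (p (Suc i)) (p i) + R_cov H (p i) (p i))"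
      unfolding L2_integral_lincomb_square[OF KL KL] using kernel_covariance[OF H p0 p0] by (simp add: power2_eq_square)
    also have "\<dots> = k\<^sup>2 * ((p (Suc i) - p i) powr (2*H))" 
      unfolding R_cov_increment using pmono[of i] by simp
    also have "p (Suc i) - p i = c * T / real n" by (simp add: pe algebra_simps diff_divide_distrib[symmetric])
    finally show ?thesis using k2 by simp
  qed
  \<comment> \<open>The kernel at time 0 is zero, so the sum of the increments telescopes to one kernel.\<close>
  have tele: "(\<Sum>i<n. f i r) = k * K_kernel H (p n) r" for r
  proof -
    have "K_kernel H (p 0) r = 0" by (rule K_kernel_support) (simp add: p_def)
    then show ?thesis
      unfolding f_def sum_distrib_left[symmetric]
      using sum_lessThan_telescope[of "\<lambda>i. K_kernel H (p i) r" n] by simp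
  qed
  have ntotal: "(LINT r|lborel_pos. (\<Sum>i<n. f i r)\<^sup>2) = \<tau> * real n powr (2*H)"
  proof -
    have "(LINT r|lborel_pos. (\<Sum>i<n. f i r)\<^sup>2) = k\<^sup>2 * (LINT r|lborel_pos. K_kernel H (p n) r * K_kernel H (p n) r)"
      unfolding tele by (simp add: power2_eq_square mult_ac)
    also have "\<dots> = k\<^sup>2 * (p n) powr (2*H)" unfolding kernel_covariance[OF H p0 p0] by (simp add: R_cov_def)
    also have "(p n) powr (2*H) = (c * T / real n) powr (2*H) * real n powr (2*H)"
      unfolding pe by (rule powr_mult)
    finally show ?thesis using k2 by (simp add: mult.assoc[symmetric])
  qed
  have W: "AE w in P. \<forall>i<n. wiener (f i) w = k * (w (p (Suc i)) - w (p i))"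
  proof -
    have "AE w in P. wiener (f i) w = k * (w (p (Suc i)) - w (p i))" for i
    proof -
      have "(\<lambda>r. k * K_kernel H (p (Suc i)) r + (- k) * K_kernel H (p i) r) = f i" by (simp add: f_def fun_eq_iff algebra_simps)
      then have "AE w in P. wiener (f i) w = k * wiener (K_kernel H (p (Suc i))) w + (- k) * wiener (K_kernel H (p i)) w"
        using wiener_lincomb[OF KL KL, of k "Suc i" "- k" i] by simp
      then show ?thesis using wiener_kernel[OF p0[of i]] wiener_kernel[OF p0[of "Suc i"]]
        by eventually_elim (simp add: algebra_simps)
    qed
    then show ?thesis by (auto simp: AE_all_countable)
  qed
  have mc: "mean_cos_increments H T n (\<lambda>t. w (t * c)) = (\<Sum>i<n. cos (k * (w (p (Suc i)) - w (p i)))) / real n" for w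
    by (simp add: mean_cos_increments_def p_def k_def)
  have mw: "(\<lambda>w. w (p i)) \<in> borel_measurable P" for i by (rule evaluation_P[OF p0])
  have "(LINT w|P. (mean_cos_increments H T n (\<lambda>t. w (t * c)) - exp (- \<tau> / 2))\<^sup>2)
    = (LINT w|P. ((\<Sum>i<n. cos (wiener (f i) w)) / real n - exp (- \<tau> / 2))\<^sup>2)"
  proof (rule integral_cong_AE)
    show "AE w in P. (mean_cos_increments H T n (\<lambda>t. w (t * c)) - exp (- \<tau> / 2))\<^sup>2
       = ((\<Sum>i<n. cos (wiener (f i) w)) / real n - exp (- \<tau> / 2))\<^sup>2"
      using W by eventually_elim (simp add: mc)
    show "(\<lambda>w. (mean_cos_increments H T n (\<lambda>t. w (t * c)) - exp (- \<tau> / 2))\<^sup>2) \<in> borel_measurable P"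
      unfolding mc using mw by measurable
    show "(\<lambda>w. ((\<Sum>i<n. cos (wiener (f i) w)) / real n - exp (- \<tau> / 2))\<^sup>2) \<in> borel_measurable P"
      using wiener_measurable[OF fL] by measurable
  qed
  also have "\<dots> \<le> (LINT r|lborel_pos. (\<Sum>i<n. f i r)\<^sup>2) / (\<tau> * (real n)\<^sup>2)"
    by (rule mean_cos_variance[OF fL n \<tau> norm]) (use f0 in \<open>auto intro!: Bochner_Integration.integral_nonneg\<close>)
  also have "\<dots> = real n powr (2*H - 2)"
    unfolding ntotal using \<tau> n by (simp add: powr_diff)
  finally show ?thesis by (simp add: \<tau>_def)
qed

end

lemma mean_cos_increments_bound: "\<bar>mean_cos_increments H T n x\<bar> \<le> 1"
proof -
  have "\<bar>\<Sum>i<n. cos (g i)\<bar> \<le> real n * 1" for g :: "nat \<Rightarrow> real"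
  proof -
    have "\<bar>\<Sum>i<n. cos (g i)\<bar> \<le> (\<Sum>i<n. \<bar>cos (g i)\<bar>)" by (rule sum_abs)
    also have "\<dots> \<le> real (card {..<n}) * 1" by (rule sum_bounded_above) simp
    finally show ?thesis by simp
  qed
  then show ?thesis unfolding mean_cos_increments_def abs_divide by (cases "n = 0") (simp_all add: divide_le_eq)
qed

section \<open>Laws under a random time change\<close>

text \<open>
  A density on the probability space yields a density of the laws as soon as it factors through the
  observed variable \<open>X\<close>.
\<close>

lemma equivalent_of_factored_density:
  fixes D :: "'a \<Rightarrow> real" and g :: "'b \<Rightarrow> real"
  assumes Q: "prob_space Q" and [measurable]: "X \<in> Q \<rightarrow>\<^sub>M N" "X' \<in> Q \<rightarrow>\<^sub>M N"
      "D \<in> borel_measurable Q" "g \<in> borel_measurable N"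
    and D: "\<And>x. 0 < D x" and factor: "AE x in Q. D x = g (X x)"
    and change: "\<And>A. A \<in> sets N \<Longrightarrow> emeasure Q (X' -` A \<inter> space Q) = (\<integral>\<^sup>+x. ennreal (D x) * indicator A (X x) \<partial>Q)"
  shows "equivalent_measures (distr Q N X') (distr Q N X)"
    and "AE x in Q. RN_deriv (distr Q N X) (distr Q N X') (X x) = ennreal (D x)"
proof -
  interpret Q: prob_space Q by fact
  interpret X: prob_space "distr Q N X" by (rule Q.prob_space_distr) simp
  have eq: "density (distr Q N X) (\<lambda>y. ennreal (g y)) = distr Q N X'"
  proof (rule measure_eqI)
    fix A assume "A \<in> sets (density (distr Q N X) (\<lambda>y. ennreal (g y)))"
    then have [measurable]: "A \<in> sets N" by simp
    have "emeasure (density (distr Q N X) (\<lambda>y. ennreal (g y))) A = (\<integral>\<^sup>+x. ennreal (g (X x)) * indicator A (X x) \<partial>Q)"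
      by (simp add: emeasure_density nn_integral_distr)
    also have "\<dots> = (\<integral>\<^sup>+x. ennreal (D x) * indicator A (X x) \<partial>Q)"
      using factor by (intro nn_integral_cong_AE) (auto elim!: eventually_mono)
    finally show "emeasure (density (distr Q N X) (\<lambda>y. ennreal (g y))) A = emeasure (distr Q N X') A"
      by (simp add: emeasure_distr change)
  qed simp
  have "AE y in distr Q N X. ennreal (g y) = RN_deriv (distr Q N X) (distr Q N X') y"
    by (rule X.RN_deriv_unique[OF _ eq]) simp
  then have "AE x in Q. ennreal (g (X x)) = RN_deriv (distr Q N X) (distr Q N X') (X x)"
    by (rule AE_distrD[rotated]) simp
  then show "AE x in Q. RN_deriv (distr Q N X) (distr Q N X') (X x) = ennreal (D x)"
    using factor by eventually_elim simp
  have "absolutely_continuous (distr Q N X) (distr Q N X')"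
    unfolding eq[symmetric] by (rule absolutely_continuousI_density) simp
  moreover have "absolutely_continuous (distr Q N X') (distr Q N X)"
    unfolding absolutely_continuous_def
  proof
    fix A assume A: "A \<in> null_sets (distr Q N X')"
    then have [measurable]: "A \<in> sets N" by auto
    have "emeasure Q (X' -` A \<inter> space Q) = 0" using A by (auto simp: null_sets_def emeasure_distr)
    then have "AE x in Q. ennreal (D x) * indicator A (X x) = 0"
      unfolding change[OF \<open>A \<in> sets N\<close>] by (subst (asm) nn_integral_0_iff_AE) auto
    then have "AE x in Q. X x \<notin> A"
    proof eventually_elim
      fix x assume "ennreal (D x) * indicator A (X x) = 0"
      then show "X x \<notin> A" using D[of x] by (auto simp: ennreal_eq_0_iff)
    qed
    then have "emeasure Q (X -` A \<inter> space Q) = 0"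
      using emeasure_eq_0_AE[of "\<lambda>x. X x \<in> A" Q] by (simp add: vimage_def Int_def conj_commute)
    then show "A \<in> null_sets (distr Q N X)" by (auto simp: null_sets_def emeasure_distr)
  qed
  ultimately show "equivalent_measures (distr Q N X') (distr Q N X)"
    by (simp add: equivalent_measures_def)
qed

text \<open>
  The second factor carries the random time, independent of the path. Positivity of the time is what
  allows the time change to be undone.
\<close>

locale random_time_change = wiener_isometry P H \<delta> + Y: prob_space Y
  for P H \<delta> and Y :: "real measure" +
  assumes sets_Y [measurable_cong]: "sets Y = sets lborel_pos"
    and positive_time: "AE \<tau> in Y. 0 < \<tau>"
begin

sublocale pair: pair_prob_space P Y ..

abbreviation "Q \<equiv> P \<Otimes>\<^sub>M Y"

definition scale :: "real \<Rightarrow> real" where "scale \<tau> = \<tau> powr (1 / (2 * H))"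

definition path_on :: "real set \<Rightarrow> (real \<Rightarrow> real) \<times> real \<Rightarrow> (real \<Rightarrow> real)" where
  "path_on I z = (\<lambda>t\<in>I. fst z (t * scale (snd z)))"

lemma space_Y: "space Y = {0..}"
  using sets_eq_imp_space_eq[OF sets_Y] by (simp add: space_restrict_space)

lemma space_Q: "space Q = path_space {0..} \<times> {0..}"
  by (simp add: space_pair_measure space_Y)

lemma scale_nonneg [simp]: "0 \<le> scale \<tau>" by (simp add: scale_def)

lemma scale_pos: "0 < \<tau> \<Longrightarrow> 0 < scale \<tau>" by (simp add: scale_def)

lemma scale_powr: "0 < \<tau> \<Longrightarrow> scale \<tau> powr (2*H) = \<tau>"
  using H by (simp add: scale_def powr_powr)

lemma borel_lborel_pos: "f \<in> borel_measurable borel \<Longrightarrow> f \<in> borel_measurable Y"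
  unfolding measurable_cong_sets[OF sets_Y refl] by (rule measurable_restrict_space1) simp

lemma scale_measurable [measurable]: "scale \<in> borel_measurable Y"
  unfolding scale_def[abs_def] by (rule borel_lborel_pos) measurable

lemma scale_measurable_borel [measurable]: "scale \<in> borel_measurable borel"
  unfolding scale_def[abs_def] by measurable

lemma time_measurable [measurable]: "(\<lambda>\<tau>. \<tau>) \<in> borel_measurable Y"
  by (rule borel_lborel_pos) simp

lemma fst_path [measurable]: "fst \<in> Q \<rightarrow>\<^sub>M path_borel {0..}"
proof -
  have "fst \<in> Q \<rightarrow>\<^sub>M P" by measurable
  then show ?thesis by (simp add: measurable_cong_sets[OF refl sets_P])
qed

lemma snd_time [measurable]: "snd \<in> borel_measurable Q"
  using measurable_compose[OF measurable_snd time_measurable] by simp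

lemma path_on_measurable:
  assumes I: "time_set I"
  shows "path_on I \<in> Q \<rightarrow>\<^sub>M path_borel I"
proof (rule measurable_path_borelI[OF I])
  fix z assume "z \<in> space Q"
  then have "fst z \<in> path_space {0..}" by (auto simp: space_Q)
  then show "path_on I z \<in> path_space I"
    unfolding path_on_def using time_set_nonneg[OF I]
    by (intro path_rescale[OF I time_set_halfline] continuous_intros) auto
next
  fix t assume t: "t \<in> I"
  have "(\<lambda>z. fst z (t * scale (snd z))) \<in> borel_measurable Q"
    by (rule jointly_measurable_evaluation[OF time_set_halfline fst_path])
      (use time_set_nonneg[OF I t] in auto)
  then show "(\<lambda>z. path_on I z t) \<in> borel_measurable Q" using t by (simp add: path_on_def)
qed

lemma AE_fst:
  assumes "AE w in P. R w" shows "AE z in Q. R (fst z)"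
proof -
  have "distr Q P fst = P" by (rule Y.distr_pair_fst)
  then have "AE w in distr Q P fst. R w" using assms by (simp only:)
  from AE_distrD[OF measurable_fst this] show ?thesis .
qed

lemma AE_positive_time: "AE z in Q. 0 < snd z"
proof (rule pair.AE_pair_measure)
  have "{z \<in> space Q. 0 < snd z} = snd -` {0<..} \<inter> space Q" by auto
  also have "\<dots> \<in> sets Q" by (rule measurable_sets[OF snd_time]) simp
  finally show "{z \<in> space Q. 0 < snd z} \<in> sets Q" .
  show "AE w in P. AE \<tau> in Y. 0 < snd (w, \<tau>)" using positive_time by simp
qed

lemma nn_integral_Q: "f \<in> borel_measurable Q \<Longrightarrow> (\<integral>\<^sup>+z. f z \<partial>Q) = (\<integral>\<^sup>+\<tau>. \<integral>\<^sup>+w. f (w, \<tau>) \<partial>P \<partial>Y)"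
  by (rule pair.nn_integral_snd[symmetric])

lemma grid_point_in_time_set:
  assumes I: "time_set I" "T \<in> I" "0 < T" and i: "i \<le> n" "0 < n"
  shows "T * real i / real n \<in> I"
proof (rule time_set_downward[OF I(1,2)])
  show "0 \<le> T * real i / real n" using I(3) by simp
  have "T * real i \<le> T * real n" using I(3) i by (intro mult_left_mono) auto
  then show "T * real i / real n \<le> T" using i by (simp add: pos_divide_le_eq)
qed

lemma mean_cos_increments_path_measurable:
  assumes I: "time_set I" "T \<in> I" "0 < T"
  shows "mean_cos_increments H T n \<in> borel_measurable (path_borel I)"
proof (cases "n = 0")
  case False
  have ev: "(\<lambda>x. x (T * real i / real n)) \<in> borel_measurable (path_borel I)" if "i \<le> n" for i
    using False that by (intro evaluation_measurable grid_point_in_time_set[OF I]) auto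
  have c: "(\<lambda>x. cos ((real n / T) powr H * (x (T * real (Suc i) / real n) - x (T * real i / real n))))
      \<in> borel_measurable (path_borel I)" if "i < n" for i
  proof -
    have [measurable]: "(\<lambda>x. x (T * real (Suc i) / real n)) \<in> borel_measurable (path_borel I)"
      "(\<lambda>x. x (T * real i / real n)) \<in> borel_measurable (path_borel I)"
      using ev[of "Suc i"] ev[of i] that by auto
    show ?thesis by measurable
  qed
  show ?thesis unfolding mean_cos_increments_def[abs_def]
    by (intro borel_measurable_divide borel_measurable_sum borel_measurable_const c) simp
qed (simp add: mean_cos_increments_def[abs_def])

text \<open>
  For fixed \<open>\<tau>\<close> the statistic \<open>mean_cos_increments\<close> of the time-changed path tends to \<open>exp (- \<tau> / 2)\<close>
  in \<open>L\<^sup>2\<close>, uniformly in \<open>\<tau>\<close>. So it converges in \<open>L\<^sup>2\<close> on the product space and almost surely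
  along a subsequence, and the random time is a measurable function of the observed path.
\<close>

lemma random_time_recovered:
  assumes I: "time_set I" "T \<in> I" "0 < T"
  obtains V where "V \<in> borel_measurable (path_borel I)" "AE z in Q. V (path_on I z) = snd z"
proof -
  define F where "F n = mean_cos_increments H T (Suc n)" for n
  have F[measurable]: "F n \<in> borel_measurable (path_borel I)" for n
    unfolding F_def by (rule mean_cos_increments_path_measurable[OF I])
  note [measurable] = path_on_measurable[OF I(1)]
  have FI: "F n (path_on I (w, \<tau>)) = mean_cos_increments H T (Suc n) (\<lambda>t. w (t * scale \<tau>))" for n w \<tau>
  proof -
    have "T * real i / real (Suc n) \<in> I" if "i \<le> Suc n" for i
      by (rule grid_point_in_time_set[OF I that]) simp
    then show ?thesis unfolding F_def mean_cos_increments_def path_on_def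
      by (intro arg_cong2[where f = "(/)"] sum.cong refl) (auto simp del: of_nat_Suc)
  qed
  define u where "u n z = (F n (path_on I z) - exp (- (snd z) / 2))\<^sup>2" for n z
  have um[measurable]: "u n \<in> borel_measurable Q" for n unfolding u_def[abs_def] by measurable
  have bound: "(\<integral>\<^sup>+z. ennreal (u n z) \<partial>Q) \<le> ennreal (real (Suc n) powr (2*H - 2))" for n
  proof -
    have "(\<integral>\<^sup>+z. ennreal (u n z) \<partial>Q) = (\<integral>\<^sup>+\<tau>. \<integral>\<^sup>+w. ennreal (u n (w, \<tau>)) \<partial>P \<partial>Y)"
      by (rule nn_integral_Q) measurable
    also have "\<dots> \<le> (\<integral>\<^sup>+\<tau>. ennreal (real (Suc n) powr (2*H - 2)) \<partial>Y)"
    proof (rule nn_integral_mono_AE, use positive_time AE_space in eventually_elim)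
      fix \<tau> assume \<tau>: "0 < \<tau>" "\<tau> \<in> space Y"
      have m: "(\<lambda>w. u n (w, \<tau>)) \<in> borel_measurable P" using \<tau>(2) by measurable
      have ub: "norm (u n (w, \<tau>)) \<le> 4" for w
      proof -
        have "\<bar>F n (path_on I (w, \<tau>))\<bar> \<le> 1"
          unfolding F_def by (rule mean_cos_increments_bound)
        moreover have "0 \<le> exp (- \<tau> / 2)" "exp (- \<tau> / 2) \<le> 1" using \<tau> by auto
        ultimately have "\<bar>F n (path_on I (w, \<tau>)) - exp (- \<tau> / 2)\<bar> \<le> 2" by linarith
        then have "(F n (path_on I (w, \<tau>)) - exp (- \<tau> / 2))\<^sup>2 \<le> 2\<^sup>2" by (intro abs_le_square_iff[THEN iffD1]) simp
        then show ?thesis by (simp add: u_def)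
      qed
      have "(\<integral>\<^sup>+w. ennreal (u n (w, \<tau>)) \<partial>P) = ennreal (LINT w|P. u n (w, \<tau>))"
        using m ub by (intro nn_integral_eq_integral integrable_const_bound[of _ 4]) (auto simp: u_def)
      also have "(LINT w|P. u n (w, \<tau>)) \<le> real (Suc n) powr (2*H - 2)"
        using mean_cos_increments_variance[OF I(3) _ scale_pos[OF \<tau>(1)], of "Suc n"]
        by (simp add: u_def FI scale_powr[OF \<tau>(1)] del: of_nat_Suc)
      finally show "(\<integral>\<^sup>+w. ennreal (u n (w, \<tau>)) \<partial>P) \<le> ennreal (real (Suc n) powr (2*H - 2))"
        by (simp add: ennreal_leI)
    qed
    also have "\<dots> = ennreal (real (Suc n) powr (2*H - 2))" by (simp add: Y.emeasure_space_1)
    finally show ?thesis .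
  qed
  have ui: "integrable Q (u n)" for n
    using bound[of n] by (intro integrableI_bounded um) (auto simp: u_def le_less_trans[OF _ ennreal_less_top])
  have "(\<lambda>n. LINT z|Q. norm (u n z)) \<longlonglongrightarrow> 0"
  proof (rule tendsto_sandwich[of "\<lambda>_. 0" _ _ "\<lambda>n. real (Suc n) powr (2*H - 2)"])
    have "(LINT z|Q. norm (u n z)) \<le> real (Suc n) powr (2*H - 2)" for n
    proof -
      have "ennreal (LINT z|Q. u n z) = (\<integral>\<^sup>+z. ennreal (u n z) \<partial>Q)"
        by (rule nn_integral_eq_integral[symmetric, OF ui]) (simp add: u_def)
      then have "ennreal (LINT z|Q. u n z) \<le> ennreal (real (Suc n) powr (2*H - 2))" using bound[of n] by simp
      then show ?thesis by (simp add: u_def del: of_nat_Suc)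
    qed
    then show "\<forall>\<^sub>F n in sequentially. (LINT z|Q. norm (u n z)) \<le> real (Suc n) powr (2*H - 2)" by simp
    show "(\<lambda>n. real (Suc n) powr (2*H - 2)) \<longlonglongrightarrow> 0"
      using H by (intro LIMSEQ_Suc[of "\<lambda>n. real n powr (2*H - 2)"] tendsto_neg_powr filterlim_real_sequentially) auto
  qed auto
  from tendsto_L1_AE_subseq[of Q u, OF ui this] obtain k :: "nat \<Rightarrow> nat"
    where ae: "AE z in Q. (\<lambda>n. u (k n) z) \<longlonglongrightarrow> 0" by blast
  \<comment> \<open>This inverts \<open>\<tau> \<mapsto> exp (- \<tau> / 2)\<close>.\<close>
  define V where "V x = - 2 * ln (lim (\<lambda>n. F (k n) x))" for x
  have "V \<in> borel_measurable (path_borel I)" unfolding V_def[abs_def] by measurable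
  moreover have "AE z in Q. V (path_on I z) = snd z"
    using ae
  proof eventually_elim
    fix z assume "(\<lambda>n. u (k n) z) \<longlonglongrightarrow> 0"
    then have "(\<lambda>n. sqrt (u (k n) z)) \<longlonglongrightarrow> sqrt 0" by (rule tendsto_real_sqrt)
    then have "(\<lambda>n. F (k n) (path_on I z) - exp (- (snd z) / 2)) \<longlonglongrightarrow> 0"
      by (simp add: u_def tendsto_rabs_zero_iff)
    then have "lim (\<lambda>n. F (k n) (path_on I z)) = exp (- (snd z) / 2)" by (intro limI) (rule LIM_zero_cancel)
    then show "V (path_on I z) = snd z" by (simp add: V_def)
  qed
  ultimately show thesis by (rule that)
qed

text \<open>
  The Cameron--Martin theorem for each fixed value of the random time, integrated over that value.
  The integrand \<open>f \<tau>\<close> may depend on \<open>\<tau>\<close>, since on a bounded horizon the shift matters only up to the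
  time that the path has reached.
\<close>

lemma shifted_law:
  fixes D :: "(real \<Rightarrow> real) \<times> real \<Rightarrow> real"
  assumes I: "time_set I" and X': "X' \<in> Q \<rightarrow>\<^sub>M path_borel I" and [measurable]: "D \<in> borel_measurable Q"
    and f: "\<And>\<tau>. 0 \<le> \<tau> \<Longrightarrow> f \<tau> \<in> L2 lborel_pos"
    and shift: "\<And>w \<tau>. w \<in> path_space {0..} \<Longrightarrow> 0 \<le> \<tau> \<Longrightarrow> X' (w, \<tau>) = path_on I (\<lambda>t\<in>{0..}. w t + K_op H (f \<tau>) t, \<tau>)"
    and D: "\<And>\<tau>. 0 \<le> \<tau> \<Longrightarrow> AE w in P. D (w, \<tau>) = exp (wiener (f \<tau>) w - (LINT r|lborel_pos. (f \<tau> r)\<^sup>2) / 2)"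
    and A: "A \<in> sets (path_borel I)"
  shows "emeasure Q (X' -` A \<inter> space Q) = (\<integral>\<^sup>+z. ennreal (D z) * indicator A (path_on I z) \<partial>Q)"
proof -
  note [measurable] = path_on_measurable[OF I] X' A
  have "emeasure Q (X' -` A \<inter> space Q) = (\<integral>\<^sup>+z. indicator A (X' z) \<partial>Q)"
  proof -
    have "(\<integral>\<^sup>+z. indicator A (X' z) \<partial>Q) = (\<integral>\<^sup>+z. indicator (X' -` A \<inter> space Q) z \<partial>Q)"
      by (intro nn_integral_cong) (auto simp: indicator_def)
    also have "\<dots> = emeasure Q (X' -` A \<inter> space Q)" by (rule nn_integral_indicator) measurable
    finally show ?thesis ..
  qed
  also have "\<dots> = (\<integral>\<^sup>+\<tau>. \<integral>\<^sup>+w. indicator A (X' (w, \<tau>)) \<partial>P \<partial>Y)" by (rule nn_integral_Q) measurable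
  also have "\<dots> = (\<integral>\<^sup>+\<tau>. \<integral>\<^sup>+w. ennreal (D (w, \<tau>)) * indicator A (path_on I (w, \<tau>)) \<partial>P \<partial>Y)"
  proof (rule nn_integral_cong)
    fix \<tau> assume \<tau>Y[measurable]: "\<tau> \<in> space Y"
    then have \<tau>: "0 \<le> \<tau>" by (simp add: space_Y)
    let ?h = "K_op H (f \<tau>)"
    let ?e = "\<lambda>w. ennreal (exp (wiener (f \<tau>) w - (LINT r|lborel_pos. (f \<tau> r)\<^sup>2) / 2))"
    have s[measurable]: "(\<lambda>w. \<lambda>t\<in>{0..}. w t + ?h t) \<in> P \<rightarrow>\<^sub>M path_borel {0..}"
      by (rule path_shift_measurable[OF identity_P K_op_path[OF H f[OF \<tau>]]])
    have "(\<lambda>w. (w, \<tau>)) \<in> P \<rightarrow>\<^sub>M Q" by measurable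
    then have p: "(\<lambda>w. indicator A (path_on I (w, \<tau>)) :: ennreal) \<in> borel_measurable P" by measurable
    then have p': "(\<lambda>w. indicator A (path_on I (w, \<tau>)) :: ennreal) \<in> borel_measurable (path_borel {0..})"
      by (simp add: measurable_cong_sets[OF sets_P refl])
    note [measurable] = wiener_measurable[OF f[OF \<tau>]]
    have "(\<integral>\<^sup>+w. indicator A (X' (w, \<tau>)) \<partial>P) = (\<integral>\<^sup>+w. indicator A (path_on I (\<lambda>t\<in>{0..}. w t + ?h t, \<tau>)) \<partial>P)"
      using \<tau> by (intro nn_integral_cong) (simp add: shift)
    also have "\<dots> = (\<integral>\<^sup>+w. indicator A (path_on I (w, \<tau>)) \<partial>distr P (path_borel {0..}) (\<lambda>w. \<lambda>t\<in>{0..}. w t + ?h t))"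
      using p' by (subst nn_integral_distr[OF s]) auto
    also have "\<dots> = (\<integral>\<^sup>+w. ?e w * indicator A (path_on I (w, \<tau>)) \<partial>P)"
      unfolding Cameron_Martin[OF f[OF \<tau>]] using p by (subst nn_integral_density) auto
    also have "\<dots> = (\<integral>\<^sup>+w. ennreal (D (w, \<tau>)) * indicator A (path_on I (w, \<tau>)) \<partial>P)"
      using D[OF \<tau>] by (intro nn_integral_cong_AE) (auto elim!: eventually_mono)
    finally show "(\<integral>\<^sup>+w. indicator A (X' (w, \<tau>)) \<partial>P) = (\<integral>\<^sup>+w. ennreal (D (w, \<tau>)) * indicator A (path_on I (w, \<tau>)) \<partial>P)" .
  qed
  also have "\<dots> = (\<integral>\<^sup>+z. ennreal (D z) * indicator A (path_on I z) \<partial>Q)" by (rule nn_integral_Q[symmetric]) measurable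
  finally show ?thesis .
qed

end

section \<open>The integral process\<close>

lemma indicator_L2: "indicator {0..t::real} \<in> L2 lborel_pos"
proof -
  have "integrable lborel (\<lambda>r. indicator {0..} r *\<^sub>R (indicator {0..t} r :: real)\<^sup>2)"
  proof (rule integrable_mult_indicator)
    have "(\<lambda>r. (indicator {0..t} r :: real)\<^sup>2) = indicator {0..t}" by (auto simp: indicator_def)
    moreover have "integrable lborel (indicator {0..t} :: real \<Rightarrow> real)"
      by (rule integrable_real_indicator) (simp_all add: emeasure_lborel_Icc_eq)
    ultimately show "integrable lborel (\<lambda>r. (indicator {0..t} r :: real)\<^sup>2)" by simp
  qed simp
  moreover have "indicator {0..t} \<in> borel_measurable lborel_pos"
    by (rule measurable_restrict_space1) simp
  ultimately show ?thesis by (simp add: L2_def integrable_restrict_space)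
qed

context wiener_isometry begin

text \<open>
  An increment of the underlying Brownian motion is the Wiener integral of the indicator of a
  half-open interval, here written as a difference of indicators of \<open>[0,t]\<close>.
\<close>

lemma step_integral_eq_wiener:
  assumes B: "is_underlying_bm H P \<delta> B" and p: "0 \<le> p 0" "mono p"
  shows "step_fun n p a \<in> L2 lborel_pos"
    and "AE w in P. step_integral B n p a w = wiener (step_fun n p a) w"
    and "step_integral B n p a \<in> borel_measurable P"
proof -
  have p0: "0 \<le> p i" for i using p monoD[OF p(2), of 0 i] by simp
  have pS: "p i \<le> p (Suc i)" for i using p(2) by (simp add: monoD)
  define d where "d i r = indicator {0..p (Suc i)} r - (indicator {0..p i} r :: real)" for i r
  have dL: "d i \<in> L2 lborel_pos" for i unfolding d_def[abs_def] by (intro L2_diff indicator_L2)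
  have "indicator {p i<..p (Suc i)} r = d i r" for i r
    using p0[of i] pS[of i] by (auto simp: d_def indicator_def)
  then have eq: "step_fun n p a = (\<lambda>r. \<Sum>i<n. a i * d i r)" by (simp add: step_fun_def fun_eq_iff)
  show "step_fun n p a \<in> L2 lborel_pos" unfolding eq using dL by (intro L2_sum)
  have BW: "AE w in P. B t w = wiener (indicator {0..t}) w" if "0 \<le> t" for t
    using B that by (simp add: is_underlying_bm_def wiener_def)
  have "AE w in P. \<forall>i. wiener (d i) w = B (p (Suc i)) w - B (p i) w"
    unfolding AE_all_countable
  proof
    fix i
    have "AE w in P. wiener (d i) w = wiener (indicator {0..p (Suc i)}) w - wiener (indicator {0..p i}) w"
      using wiener_lincomb[OF indicator_L2 indicator_L2, of 1 "p (Suc i)" "-1" "p i"] by (simp add: d_def[abs_def])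
    with BW[OF p0[of i]] BW[OF p0[of "Suc i"]]
    show "AE w in P. wiener (d i) w = B (p (Suc i)) w - B (p i) w" by eventually_elim simp
  qed
  moreover have "AE w in P. wiener (\<lambda>r. \<Sum>i<n. a i * d i r) w = (\<Sum>i<n. a i * wiener (d i) w)"
    using dL by (intro wiener_sum) auto
  ultimately show "AE w in P. step_integral B n p a w = wiener (step_fun n p a) w"
    unfolding eq by eventually_elim (simp add: step_integral_def)
  have "B (p i) \<in> borel_measurable P" for i using B p0 by (simp add: is_underlying_bm_def)
  then show "step_integral B n p a \<in> borel_measurable P"
    unfolding step_integral_def[abs_def] by (intro borel_measurable_sum borel_measurable_times borel_measurable_diff) auto
qed

lemma wiener_integral_eq:
  assumes B: "is_underlying_bm H P \<delta> B" and X: "has_wiener_integral P B f X"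
  shows "AE w in P. X w = wiener f w"
proof -
  have f: "f \<in> L2 lborel_pos" and XL: "X \<in> L2 P" using X by (auto simp: has_wiener_integral_def)
  obtain n p a where p: "\<And>k. 0 \<le> p k 0" "\<And>k. mono (p k)"
    and l1: "(\<lambda>k. \<integral>\<^sup>+ s. ennreal ((step_fun (n k) (p k) (a k) s - f s)\<^sup>2) \<partial>lborel_pos) \<longlonglongrightarrow> 0"
    and l2: "(\<lambda>k. \<integral>\<^sup>+ w. ennreal ((step_integral B (n k) (p k) (a k) w - X w)\<^sup>2) \<partial>P) \<longlonglongrightarrow> 0"
    using X unfolding has_wiener_integral_def by blast
  define S where "S k = step_fun (n k) (p k) (a k)" for k
  define SI where "SI k = step_integral B (n k) (p k) (a k)" for k
  have st: "S k \<in> L2 lborel_pos" "AE w in P. SI k w = wiener (S k) w" "SI k \<in> borel_measurable P" for k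
    unfolding S_def SI_def by (rule step_integral_eq_wiener[OF B p])+
  have st_sym: "AE w in P. wiener (S k) w = SI k w" for k using st(2)[of k] by eventually_elim simp
  have SL: "SI k \<in> L2 P" for k by (rule L2_cong_AE[OF wiener_L2[OF st(1)] st(3) st_sym])
  have to_real: "(\<lambda>k. LINT x|M. (S k x - T x)\<^sup>2) \<longlonglongrightarrow> 0"
    if "\<And>k. S k \<in> L2 M" "T \<in> L2 M" "(\<lambda>k. \<integral>\<^sup>+ x. ennreal ((S k x - T x)\<^sup>2) \<partial>M) \<longlonglongrightarrow> 0" for S T and M :: "'m measure"
    using that(3) unfolding nn_integral_square_L2[OF L2_diff[OF that(1,2)]]
    by (subst (asm) tendsto_ennreal_iff[of _ _ 0, simplified]) auto
  have "(\<lambda>k. LINT s|lborel_pos. (S k s - f s)\<^sup>2) \<longlonglongrightarrow> 0"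
    by (rule to_real[OF st(1) f]) (use l1 in \<open>simp add: S_def\<close>)
  then have "(\<lambda>k. LINT w|P. (wiener (S k) w - wiener f w)\<^sup>2) \<longlonglongrightarrow> 0"
    by (rule wiener_tendsto[OF st(1) f])
  moreover have "(LINT w|P. (wiener (S k) w - wiener f w)\<^sup>2) = (LINT w|P. (SI k w - wiener f w)\<^sup>2)" for k
  proof (rule integral_cong_AE)
    show "AE w in P. (wiener (S k) w - wiener f w)\<^sup>2 = (SI k w - wiener f w)\<^sup>2"
      using st_sym[of k] by eventually_elim simp
  qed (use st(3)[of k] wiener_measurable[OF st(1)[of k]] wiener_measurable[OF f] in measurable)
  ultimately have lim: "(\<lambda>k. LINT w|P. (SI k w - wiener f w)\<^sup>2) \<longlonglongrightarrow> 0" by simp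
  have "(\<lambda>k. LINT w|P. (SI k w - X w)\<^sup>2) \<longlonglongrightarrow> 0"
    by (rule to_real[OF SL XL]) (use l2 in \<open>simp add: SI_def\<close>)
  from L2_limits_agree[OF SL XL wiener_L2[OF f] this lim] show ?thesis .
qed

text \<open>
  Each single integral up to a time \<open>q\<close> is a functional of the path up to \<open>q\<close>. To obtain one functional
  that is jointly measurable in path and time, these functionals are used only at grid times below
  \<open>t\<close>, and continuity of the integral process identifies the limit for all \<open>t\<close> simultaneously.
\<close>

lemma integral_process_functional:
  assumes B: "is_underlying_bm H P \<delta> B" and Z: "is_integral_process P B f Z"
  obtains L :: "(real \<Rightarrow> real) \<Rightarrow> real \<Rightarrow> real" where
    "(\<lambda>(w, t). L w t) \<in> borel_measurable (path_borel {0..} \<Otimes>\<^sub>M borel)"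
    "\<And>w v t. 0 \<le> t \<Longrightarrow> (\<And>s. s \<in> {0..t} \<Longrightarrow> w s = v s) \<Longrightarrow> L w t = L v t"
    "AE w in P. \<forall>t\<ge>0. L w t = Z (ennreal t) w"
proof -
  define trunc where "trunc q s = f s * indicator {s. ennreal s \<le> ennreal q} s" for q s :: real
  have ZW: "has_wiener_integral P B (trunc q) (Z (ennreal q))" for q
    using Z by (simp add: is_integral_process_def trunc_def[abs_def])
  have "\<exists>G. G \<in> borel_measurable (path_borel {0..}) \<and> (0 \<le> q \<longrightarrow>
      (\<forall>w v. (\<forall>t\<in>{0..q}. w t = v t) \<longrightarrow> G w = G v) \<and> (AE w in P. Z (ennreal q) w = G w))" for q
  proof (cases "0 \<le> q")
    case True
    have tL: "trunc q \<in> L2 lborel_pos" using ZW[of q] by (simp add: has_wiener_integral_def)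
    have supp: "trunc q r = 0" if "r \<ge> 0" "r \<notin> {0..q}" for r
      using that True by (auto simp: trunc_def indicator_def ennreal_le_iff2)
    obtain G where G: "G \<in> borel_measurable (path_borel {0..})"
      "\<forall>w v. (\<forall>t\<in>{0..q}. w t = v t) \<longrightarrow> G w = G v" "AE w in P. wiener (trunc q) w = G w"
      by (rule wiener_adapted[OF time_set_interval[OF True] tL supp])
    have "AE w in P. Z (ennreal q) w = G w"
      using wiener_integral_eq[OF B ZW[of q]] G(3) by eventually_elim simp
    then show ?thesis using G(1,2) by blast
  next
    case False
    then show ?thesis by (intro exI[of _ "\<lambda>_. 0"]) simp
  qed
  then obtain G where G: "\<And>q. G q \<in> borel_measurable (path_borel {0..}) \<and> (0 \<le> q \<longrightarrow>
      (\<forall>w v. (\<forall>t\<in>{0..q}. w t = v t) \<longrightarrow> G q w = G q v) \<and> (AE w in P. Z (ennreal q) w = G q w))"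
    by (rule that[OF someI_ex])
  then have Gm: "\<And>q. G q \<in> borel_measurable (path_borel {0..})"
    and Gl: "\<And>q w v. 0 \<le> q \<Longrightarrow> (\<forall>t\<in>{0..q}. w t = v t) \<Longrightarrow> G q w = G q v"
    and GZ: "\<And>q. 0 \<le> q \<Longrightarrow> AE w in P. Z (ennreal q) w = G q w" by blast+
  \<comment> \<open>Grid times below \<open>t\<close>, so that only the path up to \<open>t\<close> enters.\<close>
  define L where "L w t = lim (\<lambda>m. G (grid_below (Suc m) t) w)" for w t
  have Lm: "(\<lambda>(w, t). L w t) \<in> borel_measurable (path_borel {0..} \<Otimes>\<^sub>M borel)"
    (is "_ \<in> borel_measurable ?M")
  proof -
    have "(\<lambda>z. G (grid_below (Suc m) (snd z)) (fst z)) \<in> borel_measurable ?M" for m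
      unfolding grid_below_def
    proof (rule measurable_compose_countable[where f = "\<lambda>i z. G (real_of_int i / real (Suc m)) (fst z)"
          and g = "\<lambda>z. \<lfloor>real (Suc m) * snd z\<rfloor>"])
      show "(\<lambda>z. G (real_of_int i / real (Suc m)) (fst z)) \<in> borel_measurable ?M" for i
        by (rule measurable_compose[OF measurable_fst Gm])
      show "(\<lambda>z. \<lfloor>real (Suc m) * snd z\<rfloor>) \<in> ?M \<rightarrow>\<^sub>M count_space UNIV" by measurable
    qed
    then show ?thesis unfolding L_def case_prod_beta by (rule borel_measurable_lim_metric)
  qed
  have Ll: "L w t = L v t" if "0 \<le> t" "\<And>s. s \<in> {0..t} \<Longrightarrow> w s = v s" for w v t
  proof -
    have "G (grid_below (Suc m) t) w = G (grid_below (Suc m) t) v" for m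
      using that grid_below_le[of "Suc m" t] grid_below_nonneg[OF that(1), of "Suc m"] by (intro Gl) auto
    then show ?thesis by (simp add: L_def)
  qed
  have "AE w in P. \<forall>m::nat. \<forall>i::nat. Z (ennreal (real i / real (Suc m))) w = G (real i / real (Suc m)) w"
    unfolding AE_all_countable using GZ by simp
  moreover have "AE w in P. continuous_on UNIV (\<lambda>t. Z t w)" using Z by (simp add: is_integral_process_def)
  ultimately have LZ: "AE w in P. \<forall>t\<ge>0. L w t = Z (ennreal t) w"
  proof eventually_elim
    fix w assume G: "\<forall>m::nat. \<forall>i::nat. Z (ennreal (real i / real (Suc m))) w = G (real i / real (Suc m)) w"
      and c: "continuous_on UNIV (\<lambda>t. Z t w)"
    show "\<forall>t\<ge>0. L w t = Z (ennreal t) w"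
    proof (intro allI impI)
      fix t :: real assume t: "0 \<le> t"
      have "grid_below (Suc m) t = real (nat \<lfloor>real (Suc m) * t\<rfloor>) / real (Suc m)" for m
        using t by (simp add: grid_below_def)
      then have eq: "G (grid_below (Suc m) t) w = Z (ennreal (grid_below (Suc m) t)) w" for m
        using G by (simp only:)
      have "(\<lambda>m. ennreal (grid_below (Suc m) t)) \<longlonglongrightarrow> ennreal t"
        by (intro tendsto_ennrealI grid_below_tendsto)
      then have "(\<lambda>m. Z (ennreal (grid_below (Suc m) t)) w) \<longlonglongrightarrow> Z (ennreal t) w"
        using c by (intro continuous_on_tendsto_compose[of UNIV "\<lambda>t. Z t w"]) auto
      then show "L w t = Z (ennreal t) w" unfolding L_def eq by (rule limI)
    qed
  qed
  show thesis by (rule that[OF Lm Ll LZ])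
qed

end

section \<open>Densities of the shifted laws\<close>

context random_time_change begin

definition shifted_path_on :: "(real \<Rightarrow> real) \<Rightarrow> real set \<Rightarrow> (real \<Rightarrow> real) \<times> real \<Rightarrow> (real \<Rightarrow> real)" where
  "shifted_path_on h I z = (\<lambda>t\<in>I. fst z (t * scale (snd z)) + h (t * scale (snd z)))"

lemma shifted_path_on_eq:
  assumes "time_set I"
  shows "shifted_path_on h I (w, \<tau>) = path_on I (\<lambda>t\<in>{0..}. w t + h t, \<tau>)"
  unfolding shifted_path_on_def path_on_def
  by (rule restrict_ext) (use time_set_nonneg[OF assms] in simp)

lemma shifted_path_on_measurable:
  assumes I: "time_set I" and h: "h \<in> path_space {0..}"
  shows "shifted_path_on h I \<in> Q \<rightarrow>\<^sub>M path_borel I"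
proof -
  have s: "(\<lambda>z. \<lambda>t\<in>{0..}. fst z t + h t) \<in> Q \<rightarrow>\<^sub>M path_borel {0..}"
    by (rule path_shift_measurable[OF fst_path h])
  show ?thesis
  proof (rule measurable_path_borelI[OF I])
    fix z assume z: "z \<in> space Q"
    obtain w \<tau> where zw: "z = (w, \<tau>)" by (cases z)
    have "(\<lambda>t\<in>{0..}. w t + h t) \<in> path_space {0..}" "0 \<le> \<tau>"
      using measurable_space[OF s z] z by (auto simp: zw space_Q)
    then have "path_on I (\<lambda>t\<in>{0..}. w t + h t, \<tau>) \<in> path_space I"
      using measurable_space[OF path_on_measurable[OF I], of "(\<lambda>t\<in>{0..}. w t + h t, \<tau>)"] by (simp add: space_Q)
    then show "shifted_path_on h I z \<in> path_space I" by (simp add: zw shifted_path_on_eq[OF I])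
  next
    fix t assume t: "t \<in> I"
    have "(\<lambda>z. (\<lambda>t\<in>{0..}. fst z t + h t) (t * scale (snd z))) \<in> borel_measurable Q"
      by (rule jointly_measurable_evaluation[OF time_set_halfline s]) (use time_set_nonneg[OF I t] in auto)
    then show "(\<lambda>z. shifted_path_on h I z t) \<in> borel_measurable Q"
      using t time_set_nonneg[OF I t] by (simp add: shifted_path_on_def)
  qed
qed

text \<open>
  Undoing the time change with the recovered random time: \<open>g\<close> will be multiplication by the inverse
  scale, truncated at \<open>T\<close> on a bounded horizon.
\<close>

lemma unscaled_path_measurable:
  assumes J: "time_set J" and [measurable]: "V \<in> borel_measurable (path_borel J)"
    and g: "\<And>a. 0 \<le> a \<Longrightarrow> continuous_on {0..} (g a)" "\<And>a u. 0 \<le> a \<Longrightarrow> 0 \<le> u \<Longrightarrow> g a u \<in> J" "\<And>a. g a 0 = 0"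
    and gm: "\<And>u. 0 \<le> u \<Longrightarrow> (\<lambda>a. g a u) \<in> borel_measurable borel"
  shows "(\<lambda>x. \<lambda>u\<in>{0..}. x (g (inverse (scale (V x))) u)) \<in> path_borel J \<rightarrow>\<^sub>M path_borel {0..}"
proof (rule measurable_path_borelI[OF time_set_halfline])
  fix x assume "x \<in> space (path_borel J)"
  then show "(\<lambda>u\<in>{0..}. x (g (inverse (scale (V x))) u)) \<in> path_space {0..}"
    using g by (intro path_rescale[OF time_set_halfline J]) (auto simp: image_subset_iff)
next
  fix u :: real assume u: "u \<in> {0..}"
  have [measurable]: "(\<lambda>a. g a u) \<in> borel_measurable borel" using gm u by simp
  have "(\<lambda>x. x (g (inverse (scale (V x))) u)) \<in> borel_measurable (path_borel J)"
  proof (rule jointly_measurable_evaluation[OF J, of "\<lambda>x. x"])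
    show "(\<lambda>x. g (inverse (scale (V x))) u) \<in> borel_measurable (path_borel J)" by measurable
  qed (use g u in auto)
  then show "(\<lambda>x. (\<lambda>u\<in>{0..}. x (g (inverse (scale (V x))) u)) u) \<in> borel_measurable (path_borel J)"
    using u by simp
qed

text \<open>
  Once the random time is recovered, the whole path \<open>w\<close> is recovered from the observed path, so every
  random variable of \<open>w\<close> factors through the observation.
\<close>

theorem infinite_horizon_density:
  assumes f: "f \<in> L2 lborel_pos"
  defines "s \<equiv> (LINT r|lborel_pos. (f r)\<^sup>2)"
  shows "equivalent_measures (distr Q (path_borel {0..}) (shifted_path_on (K_op H f) {0..}))
      (distr Q (path_borel {0..}) (path_on {0..}))"
    and "AE z in Q. RN_deriv (distr Q (path_borel {0..}) (path_on {0..}))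
      (distr Q (path_borel {0..}) (shifted_path_on (K_op H f) {0..})) (path_on {0..} z)
      = ennreal (exp (wiener f (fst z) - s / 2))"
proof -
  note I = time_set_halfline
  obtain V where V[measurable]: "V \<in> borel_measurable (path_borel {0..})"
    and Vz: "AE z in Q. V (path_on {0..} z) = snd z"
    using random_time_recovered[OF I, of 1] by auto
  define \<Phi> where "\<Phi> x = (\<lambda>u\<in>{0..}. x ((\<lambda>a u. u * a) (inverse (scale (V x))) u))" for x
  have \<Phi>m: "\<Phi> \<in> path_borel {0..} \<rightarrow>\<^sub>M path_borel {0..}"
    unfolding \<Phi>_def[abs_def] by (rule unscaled_path_measurable[OF I V]) (auto intro!: continuous_intros)
  have wm: "wiener f \<in> borel_measurable (path_borel {0..})"
    using wiener_measurable[OF f] by (simp add: measurable_cong_sets[OF sets_P refl])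
  define D where "D z = exp (wiener f (fst z) - s / 2)" for z :: "(real \<Rightarrow> real) \<times> real"
  define g where "g x = exp (wiener f (\<Phi> x) - s / 2)" for x
  have gm: "g \<in> borel_measurable (path_borel {0..})"
    unfolding g_def[abs_def] using measurable_compose[OF \<Phi>m wm] by measurable
  have Dm: "D \<in> borel_measurable Q"
    unfolding D_def[abs_def] using measurable_compose[OF fst_path wm] by measurable
  have factor: "AE z in Q. D z = g (path_on {0..} z)"
    using Vz AE_positive_time AE_space
  proof eventually_elim
    fix z assume v: "V (path_on {0..} z) = snd z" and \<tau>: "0 < snd z" and z: "z \<in> space Q"
    have c: "0 < scale (snd z)" using scale_pos[OF \<tau>] .
    have w: "fst z \<in> extensional {0..}" using z by (auto simp: space_Q path_space_def)
    have "\<Phi> (path_on {0..} z) = fst z"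
    proof
      fix u
      show "\<Phi> (path_on {0..} z) u = fst z u"
      proof (cases "0 \<le> u")
        case True
        then have "\<Phi> (path_on {0..} z) u = path_on {0..} z (u * inverse (scale (snd z)))" by (simp add: \<Phi>_def v)
        then show ?thesis using True c by (simp add: path_on_def mult.assoc)
      next
        case False
        then show ?thesis using w by (simp add: \<Phi>_def extensional_def)
      qed
    qed
    then show "D z = g (path_on {0..} z)" by (simp add: D_def g_def)
  qed
  note X'm = shifted_path_on_measurable[OF I K_op_path[OF H f]]
  have change: "emeasure Q (shifted_path_on (K_op H f) {0..} -` A \<inter> space Q)
      = (\<integral>\<^sup>+z. ennreal (D z) * indicator A (path_on {0..} z) \<partial>Q)"
    if A: "A \<in> sets (path_borel {0..})" for A
    by (rule shifted_law[OF I X'm Dm, of "\<lambda>_. f"]) (use f A in \<open>auto simp: shifted_path_on_eq[OF I] D_def s_def\<close>)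
  note eq = equivalent_of_factored_density[OF pair.prob_space_axioms path_on_measurable[OF I] X'm Dm gm _ factor change]
  show "equivalent_measures (distr Q (path_borel {0..}) (shifted_path_on (K_op H f) {0..}))
      (distr Q (path_borel {0..}) (path_on {0..}))" by (rule eq(1)) (simp add: D_def)
  have "AE z in Q. RN_deriv (distr Q (path_borel {0..}) (path_on {0..}))
      (distr Q (path_borel {0..}) (shifted_path_on (K_op H f) {0..})) (path_on {0..} z) = ennreal (D z)"
    by (rule eq(2)) (simp add: D_def)
  then show "AE z in Q. RN_deriv (distr Q (path_borel {0..}) (path_on {0..}))
      (distr Q (path_borel {0..}) (shifted_path_on (K_op H f) {0..})) (path_on {0..} z)
      = ennreal (exp (wiener f (fst z) - s / 2))" by (simp add: D_def)
qed

text \<open>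
  The kernel at time \<open>t\<close> does not see the integrand after \<open>t\<close>.
\<close>

lemma truncated_K_op:
  assumes "0 \<le> t" "t \<le> q"
  shows "K_op H (\<lambda>s. f s * indicator {s. ennreal s \<le> ennreal q} s) t = K_op H f t"
proof -
  have e: "K_kernel H t r * (f r * indicator {s. ennreal s \<le> ennreal q} r) = K_kernel H t r * f r" for r
    using assms by (cases "r \<in> {0<..t}") (auto simp: K_kernel_support indicator_def ennreal_le_iff2)
  show ?thesis unfolding K_op_eq_inner[OF assms(1)] e ..
qed

lemma truncated_square_integral:
  fixes f :: "real \<Rightarrow> real"
  assumes "0 \<le> q"
  shows "(LINT s|lborel_pos. (f s * indicator {s. ennreal s \<le> ennreal q} s)\<^sup>2) = (LINT s:{0..q}|lborel. \<bar>f s\<bar>\<^sup>2)"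
proof -
  have "indicator {0..} s *\<^sub>R (f s * indicator {s. ennreal s \<le> ennreal q} s)\<^sup>2 = indicator {0..q} s *\<^sub>R \<bar>f s\<bar>\<^sup>2" for s
    using assms by (auto simp: indicator_def ennreal_le_iff2)
  then show ?thesis by (simp add: integral_restrict_space set_lebesgue_integral_def)
qed

lemma initial_square_integral_measurable:
  fixes f :: "real \<Rightarrow> real"
  assumes f: "f \<in> borel_measurable lborel_pos"
  shows "(\<lambda>t. LINT s:{0..t}|lborel. \<bar>f s\<bar>\<^sup>2) \<in> borel_measurable borel"
proof -
  define F where "F s = indicator {0..} s * f s" for s
  have [measurable]: "F \<in> borel_measurable borel"
    using f unfolding F_def[abs_def] measurable_lborel_pos_iff by simp
  have "(LINT s:{0..t}|lborel. \<bar>f s\<bar>\<^sup>2) = (LINT s|lborel. (if 0 \<le> s \<and> s \<le> t then (F s)\<^sup>2 else 0))" for t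
    unfolding set_lebesgue_integral_def
    by (intro Bochner_Integration.integral_cong) (auto simp: F_def indicator_def)
  moreover have "(\<lambda>t. LINT s|lborel. (if 0 \<le> s \<and> s \<le> t then (F s)\<^sup>2 else 0)) \<in> borel_measurable borel"
    by (rule lborel.borel_measurable_lebesgue_integral) measurable
  ultimately show ?thesis by simp
qed

text \<open>
  From the observed path on \<open>[0,T]\<close> one recovers \<open>\<tau>\<close> and the path \<open>w\<close> up to time \<open>T * scale \<tau>\<close>. On this
  stretch the shift agrees with the shift by the truncated integrand, whose Wiener integral is
  determined by the same stretch of \<open>w\<close>.
\<close>

theorem finite_horizon_density:
  assumes T: "0 < T" and f: "f \<in> L2 lborel_pos"
    and B: "is_underlying_bm H P \<delta> B" and Z: "is_integral_process P B f Z"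
  defines "N \<equiv> \<lambda>t. LINT s:{0..t}|lborel. \<bar>f s\<bar>\<^sup>2"
  shows "equivalent_measures (distr Q (path_borel {0..T}) (shifted_path_on (K_op H f) {0..T}))
      (distr Q (path_borel {0..T}) (path_on {0..T}))"
    and "AE z in Q. RN_deriv (distr Q (path_borel {0..T}) (path_on {0..T}))
      (distr Q (path_borel {0..T}) (shifted_path_on (K_op H f) {0..T})) (path_on {0..T} z)
      = ennreal (exp (Z (ennreal (T * scale (snd z))) (fst z) - N (T * scale (snd z)) / 2))"
proof -
  have I: "time_set {0..T}" using T by (intro time_set_interval) simp
  obtain V where V[measurable]: "V \<in> borel_measurable (path_borel {0..T})"
    and Vz: "AE z in Q. V (path_on {0..T} z) = snd z"
    using random_time_recovered[OF I _ T] T by auto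
  obtain L where L: "(\<lambda>(w, t). L w t) \<in> borel_measurable (path_borel {0..} \<Otimes>\<^sub>M borel)"
    and Ll: "\<And>w v t. 0 \<le> t \<Longrightarrow> (\<And>s. s \<in> {0..t} \<Longrightarrow> w s = v s) \<Longrightarrow> L w t = L v t"
    and LZ: "AE w in P. \<forall>t\<ge>0. L w t = Z (ennreal t) w"
    using integral_process_functional[OF B Z] by blast
  have Lm: "(\<lambda>x. L (\<phi> x) (k x)) \<in> borel_measurable M"
    if "\<phi> \<in> M \<rightarrow>\<^sub>M path_borel {0..}" "k \<in> borel_measurable M" for \<phi> k and M :: "'x measure"
    using measurable_compose[OF measurable_Pair[OF that] L] by simp
  define \<Phi> where "\<Phi> x = (\<lambda>u\<in>{0..}. x ((\<lambda>a u. min (u * a) T) (inverse (scale (V x))) u))" for x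
  have \<Phi>m: "\<Phi> \<in> path_borel {0..T} \<rightarrow>\<^sub>M path_borel {0..}"
    unfolding \<Phi>_def[abs_def]
    by (rule unscaled_path_measurable[OF I V]) (use T in \<open>auto intro!: continuous_intros\<close>)
  have Nm[measurable]: "N \<in> borel_measurable borel"
    unfolding N_def using f by (intro initial_square_integral_measurable) (simp add: L2_def)
  define D where "D z = exp (L (fst z) (T * scale (snd z)) - N (T * scale (snd z)) / 2)" for z :: "(real \<Rightarrow> real) \<times> real"
  define g where "g x = exp (L (\<Phi> x) (T * scale (V x)) - N (T * scale (V x)) / 2)" for x
  have gm: "g \<in> borel_measurable (path_borel {0..T})"
  proof -
    have [measurable]: "(\<lambda>x. L (\<Phi> x) (T * scale (V x))) \<in> borel_measurable (path_borel {0..T})"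
      by (rule Lm[OF \<Phi>m]) measurable
    show ?thesis unfolding g_def[abs_def] by measurable
  qed
  have Dm: "D \<in> borel_measurable Q"
  proof -
    have [measurable]: "(\<lambda>z. L (fst z) (T * scale (snd z))) \<in> borel_measurable Q"
      by (rule Lm[OF fst_path]) measurable
    show ?thesis unfolding D_def[abs_def] by measurable
  qed
  have factor: "AE z in Q. D z = g (path_on {0..T} z)"
    using Vz AE_positive_time
  proof eventually_elim
    fix z assume v: "V (path_on {0..T} z) = snd z" and \<tau>: "0 < snd z"
    have c: "0 < scale (snd z)" using scale_pos[OF \<tau>] .
    have "L (\<Phi> (path_on {0..T} z)) (T * scale (snd z)) = L (fst z) (T * scale (snd z))"
    proof (rule Ll)
      show "0 \<le> T * scale (snd z)" using T by simp
      fix s assume s: "s \<in> {0..T * scale (snd z)}"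
      then have "s * inverse (scale (snd z)) \<le> T" using c by (simp add: field_simps)
      moreover have "\<Phi> (path_on {0..T} z) s = path_on {0..T} z (min (s * inverse (scale (snd z))) T)"
        using s by (simp add: \<Phi>_def v)
      ultimately show "\<Phi> (path_on {0..T} z) s = fst z s"
        using s c by (simp add: path_on_def min_def mult.assoc)
    qed
    then show "D z = g (path_on {0..T} z)" by (simp add: D_def g_def v)
  qed
  note X'm = shifted_path_on_measurable[OF I K_op_path[OF H f]]
  define trunc where "trunc q s = f s * indicator {s. ennreal s \<le> ennreal q} s" for q s :: real
  have ZW: "has_wiener_integral P B (trunc q) (Z (ennreal q))" for q
    using Z by (simp add: is_integral_process_def trunc_def[abs_def])
  have tL: "trunc q \<in> L2 lborel_pos" for q using ZW[of q] by (simp add: has_wiener_integral_def)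
  have change: "emeasure Q (shifted_path_on (K_op H f) {0..T} -` A \<inter> space Q)
      = (\<integral>\<^sup>+z. ennreal (D z) * indicator A (path_on {0..T} z) \<partial>Q)"
    if A: "A \<in> sets (path_borel {0..T})" for A
  proof (rule shifted_law[OF I X'm Dm, of "\<lambda>\<tau>. trunc (T * scale \<tau>)"])
    show "trunc (T * scale \<tau>) \<in> L2 lborel_pos" for \<tau> by (rule tL)
    show "shifted_path_on (K_op H f) {0..T} (w, \<tau>) = path_on {0..T} (\<lambda>t\<in>{0..}. w t + K_op H (trunc (T * scale \<tau>)) t, \<tau>)" for w \<tau>
      unfolding shifted_path_on_def path_on_def
    proof (rule restrict_ext)
      fix t assume t: "t \<in> {0..T}"
      have "t * scale \<tau> \<le> T * scale \<tau>" using t by (intro mult_right_mono) auto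
      then have "K_op H (trunc (T * scale \<tau>)) (t * scale \<tau>) = K_op H f (t * scale \<tau>)"
        unfolding trunc_def[abs_def] using t by (intro truncated_K_op) auto
      then show "fst (w, \<tau>) (t * scale (snd (w, \<tau>))) + K_op H f (t * scale (snd (w, \<tau>)))
        = fst (\<lambda>t\<in>{0..}. w t + K_op H (trunc (T * scale \<tau>)) t, \<tau>) (t * scale (snd (\<lambda>t\<in>{0..}. w t + K_op H (trunc (T * scale \<tau>)) t, \<tau>)))"
        using t by simp
    qed
    fix \<tau> :: real
    have q: "0 \<le> T * scale \<tau>" using T by simp
    have "(LINT r|lborel_pos. (trunc (T * scale \<tau>) r)\<^sup>2) = N (T * scale \<tau>)"
      unfolding trunc_def N_def by (rule truncated_square_integral[OF q])
    then show "AE w in P. D (w, \<tau>) = exp (wiener (trunc (T * scale \<tau>)) w - (LINT r|lborel_pos. (trunc (T * scale \<tau>) r)\<^sup>2) / 2)"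
      using LZ wiener_integral_eq[OF B ZW[of "T * scale \<tau>"]]
      by (auto elim!: eventually_elim2 simp: D_def q)
  qed (rule A)
  note eq = equivalent_of_factored_density[OF pair.prob_space_axioms path_on_measurable[OF I] X'm Dm gm _ factor change]
  show "equivalent_measures (distr Q (path_borel {0..T}) (shifted_path_on (K_op H f) {0..T}))
      (distr Q (path_borel {0..T}) (path_on {0..T}))" by (rule eq(1)) (simp add: D_def)
  have "AE z in Q. RN_deriv (distr Q (path_borel {0..T}) (path_on {0..T}))
      (distr Q (path_borel {0..T}) (shifted_path_on (K_op H f) {0..T})) (path_on {0..T} z) = ennreal (D z)"
    by (rule eq(2)) (simp add: D_def)
  moreover have "AE z in Q. \<forall>t\<ge>0. L (fst z) t = Z (ennreal t) (fst z)" using LZ by (rule AE_fst)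
  ultimately show "AE z in Q. RN_deriv (distr Q (path_borel {0..T}) (path_on {0..T}))
      (distr Q (path_borel {0..T}) (shifted_path_on (K_op H f) {0..T})) (path_on {0..T} z)
      = ennreal (exp (Z (ennreal (T * scale (snd z))) (fst z) - N (T * scale (snd z)) / 2))"
    by eventually_elim (use T in \<open>simp add: D_def\<close>)
qed

end

section \<open>Generalized grey Brownian motion\<close>

lemma sets_Y_law: "sets (Y_law M) = sets lborel_pos"
  by (simp add: Y_law_def)

text \<open>
  At \<open>s = 0\<close> the Laplace transform is \<open>mittag_leffler \<beta> 0\<close>, whose series reduces to its first term.
\<close>

lemma M_density_integrable:
  assumes "is_M_density \<beta> M"
  shows "integrable lborel_pos M" "(LINT \<tau>|lborel_pos. M \<tau>) = 1"
proof -
  have "has_bochner_integral lborel_pos (\<lambda>\<tau>. exp (- 0 * \<tau>) * M \<tau>) (mittag_leffler \<beta> (- 0))"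
    using assms unfolding is_M_density_def by blast
  moreover have "mittag_leffler \<beta> (- 0) = 1"
  proof -
    have "(\<lambda>n. (- 0 :: real) ^ n / Gamma (\<beta> * real n + 1)) = (\<lambda>n. if n = 0 then 1 else 0)"
      by (auto simp: fun_eq_iff)
    moreover have "(\<Sum>n. if n = 0 then 1 else 0 :: real) = (\<Sum>n\<in>{0::nat}. if n = 0 then 1 else 0)"
      by (rule suminf_finite) auto
    ultimately show ?thesis unfolding mittag_leffler_def by simp
  qed
  ultimately have "has_bochner_integral lborel_pos M 1" by simp
  then show "integrable lborel_pos M" "(LINT \<tau>|lborel_pos. M \<tau>) = 1"
    by (auto dest: has_bochner_integral_integrable has_bochner_integral_integral_eq simp: has_bochner_integral_iff)
qed

lemma Y_law_prob_space:
  assumes M: "is_M_density \<beta> M"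
  shows "prob_space (Y_law M)"
proof (rule prob_spaceI)
  have m[measurable]: "M \<in> borel_measurable lborel_pos" using M_density_integrable(1)[OF M] by auto
  have "emeasure (Y_law M) (space (Y_law M)) = (\<integral>\<^sup>+\<tau>. ennreal (M \<tau>) * indicator (space lborel_pos) \<tau> \<partial>lborel_pos)"
    unfolding Y_law_def space_density
  proof (rule emeasure_density)
    show "(\<lambda>\<tau>. ennreal (M \<tau>)) \<in> borel_measurable lborel_pos" by measurable
  qed (rule sets.top)
  also have "\<dots> = (\<integral>\<^sup>+\<tau>. ennreal (M \<tau>) \<partial>lborel_pos)" by (intro nn_integral_cong) simp
  also have "\<dots> = ennreal (LINT \<tau>|lborel_pos. M \<tau>)"
  proof (rule nn_integral_eq_integral[OF M_density_integrable(1)[OF M]])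
    show "AE \<tau> in lborel_pos. 0 \<le> M \<tau>"
      using M by (intro AE_I2) (simp add: is_M_density_def space_restrict_space)
  qed
  finally show "emeasure (Y_law M) (space (Y_law M)) = 1" by (simp add: M_density_integrable(2)[OF M])
qed

lemma AE_Y_law_positive:
  assumes M: "is_M_density \<beta> M"
  shows "AE \<tau> in Y_law M. 0 < \<tau>"
proof -
  have m[measurable]: "M \<in> borel_measurable lborel_pos" using M_density_integrable(1)[OF M] by auto
  have "AE \<tau> in lborel. \<tau> \<in> {0::real..} \<longrightarrow> 0 < \<tau>"
    using AE_lborel_singleton[of 0] by eventually_elim auto
  then have "AE \<tau> in lborel_pos. 0 < \<tau>" by (subst AE_restrict_space_iff) auto
  then show ?thesis unfolding Y_law_def by (subst AE_density) (auto elim!: eventually_mono)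
qed

theorem theorem3p5:
  fixes \<beta> H :: real
    and h M :: "real \<Rightarrow> real"
    and P :: "(real \<Rightarrow> real) measure"
    and Q :: "((real \<Rightarrow> real) \<times> real) measure"
    and \<delta> :: "(real \<Rightarrow> real) \<Rightarrow> (real \<Rightarrow> real) \<Rightarrow> real"
    and B :: "real \<Rightarrow> (real \<Rightarrow> real) \<Rightarrow> real"
    and Z :: "ennreal \<Rightarrow> (real \<Rightarrow> real) \<Rightarrow> real"
  assumes "0 < \<beta>" "\<beta> < 1" "1/2 < H" "H < 1"
    and "h \<in> CM_space H"
    and "fbm_law H P"
    and "is_M_density \<beta> M"
    and "is_wiener_isometry H P \<delta>"
    and "is_underlying_bm H P \<delta> B"
    and "is_integral_process P B (CM_dot H h) Z"
    and "Q = P \<Otimes>\<^sub>M Y_law M"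
  shows "(\<forall>T>0.
           equivalent_measures (mu_shift_upto Q H h T) (mu_upto Q H T) \<and>
           (AE (w, \<tau>) in Q.
              (let t = T * \<tau> powr (1 / (2 * H)) in
                 RN_deriv (mu_upto Q H T) (mu_shift_upto Q H h T) (ggbm_upto H T (w, \<tau>))
                   = ennreal (exp (Z (ennreal t) w - 1/2 * CM_normsq_upto H h t)) \<and>
                 exp (Z (ennreal t) w - 1/2 * CM_normsq_upto H h t)
                   = stoch_exp (CM_dot H h) Z (ennreal t) w))) \<and>
         equivalent_measures (mu_shift Q H h) (mu Q H) \<and>
         (AE (w, \<tau>) in Q.
            RN_deriv (mu Q H) (mu_shift Q H h) (ggbm H (w, \<tau>))
              = ennreal (exp (\<delta> h w - 1/2 * CM_normsq H h)) \<and>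
            exp (\<delta> h w - 1/2 * CM_normsq H h)
              = stoch_exp (CM_dot H h) Z \<infinity> w)"

proof -
  define f where "f = CM_dot H h"
  have H: "1/2 < H" "H < 1" by fact+
  have f: "f \<in> L2 lborel_pos"
    unfolding f_def CM_dot_def using \<open>h \<in> CM_space H\<close> by (intro inv_into_into) (simp add: CM_space_def)
  have hf: "K_op H f = h"
    unfolding f_def CM_dot_def using \<open>h \<in> CM_space H\<close> by (intro f_inv_into_f[of _ "K_op H"]) (simp add: CM_space_def)
  have "prob_space P" using \<open>fbm_law H P\<close> by (simp add: fbm_law_def)
  then interpret tc: random_time_change P H \<delta> "Y_law M"
    using \<open>fbm_law H P\<close> \<open>is_wiener_isometry H P \<delta>\<close> H Y_law_prob_space[OF \<open>is_M_density \<beta> M\<close>] AE_Y_law_positive[OF \<open>is_M_density \<beta> M\<close>]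
    by (simp add: random_time_change_def wiener_isometry_def wiener_isometry_axioms_def random_time_change_axioms_def sets_Y_law)
  have g: "ggbm H = tc.path_on {0..}"
    by (auto simp: ggbm_def tc.path_on_def tc.scale_def fun_eq_iff)
  have gs: "ggbm_shift H h = tc.shifted_path_on h {0..}"
    by (auto simp: ggbm_shift_def tc.shifted_path_on_def tc.scale_def fun_eq_iff)
  have gT: "ggbm_upto H T = tc.path_on {0..T}" for T
    by (auto simp: ggbm_upto_def ggbm_def tc.path_on_def tc.scale_def fun_eq_iff restrict_def)
  have gsT: "ggbm_shift_upto H h T = tc.shifted_path_on h {0..T}" for T
    by (auto simp: ggbm_shift_upto_def ggbm_shift_def tc.shifted_path_on_def tc.scale_def fun_eq_iff restrict_def)
  have Q: "Q = tc.Q" by fact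
  note laws = mu_def mu_shift_def mu_upto_def mu_shift_upto_def g gs gT gsT Q
  have B: "is_underlying_bm H P \<delta> B" and Z: "is_integral_process P B f Z"
    using assms by (simp_all add: f_def)
  have stoch_exp_finite: "stoch_exp f Z (ennreal t) w = exp (Z (ennreal t) w - 1/2 * CM_normsq_upto H h t)"
    if "0 \<le> t" for t w
  proof -
    have "(LINT s|lborel_pos. indicator {s. ennreal s \<le> ennreal t} s * \<bar>f s\<bar>\<^sup>2)
        = (LINT s|lborel_pos. (f s * indicator {s. ennreal s \<le> ennreal t} s)\<^sup>2)"
      by (intro Bochner_Integration.integral_cong) (auto simp: indicator_def)
    then show ?thesis
      by (simp add: stoch_exp_def CM_normsq_upto_def f_def[symmetric] tc.truncated_square_integral[OF that])
  qed
  have normsq: "CM_normsq H h = (LINT s|lborel_pos. (f s)\<^sup>2)"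
    by (simp add: CM_normsq_def CM_inner_def f_def power2_eq_square)
  have part1: "equivalent_measures (mu_shift_upto Q H h T) (mu_upto Q H T) \<and>
      (AE (w, \<tau>) in Q.
        (let t = T * \<tau> powr (1 / (2 * H)) in
           RN_deriv (mu_upto Q H T) (mu_shift_upto Q H h T) (ggbm_upto H T (w, \<tau>))
             = ennreal (exp (Z (ennreal t) w - 1/2 * CM_normsq_upto H h t)) \<and>
           exp (Z (ennreal t) w - 1/2 * CM_normsq_upto H h t) = stoch_exp (CM_dot H h) Z (ennreal t) w))"
    if T: "T > 0" for T
  proof
    note fin = tc.finite_horizon_density[OF T f B Z, unfolded hf]
    show "equivalent_measures (mu_shift_upto Q H h T) (mu_upto Q H T)"
      unfolding laws by (rule fin(1))
    show "AE (w, \<tau>) in Q.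
        (let t = T * \<tau> powr (1 / (2 * H)) in
           RN_deriv (mu_upto Q H T) (mu_shift_upto Q H h T) (ggbm_upto H T (w, \<tau>))
             = ennreal (exp (Z (ennreal t) w - 1/2 * CM_normsq_upto H h t)) \<and>
           exp (Z (ennreal t) w - 1/2 * CM_normsq_upto H h t) = stoch_exp (CM_dot H h) Z (ennreal t) w)"
      unfolding laws using fin(2)
    proof eventually_elim
      case (elim z)
      obtain w \<tau> where z: "z = (w, \<tau>)" by (cases z)
      have "0 \<le> T * \<tau> powr (1 / (2 * H))" using T by simp
      then show ?case
        using elim stoch_exp_finite[of "T * \<tau> powr (1 / (2 * H))" w]
        by (simp add: z Let_def tc.scale_def CM_normsq_upto_def f_def)
    qed
  qed
  have ZI: "AE w in P. Z \<infinity> w = \<delta> h w"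
  proof -
    have "has_wiener_integral P B (\<lambda>s. f s * indicator {s. ennreal s \<le> \<infinity>} s) (Z \<infinity>)"
      using Z unfolding is_integral_process_def by blast
    then have "has_wiener_integral P B f (Z \<infinity>)" by simp
    from tc.wiener_integral_eq[OF B this] show ?thesis by (simp add: tc.wiener_def hf)
  qed
  note inf = tc.infinite_horizon_density[OF f, unfolded hf]
  have "equivalent_measures (mu_shift Q H h) (mu Q H)" unfolding laws by (rule inf(1))
  moreover have "AE (w, \<tau>) in Q.
      RN_deriv (mu Q H) (mu_shift Q H h) (ggbm H (w, \<tau>)) = ennreal (exp (\<delta> h w - 1/2 * CM_normsq H h)) \<and>
      exp (\<delta> h w - 1/2 * CM_normsq H h) = stoch_exp (CM_dot H h) Z \<infinity> w"
    unfolding laws using inf(2) tc.AE_fst[OF ZI]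
  proof eventually_elim
    case (elim z)
    then show ?case
      by (cases z) (simp add: tc.wiener_def hf normsq stoch_exp_def f_def[symmetric])
  qed
  ultimately show ?thesis using part1 by blast
qed

end
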